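(* Fix $\gamma>0$ and $\beta>0$, and let $k>\left|\dfrac{\gamma}{4\beta}\right|^{1/4}$. Then sufficiently small amplitude periodic traveling waves $\eta(\varepsilon;k)$ of the RMKP equation are transversely unstable with respect to co-periodic perturbations in the $x$-direction and periodic, long wavelength perturbations in the $y$-direction. That is: for every $\rho_0>0$ there is $\varepsilon_0>0$ such that for every $\varepsilon$ with $0<|\varepsilon|<\varepsilon_0$ there is $\rho$ with $0<|\rho|\le\rho_0$ at which the wave has a periodic instability.
   Context: Let $\mathbb T=\mathbb R/2\pi\mathbb Z$. The rotation-modified Kadomtsev-Petviashvili (RMKP) equation for $u=u(x,y,t)$ is $(u_t-\beta u_{xxx}+(u^2)_x)_x-\gamma u+u_{yy}=0$, with $\gamma>0$, $\beta\in\mathbb R$. Periodic traveling waves. For $\beta>0$ let $k>0$ with $k\ne(\gamma/(\beta n^2))^{1/4}$ for all integers $n\ge2$. There is a known one-parameter family of $y$-independent solutions $u(x,t)=\eta(\varepsilon;k)(k(x-c(\varepsilon;k)t))$, $|\varepsilon|$ small, where $\eta$ is $2\pi$-periodic, even and smooth in $z=k(x-ct)$, $c$ is even in $\varepsilon$, $\eta$ and $c$ depend analytically on $\varepsilon,k$, and as $\varepsilon\to0$ $\eta(z)=\varepsilon\cos z+\varepsilon^2\eta_2\cos2z+\varepsilon^3\eta_3\cos3z+O(\varepsilon^4)$, $c=c_0+\varepsilon^2c_2+O(\varepsilon^4)$, with $\eta_2=\frac{2k^2}{3\gamma-12\beta k^4}$, $\eta_3=\frac{9k^2\eta_2}{8\gamma-72\beta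 k^4}$, $c_0=\frac{\gamma}{k^2}+\beta k^2$, $c_2=\eta_2$. Spectral problem. Linearizing the RMKP equation about $\eta$ in the frame $z=k(x-ct)$ and taking perturbations $e^{\lambda t/k+i\rho y}\varphi(z)$, $\lambda\in\mathbb C$, $\rho\in\mathbb R$, gives $\mathcal G_\varepsilon(\lambda,\rho)\varphi=0$ with $\mathcal G_\varepsilon(\lambda,\rho)=\lambda\partial_z-k^2\partial_z^2(c+\beta k^2\partial_z^2-2\eta)-\rho^2-\gamma$. For $\rho\neq0$, the wave has a periodic instability at $\rho$ if there is $\lambda\in\mathbb C$ with $\operatorname{Re}\lambda>0$ such that $\mathcal G_\varepsilon(\lambda,\rho)$, acting in $L^2(\mathbb T)$ with domain $H^4(\mathbb T)$, is not invertible. "Long wavelength" in $y$ means $\rho\ne0$ close to $0$. *)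

theory Defs
  imports "HOL-Analysis.Analysis" "HOL-Library.Landau_Symbols"
begin

section \<open>The RMKP equation and its periodic traveling waves\<close>

definition smooth :: "(real \<Rightarrow> real) \<Rightarrow> bool" where
  "smooth f \<longleftrightarrow> (\<forall>n x. ((deriv ^^ n) f) differentiable (at x))"

text \<open>Functions on the torus are represented by \<open>2\<pi>\<close>-periodic functions on the line.\<close>

definition periodic :: "(real \<Rightarrow> 'a) \<Rightarrow> bool" where
  "periodic f \<longleftrightarrow> (\<forall>z. f (z + 2 * pi) = f z)"

text \<open>\<open>u x y t\<close> satisfies \<open>(u\<^sub>t - \<beta> u\<^sub>x\<^sub>x\<^sub>x + (u\<^sup>2)\<^sub>x)\<^sub>x - \<gamma> u + u\<^sub>y\<^sub>y = 0\<close> pointwise; it is only used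
  for smooth \<open>u\<close>, where every \<^const>\<open>deriv\<close> below is a genuine partial derivative.\<close>

definition solves_RMKP :: "real \<Rightarrow> real \<Rightarrow> (real \<Rightarrow> real \<Rightarrow> real \<Rightarrow> real) \<Rightarrow> bool" where
  "solves_RMKP \<beta> \<gamma> u \<longleftrightarrow> (\<forall>x y t.
     deriv (\<lambda>x'. deriv (\<lambda>t'. u x' y t') t
                 - \<beta> * (deriv ^^ 3) (\<lambda>x''. u x'' y t) x'
                 + deriv (\<lambda>x''. (u x'' y t)\<^sup>2) x') x
     - \<gamma> * u x y t
     + (deriv ^^ 2) (\<lambda>y'. u x y' t) y = 0)"

definition real_analytic2_at :: "(real \<Rightarrow> real \<Rightarrow> 'b::real_normed_vector) \<Rightarrow> real \<Rightarrow> real \<Rightarrow> bool" where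
  "real_analytic2_at f a b \<longleftrightarrow> (\<exists>r>0. \<exists>A :: nat \<Rightarrow> nat \<Rightarrow> 'b. \<forall>h l.
     \<bar>h\<bar> < r \<and> \<bar>l\<bar> < r \<longrightarrow>
       ((\<lambda>(i, j). (h ^ i * l ^ j) *\<^sub>R A i j) has_sum f (a + h) (b + l)) UNIV)"

definition nonresonant :: "real \<Rightarrow> real \<Rightarrow> real \<Rightarrow> bool" where
  "nonresonant \<beta> \<gamma> k \<longleftrightarrow> (\<forall>n::nat. n \<ge> 2 \<longrightarrow> k \<noteq> root 4 (\<gamma> / (\<beta> * (real n)\<^sup>2)))"

definition eta2 :: "real \<Rightarrow> real \<Rightarrow> real \<Rightarrow> real" where
  "eta2 \<beta> \<gamma> k = 2 * k\<^sup>2 / (3 * \<gamma> - 12 * \<beta> * k ^ 4)"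

definition eta3 :: "real \<Rightarrow> real \<Rightarrow> real \<Rightarrow> real" where
  "eta3 \<beta> \<gamma> k = 9 * k\<^sup>2 * eta2 \<beta> \<gamma> k / (8 * \<gamma> - 72 * \<beta> * k ^ 4)"

definition speed0 :: "real \<Rightarrow> real \<Rightarrow> real \<Rightarrow> real" where
  "speed0 \<beta> \<gamma> k = \<gamma> / k\<^sup>2 + \<beta> * k\<^sup>2"

text \<open>\<open>\<eta> \<epsilon> k z\<close> and \<open>c \<epsilon> k\<close> are the profile and the speed. The set \<open>D\<close> makes ``\<open>\<bar>\<epsilon>\<bar>\<close> small''
  precise: it is a neighbourhood of \<open>{0} \<times> {k. k > 0, k nonresonant}\<close> on which the family lives;
  values of \<open>\<eta>\<close> and \<open>c\<close> outside \<open>D\<close> are irrelevant. Analytic dependence of the profile and the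
  remainder in its expansion are understood in the supremum norm in \<open>z\<close>, hence the passage
  to the Banach space of bounded continuous functions.\<close>

definition RMKP_wave_family ::
  "real \<Rightarrow> real \<Rightarrow> (real \<Rightarrow> real \<Rightarrow> real \<Rightarrow> real) \<Rightarrow> (real \<Rightarrow> real \<Rightarrow> real) \<Rightarrow> bool" where
  "RMKP_wave_family \<beta> \<gamma> \<eta> c \<longleftrightarrow> (\<exists>D :: (real \<times> real) set. open D \<and>
     (\<forall>k. k > 0 \<and> nonresonant \<beta> \<gamma> k \<longrightarrow> (0, k) \<in> D) \<and>
     (\<forall>\<epsilon> k. (\<epsilon>, k) \<in> D \<longrightarrow>
        k > 0 \<and> nonresonant \<beta> \<gamma> k \<and>
        solves_RMKP \<beta> \<gamma> (\<lambda>x y t. \<eta> \<epsilon> k (k * (x - c \<epsilon> k * t))) \<and>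
        periodic (\<eta> \<epsilon> k) \<and> (\<forall>z. \<eta> \<epsilon> k (- z) = \<eta> \<epsilon> k z) \<and> smooth (\<eta> \<epsilon> k) \<and>
        (- \<epsilon>, k) \<in> D \<and> c (- \<epsilon>) k = c \<epsilon> k \<and>
        real_analytic2_at (\<lambda>\<epsilon> k. Bcontfun (\<eta> \<epsilon> k)) \<epsilon> k \<and>
        real_analytic2_at c \<epsilon> k) \<and>
     (\<forall>k. k > 0 \<and> nonresonant \<beta> \<gamma> k \<longrightarrow>
        (\<exists>M. \<forall>\<^sub>F \<epsilon> in at 0. \<forall>z.
           \<bar>\<eta> \<epsilon> k z - (\<epsilon> * cos z + \<epsilon>\<^sup>2 * eta2 \<beta> \<gamma> k * cos (2 * z)
                       + \<epsilon> ^ 3 * eta3 \<beta> \<gamma> k * cos (3 * z))\<bar> \<le> M * \<epsilon> ^ 4) \<and>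
        (\<lambda>\<epsilon>. c \<epsilon> k - (speed0 \<beta> \<gamma> k + \<epsilon>\<^sup>2 * eta2 \<beta> \<gamma> k)) \<in> O[at 0](\<lambda>\<epsilon>. \<epsilon> ^ 4)))"


section \<open>Square-integrable functions and Sobolev spaces on the torus\<close>

text \<open>Elements of \<open>L\<^sup>2\<close> are represented by functions; equality in \<open>L\<^sup>2\<close> is equality almost
  everywhere.\<close>

definition L2_torus :: "(real \<Rightarrow> complex) set" where
  "L2_torus = {f. f \<in> borel_measurable lebesgue \<and> periodic f \<and>
     set_integrable lebesgue {0..2 * pi} (\<lambda>z. (cmod (f z))\<^sup>2)}"

definition L2_norm_torus :: "(real \<Rightarrow> complex) \<Rightarrow> real" where
  "L2_norm_torus f = sqrt (LINT z:{0..2 * pi}|lebesgue. (cmod (f z))\<^sup>2)"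

definition weak_deriv :: "(real \<Rightarrow> complex) \<Rightarrow> (real \<Rightarrow> complex) \<Rightarrow> bool" where
  "weak_deriv f g \<longleftrightarrow> f \<in> L2_torus \<and> g \<in> L2_torus \<and>
     (\<forall>\<psi>. smooth \<psi> \<and> periodic \<psi> \<longrightarrow>
        (LINT z:{0..2 * pi}|lebesgue. f z * of_real (deriv \<psi> z))
          = - (LINT z:{0..2 * pi}|lebesgue. g z * of_real (\<psi> z)))"

primrec H_torus :: "nat \<Rightarrow> (real \<Rightarrow> complex) set" where
  "H_torus 0 = L2_torus"
| "H_torus (Suc m) = {f. \<exists>g. weak_deriv f g \<and> g \<in> H_torus m}"


section \<open>The linearized operator and transverse instability\<close>

text \<open>The graph of \<open>\<Lambda> \<partial>\<^sub>z - k\<^sup>2 \<partial>\<^sub>z\<^sup>2 (c + \<beta> k\<^sup>2 \<partial>\<^sub>z\<^sup>2 - 2 \<eta>) - \<rho>\<^sup>2 - \<gamma>\<close> in \<open>L\<^sup>2\<close> with domain \<open>H\<^sup>4\<close>, where \<open>\<Lambda>\<close> is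
  the spectral parameter and \<open>c\<close>, \<open>\<eta>\<close> are the speed and the profile of one wave. Here
  \<open>\<phi>1\<close>, \<open>\<phi>2\<close> are the weak derivatives of \<open>\<phi>\<close>, and \<open>w2\<close> is the second weak derivative of
  \<open>(c + \<beta> k\<^sup>2 \<partial>\<^sub>z\<^sup>2 - 2 \<eta>) \<phi>\<close>.\<close>

definition G_graph ::
  "real \<Rightarrow> real \<Rightarrow> real \<Rightarrow> real \<Rightarrow> (real \<Rightarrow> real) \<Rightarrow> complex \<Rightarrow> real
     \<Rightarrow> ((real \<Rightarrow> complex) \<times> (real \<Rightarrow> complex)) set" where
  "G_graph \<beta> \<gamma> k c \<eta> \<Lambda> \<rho> = {(\<phi>, f). \<phi> \<in> H_torus 4 \<and> f \<in> L2_torus \<and>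
     (\<exists>\<phi>1 \<phi>2 w1 w2.
        weak_deriv \<phi> \<phi>1 \<and> weak_deriv \<phi>1 \<phi>2 \<and>
        weak_deriv (\<lambda>z. of_real c * \<phi> z + of_real (\<beta> * k\<^sup>2) * \<phi>2 z - 2 * of_real (\<eta> z) * \<phi> z) w1 \<and>
        weak_deriv w1 w2 \<and>
        (AE z in lebesgue.
           f z = \<Lambda> * \<phi>1 z - of_real (k\<^sup>2) * w2 z - of_real (\<rho>\<^sup>2) * \<phi> z - of_real \<gamma> * \<phi> z))}"

text \<open>Invertibility of an operator in \<open>L\<^sup>2\<close> given by its graph: bijective from its domain onto
  \<open>L\<^sup>2\<close>, modulo null sets, with bounded inverse.\<close>

definition invertible_L2 :: "((real \<Rightarrow> complex) \<times> (real \<Rightarrow> complex)) set \<Rightarrow> bool" where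
  "invertible_L2 T \<longleftrightarrow>
     (\<forall>f\<in>L2_torus. \<exists>\<phi>. (\<phi>, f) \<in> T \<and>
        (\<forall>\<phi>'. (\<phi>', f) \<in> T \<longrightarrow> (AE z in lebesgue. \<phi>' z = \<phi> z))) \<and>
     (\<exists>C. \<forall>(\<phi>, f)\<in>T. L2_norm_torus \<phi> \<le> C * L2_norm_torus f)"

definition periodic_instability_at ::
  "real \<Rightarrow> real \<Rightarrow> real \<Rightarrow> real \<Rightarrow> (real \<Rightarrow> real) \<Rightarrow> real \<Rightarrow> bool" where
  "periodic_instability_at \<beta> \<gamma> k c \<eta> \<rho> \<longleftrightarrow>
     \<rho> \<noteq> 0 \<and> (\<exists>\<Lambda>::complex. Re \<Lambda> > 0 \<and> \<not> invertible_L2 (G_graph \<beta> \<gamma> k c \<eta> \<Lambda> \<rho>))"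

end

theory Submission
  imports Defs
begin

text \<open>Sorted by parity, the real equation \<open>G \<phi> = f\<close> with \<open>\<Lambda> > 0\<close> couples the even part \<open>u\<close> and the odd part
  \<open>v\<close> of \<open>\<phi>\<close> by \<open>\<Lambda> \<partial>\<^sup>-\<^sup>1 v + E u = \<partial>\<^sup>-\<^sup>2 f\<close> and \<open>\<Lambda> \<partial>\<^sup>-\<^sup>1 u + E v = 0\<close> for even \<open>f\<close>, where
  \<open>E = - k\<^sup>2 (c + \<beta> k\<^sup>2 \<partial>\<^sup>2 - 2 \<eta>) - (\<rho>\<^sup>2 + \<gamma>) \<partial>\<^sup>-\<^sup>2\<close> is symmetric. For small \<open>\<epsilon>\<close> the form of \<open>E\<close> is positive
  on functions orthogonal to \<open>cos\<close> and \<open>sin\<close>. On odd functions it is positive for \<open>\<rho> \<noteq> 0\<close>, because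
  \<open>\<eta>'\<close> spans its kernel at \<open>\<rho> = 0\<close>; on even functions it is negative at
  \<open>cos z + 2 \<epsilon> \<eta>\<^sub>2 cos 2z\<close>, with value \<open>2 k\<^sup>2 \<eta>\<^sub>2 \<epsilon>\<^sup>2 + O(\<epsilon>\<^sup>3)\<close> up to a multiple of \<open>\<rho>\<^sup>2\<close>,
  and \<open>\<eta>\<^sub>2 < 0\<close> exactly in the assumed range of \<open>k\<close>.

  If \<open>G\<close> were invertible for every \<open>\<Lambda> > 0\<close>, then the first cosine coefficient of the solution of
  \<open>G \<phi> = - cos z\<close> would be a continuous function of \<open>\<Lambda>\<close>, negative near \<open>0\<close> and positive near
  \<open>\<infinity>\<close>. It cannot vanish, since its value is the sum of the two forms at \<open>(u, v)\<close>, and these are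
  positive when it is \<open>0\<close>.\<close>

section \<open>Uniqueness of Fourier coefficients\<close>

text \<open>The even test function is the start of the \<epsilon>-derivative of the wave.
  Differentiating the twice integrated profile equation in \<epsilon> shows that, for
  \<open>\<rho> = 0\<close> and up to a constant, E maps this derivative to
  \<open>k\<^sup>2 c'(\<epsilon>) \<eta>\<close>. The form there is thus
  \<open>k\<^sup>2 c'(\<epsilon>)\<close> times a pairing with \<eta>: the negative direction
  reflects that larger waves are slower. As its value is only of order
  \<open>\<epsilon>\<^sup>2\<close>, \<rho> has to be chosen after \<epsilon>.

  The obstacle is to get from one negative direction to a point of the spectrum without locating an
  eigenvalue. The coupling through \<open>\<Lambda> \<partial>\<^sup>-\<^sup>1\<close> is skew and
  drops out of the energy, so the sign of the first coefficient can be read off from comparison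
  functions alone. An unstable eigenvalue would show as a pole through which this coefficient
  changes sign; bounded inverses exclude a pole. Continuity in \<Lambda> needs care, since \<Lambda>
  multiplies the unbounded operator \<partial>; the quadratic growth of the multiplier of E makes up
  for it.\<close>

abbreviation circ :: "real set" where "circ \<equiv> {0..2 * pi}"

text \<open>Lebesgue differentiation: at almost every point the averages over shrinking intervals to
  its right converge to the value, and here they vanish. The endpoints join the null set because
  only intervals strictly inside are assumed.\<close>

lemma zero_if_interval_integrals_zero:
  fixes f :: "real \<Rightarrow> real"
  assumes f: "f integrable_on {a..b}"
    and zero: "\<And>x y. \<lbrakk>a < x; x < y; y < b\<rbrakk> \<Longrightarrow> integral {x..y} f = 0"
  obtains N where "negligible N" "\<And>x. x \<in> {a..b} - N \<Longrightarrow> f x = 0"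
proof -
  define g where "g x = (if x \<in> {a..b} then f x else 0)" for x
  have "g integrable_on UNIV"
    using f unfolding g_def integrable_restrict_UNIV .
  then have "g integrable_on cbox x y" for x y
    using integrable_on_subcbox by blast
  then obtain N where N: "negligible N"
    and lim: "\<And>x e. \<lbrakk>x \<notin> N; 0 < e\<rbrakk> \<Longrightarrow> \<exists>d>0. \<forall>h. 0 < h \<and> h < d \<longrightarrow>
                 norm (integral (cbox x (x + h *\<^sub>R One)) g /\<^sub>R h ^ DIM(real) - g x) < e"
    by (rule integrable_ccontinuous_explicit) (rule that)
  show thesis
  proof
    show "negligible (N \<union> {a, b})"
      using N by (simp add: negligible_Un)
  next
    fix x assume x: "x \<in> {a..b} - (N \<union> {a, b})"
    have "\<bar>f x\<bar> < e" if e: "e > 0" for e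
    proof -
      obtain d where d: "d > 0" and *: "\<And>h. 0 < h \<Longrightarrow> h < d \<Longrightarrow>
                 norm (integral (cbox x (x + h *\<^sub>R One)) g /\<^sub>R h ^ DIM(real) - g x) < e"
        using lim[OF _ e, of x] x by blast
      define h where "h = min (d / 2) ((b - x) / 2)"
      have h: "0 < h" "h < d" "x + h < b"
        using d x by (auto simp: h_def min_def field_simps)
      have "integral {x..x + h} g = integral {x..x + h} f"
        using x h by (intro integral_cong) (auto simp: g_def)
      also have "\<dots> = 0"
        using x h by (intro zero) auto
      finally show ?thesis
        using *[OF h(1,2)] x by (simp add: g_def)
    qed
    then show "f x = 0"
      by (meson order_less_irrefl zero_less_abs_iff)
  qed
qed

section \<open>Density of trigonometric polynomials on the circle\<close>

text \<open>Complex exponentials are taken as generators because a product of two of them is again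
  one, so closure under multiplication needs no product formulas.\<close>

inductive trig_poly :: "(real \<Rightarrow> complex) \<Rightarrow> bool" where
  cis: "trig_poly (\<lambda>z. cis (of_int n * z))"
| add: "trig_poly p \<Longrightarrow> trig_poly q \<Longrightarrow> trig_poly (\<lambda>z. p z + q z)"
| cmul: "trig_poly p \<Longrightarrow> trig_poly (\<lambda>z. a * p z)"

lemma trig_poly_mult:
  assumes "trig_poly p" "trig_poly q"
  shows "trig_poly (\<lambda>z. p z * q z)"
  using assms(1)
proof induction
  case (cis n)
  from assms(2) show ?case
  proof induction
    case (cis m)
    have "(\<lambda>z. cis (of_int n * z) * cis (of_int m * z)) = (\<lambda>z. cis (of_int (n + m) * z))"
      by (simp add: cis_mult algebra_simps)
    then show ?case using trig_poly.cis by metis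
  next
    case (add p q)
    then show ?case using trig_poly.add[OF add.IH] by (simp add: algebra_simps)
  next
    case (cmul p a)
    then show ?case using trig_poly.cmul[OF cmul.IH, of a] by (simp add: algebra_simps)
  qed
next
  case (add p q)
  then show ?case using trig_poly.add[OF add.IH] by (simp add: algebra_simps)
next
  case (cmul p a)
  then show ?case using trig_poly.cmul[OF cmul.IH, of a] by (simp add: algebra_simps)
qed

lemma trig_poly_const: "trig_poly (\<lambda>z. a)"
  using trig_poly.cmul[OF trig_poly.cis[of 0], of a] by simp

text \<open>Transfers density: polynomials are dense on the unit circle, and along
  \<open>cis\<close> they become trigonometric polynomials. The linear case is Euler's formula for
  the two coordinates.\<close>

lemma trig_poly_real_polynomial:
  fixes p :: "complex \<Rightarrow> real"
  assumes "real_polynomial_function p"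
  shows "trig_poly (\<lambda>z. of_real (p (cis z)))"
  using assms
proof induction
  case (linear f)
  interpret bounded_linear f by fact
  have f: "f w = Re w * f 1 + Im w * f \<i>" for w
  proof -
    have "w = Re w *\<^sub>R 1 + Im w *\<^sub>R \<i>"
      by (simp add: complex_eq_iff)
    then have "f w = f (Re w *\<^sub>R 1 + Im w *\<^sub>R \<i>)"
      by (rule arg_cong)
    also have "\<dots> = Re w * f 1 + Im w * f \<i>"
      unfolding add scaleR by simp
    finally show ?thesis .
  qed
  have "complex_of_real (f (cis z))
      = (of_real (f 1) / 2 + of_real (f \<i>) / (2 * \<i>)) * cis (of_int 1 * z)
        + (of_real (f 1) / 2 - of_real (f \<i>) / (2 * \<i>)) * cis (of_int (-1) * z)" for z
    by (subst f) (simp add: complex_eq_iff)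
  then have eq: "(\<lambda>z. complex_of_real (f (cis z)))
      = (\<lambda>z. (of_real (f 1) / 2 + of_real (f \<i>) / (2 * \<i>)) * cis (of_int 1 * z)
        + (of_real (f 1) / 2 - of_real (f \<i>) / (2 * \<i>)) * cis (of_int (-1) * z))"
    by (rule ext)
  show ?case
    unfolding eq by (intro trig_poly.intros)
next
  case (const c)
  show ?case by (rule trig_poly_const)
next
  case (add f g)
  then show ?case using trig_poly.add[OF add.IH] by simp
next
  case (mult f g)
  then show ?case using trig_poly_mult[OF mult.IH] by simp
qed

lemma zero_coefficients_trig_poly:
  fixes f :: "real \<Rightarrow> real"
  assumes C: "\<And>n::nat. ((\<lambda>z. f z * cos (real n * z)) has_integral 0) S"
    and S: "\<And>n::nat. ((\<lambda>z. f z * sin (real n * z)) has_integral 0) S"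
    and p: "trig_poly p"
  shows "((\<lambda>z. of_real (f z) * p z) has_integral 0) S"
  using p
proof induction
  case (cis n)
  \<comment> \<open>The assumptions cover natural frequencies only; negative exponents are reached
    through the sign in front of the sine.\<close>
  define m where "m = nat \<bar>n\<bar>"
  have "((\<lambda>z. of_real (f z * cos (real m * z))
      + (of_int (sgn n) * \<i>) * of_real (f z * sin (real m * z))) has_integral
      (of_real 0 + (of_int (sgn n) * \<i>) * of_real 0)) S"
    by (intro has_integral_add has_integral_mult_right has_integral_of_real C S)
  also have "(\<lambda>z. of_real (f z * cos (real m * z))
      + (of_int (sgn n) * \<i>) * of_real (f z * sin (real m * z)))
      = (\<lambda>z. of_real (f z) * cis (of_int n * z))"
    by (cases "n \<ge> 0"; cases "n = 0") (auto simp: m_def complex_eq_iff)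
  finally show ?case by simp
next
  case (add p q)
  then show ?case using has_integral_add[OF add.IH] by (simp add: algebra_simps)
next
  case (cmul p a)
  then show ?case using has_integral_mult_right[OF cmul.IH, of a] by (simp add: algebra_simps)
qed

text \<open>Stone-Weierstrass: replacing \<open>G\<close> by a polynomial within \<open>e\<close>
  changes the integral by at most \<open>e\<close> times the L1 norm \<open>K\<close> of
  \<open>f\<close>, and the polynomial contributes 0. Test functions are composed with
  \<open>cis\<close> so that they live on a compact set and are periodic by construction.\<close>

lemma zero_coefficients_continuous:
  fixes f :: "real \<Rightarrow> real" and G :: "complex \<Rightarrow> real"
  assumes f: "f absolutely_integrable_on circ"
    and C: "\<And>n::nat. ((\<lambda>z. f z * cos (real n * z)) has_integral 0) circ"
    and S: "\<And>n::nat. ((\<lambda>z. f z * sin (real n * z)) has_integral 0) circ"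
    and G: "continuous_on (sphere 0 1) G"
  shows "integral circ (\<lambda>z. f z * G (cis z)) = 0"
proof -
  define K where "K = integral circ (\<lambda>z. \<bar>f z\<bar>)"
  have fabs: "(\<lambda>z. \<bar>f z\<bar>) integrable_on circ" and fint: "f integrable_on circ"
    using f by (auto simp: absolutely_integrable_on_def)
  have cont: "continuous_on circ (\<lambda>z. H (cis z))" if "continuous_on (sphere 0 1) H" for H :: "complex \<Rightarrow> real"
    by (rule continuous_on_compose2[OF that]) (auto intro!: continuous_intros)
  have prod: "(\<lambda>z. f z * H (cis z)) integrable_on circ" if "continuous_on (sphere 0 1) H" for H :: "complex \<Rightarrow> real"
  proof -
    have "(\<lambda>z. H (cis z) * f z) absolutely_integrable_on circ"
      using cont[OF that] f
      by (intro absolutely_integrable_bounded_measurable_product_real)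
         (auto intro: continuous_imp_measurable_on_sets_lebesgue compact_imp_bounded compact_continuous_image)
    then show ?thesis
      by (simp add: mult.commute absolutely_integrable_on_def)
  qed
  have bound: "\<bar>integral circ (\<lambda>z. f z * G (cis z))\<bar> \<le> e * K" if "e > 0" for e
  proof -
    obtain p where p: "real_polynomial_function p" "\<And>x. x \<in> sphere 0 1 \<Longrightarrow> \<bar>G x - p x\<bar> < e"
      using Stone_Weierstrass_real_polynomial_function[OF compact_sphere G \<open>e > 0\<close>] by metis
    have pc: "continuous_on (sphere 0 1) p"
      using p(1) by (simp add: continuous_on_polymonial_function real_polynomial_function_eq)
    have "((\<lambda>z. of_real (f z) * of_real (p (cis z)) :: complex) has_integral 0) circ"
      by (rule zero_coefficients_trig_poly[OF C S trig_poly_real_polynomial[OF p(1)]])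
    from has_integral_Re[OF this] have "((\<lambda>z. f z * p (cis z)) has_integral 0) circ"
      by simp
    then have "integral circ (\<lambda>z. f z * G (cis z)) = integral circ (\<lambda>z. f z * G (cis z) - f z * p (cis z))"
      using prod[OF G] prod[OF pc] by (subst integral_diff) (auto simp: integral_unique)
    also have "\<bar>\<dots>\<bar> \<le> integral circ (\<lambda>z. e * \<bar>f z\<bar>)"
    proof -
      have "norm (f z * G (cis z) - f z * p (cis z)) \<le> e * \<bar>f z\<bar>" for z
      proof -
        have "\<bar>G (cis z) - p (cis z)\<bar> \<le> e" using p(2)[of "cis z"] by auto
        then have "\<bar>f z\<bar> * \<bar>G (cis z) - p (cis z)\<bar> \<le> \<bar>f z\<bar> * e" by (simp add: mult_left_mono)
        then show ?thesis by (simp add: abs_mult[symmetric] algebra_simps)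
      qed
      moreover have "(\<lambda>z. f z * G (cis z) - f z * p (cis z)) integrable_on circ"
        by (intro integrable_diff prod G pc)
      moreover have "(\<lambda>z. e * \<bar>f z\<bar>) integrable_on circ"
        using fabs by (rule integrable_on_mult_right)
      ultimately have "norm (integral circ (\<lambda>z. f z * G (cis z) - f z * p (cis z))) \<le> integral circ (\<lambda>z. e * \<bar>f z\<bar>)"
        by (intro integral_norm_bound_integral)
      then show ?thesis by simp
    qed
    also have "\<dots> = e * K" by (simp add: K_def)
    finally show ?thesis .
  qed
  have "K \<ge> 0" unfolding K_def by (intro integral_nonneg fabs) auto
  have "\<bar>integral circ (\<lambda>z. f z * G (cis z))\<bar> \<le> e" if "e > 0" for e
  proof -
    have "\<bar>integral circ (\<lambda>z. f z * G (cis z))\<bar> \<le> e / (K + 1) * K"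
      using that \<open>K \<ge> 0\<close> by (intro bound) simp
    also have "\<dots> \<le> e"
      using that \<open>K \<ge> 0\<close> by (simp add: field_simps)
    finally show ?thesis .
  qed
  then show ?thesis using field_le_epsilon[of "\<bar>integral circ (\<lambda>z. f z * G (cis z))\<bar>" 0] by simp
qed

text \<open>Lets an arc be cut out by a continuous function on the circle. The bound
  \<open>2 * pi - d\<close> keeps \<open>x\<close> away from the copies of the arc in the
  neighbouring periods.\<close>

lemma cos_gt_iff:
  assumes "0 \<le> d" "d \<le> pi" "\<bar>x\<bar> \<le> 2 * pi - d"
  shows "cos x > cos d \<longleftrightarrow> \<bar>x\<bar> < d"
proof -
  consider "\<bar>x\<bar> < d" | "d \<le> \<bar>x\<bar>" "\<bar>x\<bar> \<le> pi" | "pi \<le> \<bar>x\<bar>" by linarith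
  then show ?thesis
  proof cases
    case 1
    then show ?thesis using cos_monotone_0_pi[of "\<bar>x\<bar>" d] assms by simp
  next
    case 2
    then show ?thesis using cos_monotone_0_pi_le[of d "\<bar>x\<bar>"] assms by simp
  next
    case 3
    have "cos (2 * pi - \<bar>x\<bar>) = cos \<bar>x\<bar>" by (simp add: cos_diff)
    then show ?thesis using cos_monotone_0_pi_le[of d "2 * pi - \<bar>x\<bar>"] assms 3 by simp
  qed
qed

lemma zero_coefficients_interval:
  fixes f :: "real \<Rightarrow> real"
  assumes f: "f absolutely_integrable_on circ"
    and C: "\<And>n::nat. ((\<lambda>z. f z * cos (real n * z)) has_integral 0) circ"
    and S: "\<And>n::nat. ((\<lambda>z. f z * sin (real n * z)) has_integral 0) circ"
    and ab: "0 < a" "a < b" "b < 2 * pi"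
  shows "integral {a..b} f = 0"
proof -
  define z0 d where "z0 = (a + b) / 2" and "d = (b - a) / 2"
  \<comment> \<open>A ramp of slope \<open>j\<close>, cut off at 1, in the excess of
    \<open>cos (z - z0)\<close> over \<open>cos d\<close>. With \<open>z0\<close> the midpoint and
    \<open>d\<close> half the length, the excess is positive exactly on the open interval, so the
    \<open>G j\<close> increase to its indicator and dominated convergence applies.\<close>
  define G :: "nat \<Rightarrow> complex \<Rightarrow> real"
    where "G j w = min 1 (real j * max 0 (Re (w * cnj (cis z0)) - cos d))" for j w
  have Gcis: "G j (cis z) = min 1 (real j * max 0 (cos (z - z0) - cos d))" for j z
    by (simp add: G_def cis_cnj cis_mult)
  have "continuous_on (sphere 0 1) (G j)" for j
    unfolding G_def by (intro continuous_intros)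
  then have zero: "integral circ (\<lambda>z. f z * G j (cis z)) = 0" for j
    using zero_coefficients_continuous[OF f C S] by blast
  have lim: "(\<lambda>j. f z * G j (cis z)) \<longlonglongrightarrow> (if z \<in> {a<..<b} then f z else 0)" if "z \<in> circ" for z
  proof -
    have iff: "cos (z - z0) > cos d \<longleftrightarrow> z \<in> {a<..<b}"
      using that ab by (subst cos_gt_iff) (auto simp: z0_def d_def abs_if field_simps)
    show ?thesis
    proof (cases "z \<in> {a<..<b}")
      case True
      define m where "m = cos (z - z0) - cos d"
      have m: "m > 0" using True iff by (simp add: m_def)
      obtain J where J: "real J > 1 / m" using reals_Archimedean2 by blast
      have "G j (cis z) = 1" if "j \<ge> J" for j
      proof -
        have "real j * m \<ge> 1" using J that m
          by (smt (verit) divide_less_eq mult.commute of_nat_mono)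
        then show ?thesis using m by (simp add: Gcis m_def[symmetric])
      qed
      then have "eventually (\<lambda>j. f z * G j (cis z) = f z) sequentially"
        by (auto simp: eventually_sequentially)
      then show ?thesis using True by (simp add: tendsto_eventually)
    next
      case False
      then have "\<not> cos (z - z0) > cos d" using iff by simp
      then have "max 0 (cos (z - z0) - cos d) = 0" by simp
      then have "f z * G j (cis z) = 0" for j by (simp add: Gcis)
      moreover have "(if z \<in> {a<..<b} then f z else 0) = 0" by (simp only: False if_False)
      ultimately show ?thesis by (simp only: tendsto_const)
    qed
  qed
  have "(\<lambda>j. integral circ (\<lambda>z. f z * G j (cis z))) \<longlonglongrightarrow> integral circ (\<lambda>z. if z \<in> {a<..<b} then f z else 0)"
  proof (rule dominated_convergence(2))
    show "(\<lambda>z. f z * G j (cis z)) integrable_on circ" for j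
    proof -
      have "(\<lambda>z. G j (cis z) * f z) absolutely_integrable_on circ"
        using f unfolding G_def
        by (intro absolutely_integrable_bounded_measurable_product_real)
           (auto intro!: continuous_imp_measurable_on_sets_lebesgue compact_imp_bounded
               compact_continuous_image continuous_intros)
      then show ?thesis by (simp add: mult.commute absolutely_integrable_on_def)
    qed
    show "(\<lambda>z. \<bar>f z\<bar>) integrable_on circ"
      using f by (auto simp: absolutely_integrable_on_def)
    show "norm (f z * G j (cis z)) \<le> \<bar>f z\<bar>" for j z
    proof -
      have "\<bar>G j (cis z)\<bar> \<le> 1" by (auto simp: Gcis min_def)
      then show ?thesis by (simp add: abs_mult mult_left_le)
    qed
  qed (use lim in auto)
  then have "integral circ (\<lambda>z. if z \<in> {a<..<b} then f z else 0) = 0"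
    using zero by (simp add: LIMSEQ_const_iff)
  moreover have "integral circ (\<lambda>z. if z \<in> {a<..<b} then f z else 0) = integral {a<..<b} f"
    using ab by (subst integral_restrict_Int) (auto intro!: arg_cong[of _ _ "\<lambda>S. integral S f"])
  ultimately show ?thesis
    by (simp add: integral_open_interval_real)
qed

theorem fourier_uniqueness:
  fixes f :: "real \<Rightarrow> real"
  assumes f: "f absolutely_integrable_on circ"
    and C: "\<And>n::nat. integral circ (\<lambda>z. f z * cos (real n * z)) = 0"
    and S: "\<And>n::nat. integral circ (\<lambda>z. f z * sin (real n * z)) = 0"
  obtains N where "negligible N" "\<And>z. z \<in> circ - N \<Longrightarrow> f z = 0"
proof -
  have int: "(\<lambda>z. f z * h z) integrable_on circ" if "continuous_on circ h" for h
  proof -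
    have "(\<lambda>z. h z * f z) absolutely_integrable_on circ"
      using f that
      by (intro absolutely_integrable_bounded_measurable_product_real)
         (auto intro!: continuous_imp_measurable_on_sets_lebesgue compact_imp_bounded
               compact_continuous_image)
    then show ?thesis by (simp add: mult.commute absolutely_integrable_on_def)
  qed
  have "((\<lambda>z. f z * cos (real n * z)) has_integral 0) circ" for n :: nat
    using integrable_integral[OF int, of "\<lambda>z. cos (real n * z)"] C[of n]
    by (simp add: continuous_intros)
  moreover have "((\<lambda>z. f z * sin (real n * z)) has_integral 0) circ" for n :: nat
    using integrable_integral[OF int, of "\<lambda>z. sin (real n * z)"] S[of n]
    by (simp add: continuous_intros)
  ultimately have "integral {x..y} f = 0" if "0 < x" "x < y" "y < 2 * pi" for x y
    using zero_coefficients_interval[OF f] that by blast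
  moreover have "f integrable_on circ"
    using f by (auto simp: absolutely_integrable_on_def)
  ultimately show thesis
    using zero_if_interval_integrals_zero that by blast
qed

section \<open>Absolutely convergent Fourier series\<close>

text \<open>Index \<open>n\<close> stands for frequency \<open>n + 1\<close>: only functions of mean
  zero are expanded. The phase \<open>b\<close> covers cosines (\<open>0\<close>) and sines
  (\<open>sinph\<close>) at once, so both parities share their lemmas.\<close>

definition fbasis :: "real \<Rightarrow> nat \<Rightarrow> real \<Rightarrow> real" where
  "fbasis b n z = cos (real (Suc n) * z + b)"

definition fser :: "real \<Rightarrow> (nat \<Rightarrow> real) \<Rightarrow> real \<Rightarrow> real" where
  "fser b A z = (\<Sum>n. A n * fbasis b n z)"

abbreviation sinph :: real where "sinph \<equiv> - (pi / 2)"

lemma fbasis_cos: "fbasis 0 n z = cos (real (Suc n) * z)"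
  and fbasis_sin: "fbasis sinph n z = sin (real (Suc n) * z)"
  by (simp_all add: fbasis_def cos_diff)

lemma abs_fbasis_le: "\<bar>fbasis b n z\<bar> \<le> 1"
  by (simp add: fbasis_def)

lemma continuous_fbasis [continuous_intros]: "continuous_on S (fbasis b n)"
  unfolding fbasis_def by (intro continuous_intros)

lemma absolutely_integrable_times_continuous:
  fixes f h :: "real \<Rightarrow> real"
  assumes "f absolutely_integrable_on {a..b}" "continuous_on {a..b} h"
  shows "(\<lambda>z. f z * h z) absolutely_integrable_on {a..b}"
proof -
  have "(\<lambda>z. h z * f z) absolutely_integrable_on {a..b}"
    using assms
    by (intro absolutely_integrable_bounded_measurable_product_real)
       (auto intro!: continuous_imp_measurable_on_sets_lebesgue compact_imp_bounded
             compact_continuous_image)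
  then show ?thesis by (simp add: mult.commute)
qed

lemma uniform_limit_fser:
  assumes "summable (\<lambda>n. \<bar>A n\<bar>)"
  shows "uniform_limit UNIV (\<lambda>N z. \<Sum>n<N. A n * fbasis b n z) (fser b A) sequentially"
  unfolding fser_def[abs_def]
  by (rule Weierstrass_m_test[of _ _ "\<lambda>n. \<bar>A n\<bar>"])
     (use assms in \<open>auto simp: abs_mult intro!: mult_left_le abs_fbasis_le\<close>)

lemma summable_fser:
  assumes "summable (\<lambda>n. \<bar>A n\<bar>)"
  shows "summable (\<lambda>n. A n * fbasis b n z)"
  by (rule summable_comparison_test'[OF assms, of 0])
     (auto simp: abs_mult intro!: mult_left_le abs_fbasis_le)

lemma continuous_fser:
  assumes "summable (\<lambda>n. \<bar>A n\<bar>)"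
  shows "continuous_on S (fser b A)"
proof -
  have "continuous_on UNIV (fser b A)"
    by (rule uniform_limit_theorem[OF _ uniform_limit_fser[OF assms]])
       (auto intro!: continuous_intros always_eventually)
  then show ?thesis
    by (rule continuous_on_subset) simp
qed

lemma fser_linear:
  assumes "summable (\<lambda>n. \<bar>A n\<bar>)" "summable (\<lambda>n. \<bar>A' n\<bar>)"
  shows "fser b (\<lambda>n. A n + r * A' n) z = fser b A z + r * fser b A' z"
proof -
  have "(\<lambda>n. A n * fbasis b n z + r * (A' n * fbasis b n z)) sums (fser b A z + r * fser b A' z)"
    unfolding fser_def by (intro sums_add sums_mult summable_sums summable_fser assms)
  then show ?thesis
    unfolding fser_def by (simp add: algebra_simps sums_iff)
qed

lemma fser_single: "fser b (\<lambda>n. if n = m then a else 0) z = a * fbasis b m z"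
  unfolding fser_def
  by (subst suminf_finite[of "{m}"]) auto

text \<open>Termwise integration by uniform convergence. Coefficient extraction, Parseval and the
  series of a quadratic form are all instances with different \<open>h\<close>.\<close>

lemma integral_times_fser:
  assumes A: "summable (\<lambda>n. \<bar>A n\<bar>)" and h: "continuous_on circ h"
  shows "(\<lambda>n. A n * integral circ (\<lambda>z. h z * fbasis b n z)) sums integral circ (\<lambda>z. h z * fser b A z)"
proof -
  have bdd: "bounded (h ` circ)" "bounded (fser b A ` circ)"
    using h continuous_fser[OF A] by (auto intro!: compact_imp_bounded compact_continuous_image)
  have int: "(\<lambda>z. h z * g z) integrable_on circ" if "continuous_on circ g" for g :: "real \<Rightarrow> real"
    using h that by (intro integrable_continuous_real continuous_intros)
  have "uniform_limit circ (\<lambda>N z. h z * (\<Sum>n<N. A n * fbasis b n z)) (\<lambda>z. h z * fser b A z) sequentially"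
    using bdd uniform_limit_on_subset[OF uniform_limit_fser[OF A]]
    by (intro uniform_lim_mult uniform_limit_const) auto
  moreover have "continuous_on circ (\<lambda>z. h z * (\<Sum>n<N. A n * fbasis b n z))" for N
    by (intro continuous_intros h)
  ultimately obtain I J where I: "\<And>N. ((\<lambda>z. h z * (\<Sum>n<N. A n * fbasis b n z)) has_integral I N) circ"
    and J: "((\<lambda>z. h z * fser b A z) has_integral J) circ" and lim: "I \<longlonglongrightarrow> J"
    by (rule uniform_limit_integral[OF _ _ trivial_limit_sequentially]) (rule that)
  have "I N = (\<Sum>n<N. A n * integral circ (\<lambda>z. h z * fbasis b n z))" for N
  proof -
    have "((\<lambda>z. \<Sum>n<N. A n * (h z * fbasis b n z)) has_integral
        (\<Sum>n<N. A n * integral circ (\<lambda>z. h z * fbasis b n z))) circ"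
      by (intro has_integral_sum has_integral_mult_right integrable_integral int continuous_intros) auto
    then have "((\<lambda>z. h z * (\<Sum>n<N. A n * fbasis b n z)) has_integral
        (\<Sum>n<N. A n * integral circ (\<lambda>z. h z * fbasis b n z))) circ"
      by (simp add: sum_distrib_left mult.left_commute)
    then show ?thesis using I[of N] has_integral_unique by blast
  qed
  then have "I = (\<lambda>N. \<Sum>n<N. A n * integral circ (\<lambda>z. h z * fbasis b n z))" by (rule ext)
  then have "(\<lambda>n. A n * integral circ (\<lambda>z. h z * fbasis b n z)) sums J"
    using lim unfolding sums_def by simp
  then show ?thesis using J by (simp add: integral_unique)
qed

lemma has_integral_cos_circ:
  fixes n :: int
  shows "((\<lambda>z. cos (of_int n * z + b)) has_integral (if n = 0 then 2 * pi * cos b else 0)) circ"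
proof (cases "n = 0")
  case True
  then show ?thesis using has_integral_const_real[of "cos b" 0 "2 * pi"] by simp
next
  case False
  have "((\<lambda>z. cos (of_int n * z + b)) has_integral
      (sin (of_int n * (2 * pi) + b) / of_int n - sin (of_int n * 0 + b) / of_int n)) circ"
    by (rule fundamental_theorem_of_calculus)
       (use False in \<open>auto intro!: derivative_eq_intros simp flip: has_real_derivative_iff_has_vector_derivative\<close>)
  moreover have "sin (of_int n * (2 * pi) + b) = sin b"
    using sin_int_2pin[of n] cos_int_2pin[of n] by (simp add: sin_add mult.commute)
  ultimately show ?thesis using False by simp
qed

lemma integral_fbasis: "integral circ (fbasis b n) = 0"
  using integral_unique[OF has_integral_cos_circ[of "int (Suc n)" b]]
  by (simp add: fbasis_def[abs_def])

lemma integral_fbasis_product: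
  "integral circ (\<lambda>z. fbasis b n z * fbasis b m z) = (if n = m then pi else 0)"
proof -
  have "fbasis b n z * fbasis b m z
      = (cos (of_int (int n - int m) * z + 0) + cos (of_int (int n + int m + 2) * z + 2 * b)) / 2" for z
    unfolding fbasis_def cos_times_cos by (simp add: algebra_simps)
  moreover have "((\<lambda>z. (cos (of_int (int n - int m) * z + 0)
      + cos (of_int (int n + int m + 2) * z + 2 * b)) / 2) has_integral (if n = m then pi else 0)) circ"
    using has_integral_divide[OF has_integral_add[OF has_integral_cos_circ[of "int n - int m" 0]
          has_integral_cos_circ[of "int n + int m + 2" "2 * b"]], of 2]
    by (simp split: if_splits)
  ultimately show ?thesis by (simp only: integral_unique)
qed

text \<open>For periodic functions, reflection at 0 is the same as \<open>2 * pi - z\<close>, which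
  maps \<open>circ\<close> to itself; parity is expressed in this way throughout.\<close>

lemma integral_circ_reflect:
  fixes g :: "real \<Rightarrow> real"
  shows "integral circ (\<lambda>z. g (2 * pi - z)) = integral circ g"
proof -
  have "integral circ (\<lambda>z. g (2 * pi - z)) = integral {- (2 * pi)..- 0} (\<lambda>z. g (2 * pi - (- z)))"
    by (subst Henstock_Kurzweil_Integration.integral_reflect_real) simp
  also have "\<dots> = integral {- (2 * pi)..0} (g \<circ> (+) (2 * pi))"
    by (simp add: o_def)
  also have "\<dots> = integral circ g"
    by (subst integral_shift_Icc_real) simp
  finally show ?thesis .
qed

lemma integral_circ_odd:
  fixes g :: "real \<Rightarrow> real"
  assumes "\<And>z. g (2 * pi - z) = - g z"
  shows "integral circ g = 0"
  using integral_circ_reflect[of g] assms by simp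


lemma fbasis_reflect:
  "fbasis 0 n (2 * pi - z) = fbasis 0 n z" "fbasis sinph n (2 * pi - z) = - fbasis sinph n z"
proof -
  have eq: "real (Suc n) * (2 * pi - z) = - (real (Suc n) * z) + 2 * pi * of_int (int (Suc n))"
    by (simp add: algebra_simps)
  show "fbasis 0 n (2 * pi - z) = fbasis 0 n z" "fbasis sinph n (2 * pi - z) = - fbasis sinph n z"
    unfolding fbasis_cos fbasis_sin eq cos_add sin_add by (simp_all only: cos_int_2pin sin_int_2pin) auto
qed

lemma fser_reflect:
  assumes "summable (\<lambda>n. \<bar>A n\<bar>)"
  shows "fser 0 A (2 * pi - z) = fser 0 A z" "fser sinph A (2 * pi - z) = - fser sinph A z"
  using suminf_minus[OF summable_fser[OF assms]]
  by (simp_all add: fser_def fbasis_reflect)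

lemma integral_fser_fbasis:
  assumes "summable (\<lambda>n. \<bar>A n\<bar>)"
  shows "integral circ (\<lambda>z. fser b A z * fbasis b m z) = pi * A m"
proof -
  have "(\<lambda>n. A n * integral circ (\<lambda>z. fbasis b m z * fbasis b n z)) sums
      integral circ (\<lambda>z. fbasis b m z * fser b A z)"
    by (intro integral_times_fser assms continuous_intros)
  moreover have "(\<lambda>n. A n * integral circ (\<lambda>z. fbasis b m z * fbasis b n z)) sums
      (\<Sum>n\<in>{m}. A n * integral circ (\<lambda>z. fbasis b m z * fbasis b n z))"
    by (rule sums_finite) (auto simp: integral_fbasis_product)
  ultimately have "integral circ (\<lambda>z. fbasis b m z * fser b A z)
      = (\<Sum>n\<in>{m}. A n * integral circ (\<lambda>z. fbasis b m z * fbasis b n z))"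
    by (rule sums_unique2)
  moreover have "(\<lambda>z. fser b A z * fbasis b m z) = (\<lambda>z. fbasis b m z * fser b A z)"
    by (simp add: mult.commute)
  ultimately show ?thesis
    by (simp add: integral_fbasis_product)
qed

lemma parseval:
  assumes "summable (\<lambda>n. \<bar>A n\<bar>)" "summable (\<lambda>n. \<bar>A' n\<bar>)"
  shows "(\<lambda>n. A n * A' n) sums (integral circ (\<lambda>z. fser b A z * fser b A' z) / pi)"
proof -
  have "(\<lambda>n. A' n * integral circ (\<lambda>z. fser b A z * fbasis b n z) / pi) sums
      (integral circ (\<lambda>z. fser b A z * fser b A' z) / pi)"
    by (intro sums_divide integral_times_fser assms continuous_fser)
  then show ?thesis
    unfolding integral_fser_fbasis[OF assms(1)] by (simp add: mult.commute)
qed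

lemma integral_fser:
  assumes "summable (\<lambda>n. \<bar>A n\<bar>)"
  shows "integral circ (fser b A) = 0"
proof -
  have "(\<lambda>n. A n * integral circ (\<lambda>z. 1 * fbasis b n z)) sums integral circ (\<lambda>z. 1 * fser b A z)"
    by (intro integral_times_fser assms continuous_intros)
  then have "(\<lambda>n. 0) sums integral circ (fser b A)"
    using integral_fbasis[of b] by simp
  then show ?thesis
    using sums_zero sums_unique2 by blast
qed

text \<open>Multiplication by an even function preserves parity. This is what splits the linearized
  equation into an even and an odd part coupled only through \<Lambda>.\<close>

lemma integral_cos_sin_even:
  assumes "\<And>z. h (2 * pi - z) = h z" and "summable (\<lambda>n. \<bar>A n\<bar>)"
  shows "integral circ (\<lambda>z. h z * fser 0 A z * fbasis sinph n z) = 0"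
    "integral circ (\<lambda>z. h z * fser sinph A z * fbasis 0 n z) = 0"
  by (rule integral_circ_odd; simp add: assms(1) fser_reflect[OF assms(2)] fbasis_reflect)+

text \<open>The difference between \<open>f\<close> and its series has no nonzero Fourier
  coefficient, so uniqueness applies; the assumption on the mean takes care of the constant mode,
  which the series lack.\<close>

lemma fourier_representation:
  fixes f :: "real \<Rightarrow> real"
  assumes f: "f absolutely_integrable_on circ" and mean: "integral circ f = 0"
    and A: "\<And>n. A n = integral circ (\<lambda>z. f z * fbasis 0 n z) / pi" "summable (\<lambda>n. \<bar>A n\<bar>)"
    and B: "\<And>n. B n = integral circ (\<lambda>z. f z * fbasis sinph n z) / pi" "summable (\<lambda>n. \<bar>B n\<bar>)"
  obtains N where "negligible N" "\<And>z. z \<in> circ - N \<Longrightarrow> f z = fser 0 A z + fser sinph B z"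
proof -
  define g where "g z = fser 0 A z + fser sinph B z" for z
  have g: "continuous_on circ g"
    unfolding g_def by (intro continuous_intros continuous_fser A B)
  have coef: "integral circ (\<lambda>z. (f z - g z) * fbasis b n z)
      = integral circ (\<lambda>z. f z * fbasis b n z) - integral circ (\<lambda>z. fser 0 A z * fbasis b n z)
        - integral circ (\<lambda>z. fser sinph B z * fbasis b n z)" for b n
  proof -
    have "(\<lambda>z. f z * fbasis b n z) integrable_on circ"
      using absolutely_integrable_times_continuous[OF f continuous_fbasis]
      by (simp add: absolutely_integrable_on_def)
    moreover have "(\<lambda>z. fser 0 A z * fbasis b n z) integrable_on circ"
      "(\<lambda>z. fser sinph B z * fbasis b n z) integrable_on circ"
      by (intro integrable_continuous_real continuous_intros continuous_fser A B)+
    ultimately have "((\<lambda>z. f z * fbasis b n z - fser 0 A z * fbasis b n z - fser sinph B z * fbasis b n z) has_integral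
       (integral circ (\<lambda>z. f z * fbasis b n z) - integral circ (\<lambda>z. fser 0 A z * fbasis b n z)
        - integral circ (\<lambda>z. fser sinph B z * fbasis b n z))) circ"
      by (intro has_integral_diff integrable_integral)
    then show ?thesis
      by (intro integral_unique) (simp add: g_def algebra_simps)
  qed
  have cross: "integral circ (\<lambda>z. fser 0 A z * fbasis sinph n z) = 0"
    "integral circ (\<lambda>z. fser sinph B z * fbasis 0 n z) = 0" for n
    using integral_cos_sin_even[of "\<lambda>z. 1" A n] integral_cos_sin_even[of "\<lambda>z. 1" B n] A B by simp_all
  have "integral circ (\<lambda>z. (f z - g z) * cos (real m * z)) = 0" for m
  proof (cases m)
    case 0
    have "((\<lambda>z. f z - (fser 0 A z + fser sinph B z)) has_integral 0 - (0 + 0)) circ"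
      using f mean A B
      by (intro has_integral_diff has_integral_add)
         (auto simp: has_integral_iff absolutely_integrable_on_def integral_fser
            intro!: integrable_continuous_real continuous_fser)
    then show ?thesis
      using 0 by (simp add: g_def integral_unique)
  next
    case (Suc n)
    then show ?thesis
      using coef[of 0 n] integral_fser_fbasis[OF A(2), of 0 n] cross A(1)[of n] by (simp add: fbasis_cos)
  qed
  moreover have "integral circ (\<lambda>z. (f z - g z) * sin (real m * z)) = 0" for m
  proof (cases m)
    case (Suc n)
    then show ?thesis
      using coef[of sinph n] integral_fser_fbasis[OF B(2), of sinph n] cross B(1)[of n]
      unfolding fbasis_sin by simp
  qed simp
  moreover have "(\<lambda>z. f z - g z) absolutely_integrable_on circ"
    by (intro set_integral_diff(1) f absolutely_integrable_continuous_real g)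
  ultimately obtain N where "negligible N" "\<And>z. z \<in> circ - N \<Longrightarrow> f z - g z = 0"
    using fourier_uniqueness[of "\<lambda>z. f z - g z"] by blast
  then show thesis
    by (intro that[of N]) (auto simp: g_def)
qed

section \<open>Quadratic forms on rapidly decaying sequences\<close>

text \<open>The power 4 is what coefficients of functions in \<open>H_torus 4\<close> satisfy. It
  leaves \<open>(n + 1)^2 * \<bar>A n\<bar>\<close> summable, enough for forms with quadratically
  growing weights and for the series of the derivative.\<close>

definition decay :: "(nat \<Rightarrow> real) \<Rightarrow> bool" where
  "decay A \<longleftrightarrow> (\<exists>C. \<forall>n. \<bar>A n\<bar> * real (Suc n) ^ 4 \<le> C)"

definition wsum :: "(nat \<Rightarrow> real) \<Rightarrow> (nat \<Rightarrow> real) \<Rightarrow> (nat \<Rightarrow> real) \<Rightarrow> real" where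
  "wsum w A C = (\<Sum>n. w n * A n * C n)"

text \<open>The bilinear form of a Fourier multiplier \<open>a\<close> plus multiplication by
  \<open>q\<close>, on series of phase \<open>b\<close>. Division by \<open>pi\<close> makes the
  basis functions orthonormal.\<close>

definition form :: "(nat \<Rightarrow> real) \<Rightarrow> (real \<Rightarrow> real) \<Rightarrow> real \<Rightarrow> (nat \<Rightarrow> real) \<Rightarrow> (nat \<Rightarrow> real) \<Rightarrow> real" where
  "form a q b A C = wsum a A C + integral circ (\<lambda>z. q z * (fser b A z * fser b C z)) / pi"

lemma summable_inverse_Suc_squared: "summable (\<lambda>n. 1 / real (Suc n) ^ 2)"
  using summable_Suc_iff[of "\<lambda>n. inverse (real n ^ 2)"] inverse_power_summable[of 2, where ?'a = real]
  by (simp add: field_simps)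

lemma decay_summable_squared:
  assumes "decay A"
  shows "summable (\<lambda>n. real (Suc n) ^ 2 * \<bar>A n\<bar>)"
proof -
  obtain C where C: "\<And>n. \<bar>A n\<bar> * real (Suc n) ^ 4 \<le> C"
    using assms by (auto simp: decay_def)
  have "real (Suc n) ^ 2 * \<bar>A n\<bar> \<le> C * (1 / real (Suc n) ^ 2)" for n
    using C[of n] by (simp add: field_simps del: of_nat_Suc flip: power_add)
  then show ?thesis
    by (intro summable_comparison_test'[OF summable_mult[OF summable_inverse_Suc_squared, of C], of 0]) auto
qed

lemma decay_bounded:
  assumes "decay A"
  obtains C where "C \<ge> 0" "\<And>n. \<bar>A n\<bar> \<le> C"
proof -
  obtain C where C: "\<And>n. \<bar>A n\<bar> * real (Suc n) ^ 4 \<le> C"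
    using assms by (auto simp: decay_def)
  have "\<bar>A n\<bar> \<le> C" for n
    using C[of n] mult_left_mono[of 1 "real (Suc n) ^ 4" "\<bar>A n\<bar>"] by simp
  moreover from this[of 0] have "C \<ge> 0" by linarith
  ultimately show thesis using that by blast
qed

lemma decay_summable:
  assumes "decay A"
  shows "summable (\<lambda>n. \<bar>A n\<bar>)"
proof (rule summable_comparison_test'[OF decay_summable_squared[OF assms], of 0])
  show "norm \<bar>A n\<bar> \<le> (real (Suc n))\<^sup>2 * \<bar>A n\<bar>" for n
    using mult_right_mono[of 1 "real (Suc n) ^ 2" "\<bar>A n\<bar>"] by simp
qed

lemma decay_linear:
  assumes "decay A" "decay C"
  shows "decay (\<lambda>n. A n + r * C n)"
proof -
  obtain a where a: "\<And>n. \<bar>A n\<bar> * real (Suc n) ^ 4 \<le> a"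
    using assms by (auto simp: decay_def)
  obtain c where c: "\<And>n. \<bar>C n\<bar> * real (Suc n) ^ 4 \<le> c"
    using assms by (auto simp: decay_def)
  have "\<bar>A n + r * C n\<bar> * real (Suc n) ^ 4 \<le> a + \<bar>r\<bar> * c" for n
  proof -
    have "\<bar>A n + r * C n\<bar> * real (Suc n) ^ 4 \<le> (\<bar>A n\<bar> + \<bar>r\<bar> * \<bar>C n\<bar>) * real (Suc n) ^ 4"
      by (intro mult_right_mono) (auto intro: order.trans[OF abs_triangle_ineq] simp: abs_mult)
    also have "\<dots> = \<bar>A n\<bar> * real (Suc n) ^ 4 + \<bar>r\<bar> * (\<bar>C n\<bar> * real (Suc n) ^ 4)"
      by (simp add: algebra_simps)
    also have "\<dots> \<le> a + \<bar>r\<bar> * c"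
      by (intro add_mono mult_left_mono a c) auto
    finally show ?thesis .
  qed
  then show ?thesis unfolding decay_def by blast
qed

lemma decay_finite_support:
  assumes "\<And>n. n \<ge> N \<Longrightarrow> A n = 0"
  shows "decay A"
proof -
  have "\<bar>A n\<bar> * real (Suc n) ^ 4 \<le> (\<Sum>i<N. \<bar>A i\<bar> * real (Suc i) ^ 4)" for n
  proof (cases "n < N")
    case True
    then show ?thesis by (intro member_le_sum) auto
  next
    case False
    then show ?thesis using assms by (simp add: sum_nonneg)
  qed
  then show ?thesis unfolding decay_def by blast
qed

text \<open>One sequence absorbs the quadratic weight, the other only has to be bounded.\<close>

lemma summable_wsum:
  assumes w: "\<And>n. \<bar>w n\<bar> \<le> K * real (Suc n) ^ 2" and "decay A" "decay C"
  shows "summable (\<lambda>n. w n * A n * C n)"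
proof -
  obtain c where c: "c \<ge> 0" "\<And>n. \<bar>C n\<bar> \<le> c"
    using decay_bounded[OF assms(3)] by blast
  have "norm (w n * A n * C n) \<le> K * c * (real (Suc n) ^ 2 * \<bar>A n\<bar>)" for n
  proof -
    have "\<bar>w n\<bar> * \<bar>A n\<bar> * \<bar>C n\<bar> \<le> (K * real (Suc n) ^ 2) * \<bar>A n\<bar> * c"
      using w[of n] c(2)[of n] by (intro mult_mono) auto
    then show ?thesis by (simp add: abs_mult mult_ac)
  qed
  then show ?thesis
    by (intro summable_comparison_test'[OF summable_mult[OF decay_summable_squared[OF assms(2)], of "K * c"], of 0]) auto
qed

lemma wsum_sums:
  assumes "\<And>n. \<bar>w n\<bar> \<le> K * real (Suc n) ^ 2" and "decay A" "decay C"
  shows "(\<lambda>n. w n * A n * C n) sums wsum w A C"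
  unfolding wsum_def by (rule summable_sums[OF summable_wsum[OF assms]])

lemma wsum_commute: "wsum w A C = wsum w C A"
  by (simp add: wsum_def mult_ac)

lemma one_weight: "\<bar>1\<bar> \<le> 1 * real (Suc n) ^ 2"
  by simp

lemma inverse_weight:
  "\<bar>1 / real (Suc n) ^ 2\<bar> \<le> 1 * real (Suc n) ^ 2" "\<bar>1 / real (Suc n)\<bar> \<le> 1 * real (Suc n) ^ 2"
proof -
  have "real (Suc n) \<ge> 1" by simp
  then have "real (Suc n) ^ 2 \<ge> 1" by (rule one_le_power)
  moreover have "1 / x \<le> 1" if "x \<ge> 1" for x :: real using that by simp
  ultimately show "\<bar>1 / real (Suc n) ^ 2\<bar> \<le> 1 * real (Suc n) ^ 2" "\<bar>1 / real (Suc n)\<bar> \<le> 1 * real (Suc n) ^ 2"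
    using \<open>real (Suc n) \<ge> 1\<close> by (smt (verit) divide_nonneg_nonneg)+
qed

lemma wsum_eq_0_iff:
  assumes w: "\<And>n. \<bar>w n\<bar> \<le> K * real (Suc n) ^ 2" and pos: "\<And>n. w n > 0" and "decay A"
  shows "wsum w A A \<ge> 0" "wsum w A A = 0 \<Longrightarrow> A n = 0"
proof -
  have s: "summable (\<lambda>n. w n * A n * A n)" and nn: "\<And>n. w n * A n * A n \<ge> 0"
    using summable_wsum[OF w assms(3,3)] pos by (auto simp: mult.assoc less_imp_le)
  show "wsum w A A \<ge> 0" unfolding wsum_def by (intro suminf_nonneg s nn)
  assume "wsum w A A = 0"
  then have "w n * A n * A n = 0"
    using suminf_eq_zero_iff[OF s nn] by (simp add: wsum_def)
  then show "A n = 0" using pos[of n] by auto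
qed

locale form_data =
  fixes a :: "nat \<Rightarrow> real" and q :: "real \<Rightarrow> real" and K h :: real
  assumes weight_bound: "\<bar>a n\<bar> \<le> K * real (Suc n) ^ 2"
    and q_continuous: "continuous_on circ q"
    and q_bound: "z \<in> circ \<Longrightarrow> \<bar>q z\<bar> \<le> h"
begin

lemma q_product_integrable:
  assumes "decay A" "decay C"
  shows "(\<lambda>z. q z * (fser b A z * fser b C z)) integrable_on circ"
  by (intro integrable_continuous_real continuous_intros q_continuous continuous_fser decay_summable assms)

lemma form_sums:
  assumes "decay A" "decay C"
  shows "(\<lambda>n. C n * (a n * A n + integral circ (\<lambda>z. q z * fser b A z * fbasis b n z) / pi)) sums form a q b A C"
proof -
  have "(\<lambda>n. C n * integral circ (\<lambda>z. q z * fser b A z * fbasis b n z)) sums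
      integral circ (\<lambda>z. q z * fser b A z * fser b C z)"
    by (intro integral_times_fser decay_summable assms continuous_intros q_continuous continuous_fser)
  from sums_add[OF wsum_sums[OF weight_bound assms] sums_divide[OF this, of pi]]
  show ?thesis
    by (simp add: form_def algebra_simps)
qed

text \<open>Passes from an equation mode by mode to its weak form, with \<open>C\<close> as test
  function.\<close>

lemma form_eq_suminf:
  assumes "decay A" "decay C"
    and "\<And>n. a n * A n + integral circ (\<lambda>z. q z * fser b A z * fbasis b n z) / pi = r n"
  shows "form a q b A C = (\<Sum>n. C n * r n)"
  using form_sums[OF assms(1,2), of b] by (simp add: assms(3) sums_iff)

lemma form_commute: "form a q b A C = form a q b C A"
  by (simp add: form_def wsum_commute mult.commute)

lemma form_linear:
  assumes "decay A" "decay A'" "decay C"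
  shows "form a q b (\<lambda>n. A n + r * A' n) C = form a q b A C + r * form a q b A' C"
proof -
  have "wsum a (\<lambda>n. A n + r * A' n) C = wsum a A C + r * wsum a A' C"
    using sums_add[OF wsum_sums[OF weight_bound assms(1,3)] sums_mult[OF wsum_sums[OF weight_bound assms(2,3)], of r]]
    by (simp add: wsum_def algebra_simps sums_iff)
  moreover have "integral circ (\<lambda>z. q z * (fser b (\<lambda>n. A n + r * A' n) z * fser b C z))
      = integral circ (\<lambda>z. q z * (fser b A z * fser b C z)) + r * integral circ (\<lambda>z. q z * (fser b A' z * fser b C z))"
  proof (rule integral_unique)
    have "((\<lambda>z. q z * (fser b A z * fser b C z) + r * (q z * (fser b A' z * fser b C z))) has_integral
      (integral circ (\<lambda>z. q z * (fser b A z * fser b C z)) + r * integral circ (\<lambda>z. q z * (fser b A' z * fser b C z)))) circ"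
      by (intro has_integral_add has_integral_mult_right integrable_integral q_product_integrable assms)
    then show "((\<lambda>z. q z * (fser b (\<lambda>n. A n + r * A' n) z * fser b C z)) has_integral
      (integral circ (\<lambda>z. q z * (fser b A z * fser b C z)) + r * integral circ (\<lambda>z. q z * (fser b A' z * fser b C z)))) circ"
      by (simp add: fser_linear[OF decay_summable[OF assms(1)] decay_summable[OF assms(2)]] algebra_simps)
  qed
  ultimately show ?thesis by (simp add: form_def field_simps)
qed

lemma form_square:
  assumes "decay A" "decay C"
  shows "form a q b (\<lambda>n. A n + r * C n) (\<lambda>n. A n + r * C n)
    = form a q b A A + 2 * r * form a q b A C + r\<^sup>2 * form a q b C C"
proof -
  have D: "decay (\<lambda>n. A n + r * C n)" by (rule decay_linear[OF assms])
  have "form a q b (\<lambda>n. A n + r * C n) (\<lambda>n. A n + r * C n)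
      = form a q b (\<lambda>n. A n + r * C n) A + r * form a q b (\<lambda>n. A n + r * C n) C"
    by (simp add: form_linear[OF assms D] form_commute[of b _ "\<lambda>n. A n + r * C n"])
  then show ?thesis
    by (simp add: form_linear assms form_commute[of b C A] algebra_simps power2_eq_square)
qed

lemma q_integral_bound:
  assumes "decay A"
  shows "\<bar>integral circ (\<lambda>z. q z * (fser b A z * fser b A z)) / pi\<bar> \<le> h * wsum (\<lambda>_. 1) A A"
proof -
  have int: "(\<lambda>z. fser b A z * fser b A z) integrable_on circ"
    by (intro integrable_continuous_real continuous_intros continuous_fser decay_summable assms)
  have "\<bar>integral circ (\<lambda>z. q z * (fser b A z * fser b A z))\<bar> \<le> integral circ (\<lambda>z. h * (fser b A z * fser b A z))"
  proof -
    have "norm (integral circ (\<lambda>z. q z * (fser b A z * fser b A z))) \<le> integral circ (\<lambda>z. h * (fser b A z * fser b A z))"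
      by (rule integral_norm_bound_integral[OF q_product_integrable[OF assms assms] integrable_on_mult_right[OF int]])
         (auto simp: abs_mult intro!: mult_right_mono q_bound)
    then show ?thesis by simp
  qed
  moreover have "wsum (\<lambda>_. 1) A A = integral circ (\<lambda>z. fser b A z * fser b A z) / pi"
    using parseval[OF decay_summable[OF assms] decay_summable[OF assms], of b] by (simp add: wsum_def sums_iff)
  ultimately have "\<bar>integral circ (\<lambda>z. q z * (fser b A z * fser b A z))\<bar> / pi \<le> (h * (pi * wsum (\<lambda>_. 1) A A)) / pi"
    by (intro divide_right_mono) auto
  then show ?thesis by simp
qed

text \<open>The potential costs at most \<open>h\<close> times the squared norm. The comparison is
  required only where \<open>A n\<close> is nonzero, so that the first mode can be left out when its
  coefficient vanishes.\<close>

lemma form_lower_bound: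
  assumes A: "decay A" and w: "\<And>n. \<bar>w n\<bar> \<le> K' * real (Suc n) ^ 2"
    and le: "\<And>n. A n \<noteq> 0 \<Longrightarrow> a n \<ge> w n + h"
  shows "form a q b A A \<ge> wsum w A A"
proof -
  have "wsum w A A + h * wsum (\<lambda>_. 1) A A \<le> wsum a A A"
  proof (rule sums_le)
    show "(\<lambda>n. w n * A n * A n + h * (1 * A n * A n)) sums (wsum w A A + h * wsum (\<lambda>_. 1) A A)"
      by (intro sums_add sums_mult wsum_sums[OF w A A] wsum_sums[OF one_weight A A])
    show "(\<lambda>n. a n * A n * A n) sums wsum a A A"
      by (rule wsum_sums[OF weight_bound A A])
    show "w n * A n * A n + h * (1 * A n * A n) \<le> a n * A n * A n" for n
    proof (cases "A n = 0")
      case False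
      from mult_right_mono[OF le[OF this], of "A n * A n"]
      show ?thesis by (simp add: algebra_simps)
    qed simp
  qed
  with q_integral_bound[OF A, of b] show ?thesis
    unfolding form_def abs_le_iff by linarith
qed

end


section \<open>An instability criterion in terms of quadratic forms\<close>

text \<open>Here \<open>a0\<close> is the multiplier of E at \<open>\<rho> = 0\<close>,
  \<open>p\<close> holds the sine coefficients of the translational mode, \<open>t\<close> is the
  even direction of negative energy, and \<open>gap\<close> says that beyond the first frequency the
  multiplier dominates the potential. Normalizing \<open>t 0\<close> to 1 lets a multiple of a
  solution be subtracted so as to cancel the first coefficient.\<close>

locale unstable_forms =
  fixes a0 :: "nat \<Rightarrow> real" and q :: "real \<Rightarrow> real" and K h \<kappa> \<rho> :: real and p t :: "nat \<Rightarrow> real"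
  assumes base: "form_data a0 q K h"
    and rho: "\<rho> \<noteq> 0" and kappa: "\<kappa> > 0"
    and gap: "n \<ge> 1 \<Longrightarrow> a0 n \<ge> \<kappa> + h"
    and p_decay: "decay p" and p0: "p 0 \<noteq> 0"
    and p_kernel: "a0 n * p n + integral circ (\<lambda>z. q z * fser sinph p z * fbasis sinph n z) / pi = 0"
    and t_decay: "decay t" and t0: "t 0 = 1"
    and t_negative: "form (\<lambda>n. a0 n + \<rho>\<^sup>2 / real (Suc n) ^ 2) q 0 t t < 0"
begin

definition a :: "nat \<Rightarrow> real" where "a n = a0 n + \<rho>\<^sup>2 / real (Suc n) ^ 2"

abbreviation "invsq \<equiv> (\<lambda>n. \<rho>\<^sup>2 / real (Suc n) ^ 2)"

lemma invsq_bound: "\<bar>invsq n\<bar> \<le> \<rho>\<^sup>2 * real (Suc n) ^ 2"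
  using mult_left_mono[OF inverse_weight(1)[of n], of "\<rho>\<^sup>2"] by simp

sublocale base: form_data a0 q K h by (rule base)

sublocale form_data a q "K + \<rho>\<^sup>2" h
proof
  show "\<bar>a n\<bar> \<le> (K + \<rho>\<^sup>2) * real (Suc n) ^ 2" for n
    using base.weight_bound[of n] invsq_bound[of n] abs_triangle_ineq[of "a0 n" "invsq n"]
    unfolding a_def distrib_right by linarith
qed (use base.q_continuous base.q_bound in auto)

lemma form_split:
  assumes "decay A" "decay C"
  shows "form a q b A C = form a0 q b A C + wsum invsq A C"
proof -
  have "wsum a A C = wsum a0 A C + wsum invsq A C"
    using sums_add[OF wsum_sums[OF base.weight_bound assms] wsum_sums[OF invsq_bound assms]]
    by (simp add: wsum_def a_def algebra_simps sums_iff)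
  then show ?thesis by (simp add: form_def)
qed

lemma invsq_nonneg: "decay A \<Longrightarrow> wsum invsq A A \<ge> 0" "decay A \<Longrightarrow> wsum invsq A A = 0 \<Longrightarrow> A n = 0"
  by (rule wsum_eq_0_iff[OF invsq_bound]; use rho in simp)+

lemma form_coercive:
  assumes "decay A" "A 0 = 0"
  shows "form a q b A A \<ge> wsum (\<lambda>_. \<kappa>) A A"
proof -
  have "form a0 q b A A \<ge> wsum (\<lambda>_. \<kappa>) A A"
  proof (rule base.form_lower_bound[OF assms(1)])
    show "\<bar>\<kappa>\<bar> \<le> \<kappa> * real (Suc n) ^ 2" for n
      using mult_left_mono[OF one_weight[of n], of \<kappa>] kappa by simp
    show "\<kappa> + h \<le> a0 n" if "A n \<noteq> 0" for n
      using that assms(2) gap[of n] by (cases n) auto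
  qed
  with invsq_nonneg(1)[OF assms(1)] show ?thesis by (simp add: form_split assms)
qed

lemma kappa_sum: "decay A \<Longrightarrow> wsum (\<lambda>_. \<kappa>) A A \<ge> 0" "decay A \<Longrightarrow> wsum (\<lambda>_. \<kappa>) A A = 0 \<Longrightarrow> A n = 0"
  by (rule wsum_eq_0_iff[where K = \<kappa>]; use kappa one_weight in \<open>simp add: mult_le_cancel_left1\<close>)+

text \<open>Up to a multiple of the zero mode \<open>p\<close>, every odd function has vanishing first coefficient.\<close>

lemma form_odd_lower_bound:
  assumes B: "decay B"
  shows "form a q sinph B B \<ge> wsum invsq B B"
proof -
  define r where "r = B 0 / p 0"
  define w where "w n = B n + (- r) * p n" for n
  have w: "decay w" unfolding w_def by (intro decay_linear B p_decay)
  have w0: "w 0 = 0" using p0 by (simp add: w_def r_def)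
  have kernel: "form a0 q sinph p C = 0" if "decay C" for C
    using base.form_eq_suminf[OF p_decay that p_kernel] by simp
  have "form a0 q sinph w w = form a0 q sinph B B + 2 * (- r) * form a0 q sinph B p + (- r)\<^sup>2 * form a0 q sinph p p"
    unfolding w_def by (rule base.form_square[OF B p_decay])
  \<comment> \<open>Since \<open>p\<close> lies in the kernel of the form at
    \<open>\<rho> = 0\<close>, removing a multiple of it costs nothing, while \<open>w\<close> has
    no first coefficient and is covered by the gap. The part of the form coming from \<rho> is kept
    at \<open>B\<close> and gives strict positivity.\<close>
  then have "form a0 q sinph w w = form a0 q sinph B B"
    using kernel[OF B] kernel[OF p_decay] by (simp add: base.form_commute[of _ B p])
  moreover have "form a0 q sinph w w \<ge> wsum (\<lambda>_. \<kappa>) w w"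
  proof (rule base.form_lower_bound[OF w])
    show "\<bar>\<kappa>\<bar> \<le> \<kappa> * real (Suc n) ^ 2" for n
      using mult_left_mono[OF one_weight[of n], of \<kappa>] kappa by simp
    show "\<kappa> + h \<le> a0 n" if "w n \<noteq> 0" for n
      using that w0 gap[of n] by (cases n) auto
  qed
  ultimately show ?thesis
    using kappa_sum(1)[OF w] by (simp add: form_split B)
qed

text \<open>\<open>A\<close> and \<open>B\<close> are the cosine and sine coefficients of a solution of \<open>G \<phi> = - cos z\<close>; the
  equation for frequency \<open>n + 1\<close> has been divided by \<open>- (n + 1)\<^sup>2\<close>.\<close>

definition solution :: "real \<Rightarrow> (nat \<Rightarrow> real) \<Rightarrow> (nat \<Rightarrow> real) \<Rightarrow> bool" where
  "solution \<Lambda> A B \<longleftrightarrow> decay A \<and> decay B \<and>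
     (\<forall>n. a n * A n + integral circ (\<lambda>z. q z * fser 0 A z * fbasis 0 n z) / pi
          = (if n = 0 then 1 else 0) + \<Lambda> * (B n / real (Suc n))) \<and>
     (\<forall>n. a n * B n + integral circ (\<lambda>z. q z * fser sinph B z * fbasis sinph n z) / pi
          = - (\<Lambda> * (A n / real (Suc n))))"

abbreviation coupling :: "(nat \<Rightarrow> real) \<Rightarrow> (nat \<Rightarrow> real) \<Rightarrow> real" where
  "coupling \<equiv> wsum (\<lambda>n. 1 / real (Suc n))"

lemma solution_even:
  assumes "solution \<Lambda> A B" "decay C"
  shows "form a q 0 A C = C 0 + \<Lambda> * coupling C B"
proof -
  have "(\<lambda>n. (if n = 0 then C n else 0) + \<Lambda> * (1 / real (Suc n) * C n * B n)) sums (C 0 + \<Lambda> * coupling C B)"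
    using assms by (intro sums_add sums_mult wsum_sums[OF inverse_weight(2)] sums_single) (auto simp: solution_def)
  moreover have "(\<lambda>n. (if n = 0 then C n else 0) + \<Lambda> * (1 / real (Suc n) * C n * B n))
      = (\<lambda>n. C n * ((if n = 0 then 1 else 0) + \<Lambda> * (B n / real (Suc n))))"
    by (auto simp: algebra_simps)
  ultimately show ?thesis
    using form_eq_suminf[of A C 0] assms by (simp add: solution_def sums_iff)
qed

lemma solution_odd:
  assumes "solution \<Lambda> A B" "decay C"
  shows "form a q sinph B C = - \<Lambda> * coupling A C"
proof -
  have "(\<lambda>n. - \<Lambda> * (1 / real (Suc n) * A n * C n)) sums (- \<Lambda> * coupling A C)"
    using assms by (intro sums_mult wsum_sums[OF inverse_weight(2)]) (auto simp: solution_def)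
  moreover have "(\<lambda>n. - \<Lambda> * (1 / real (Suc n) * A n * C n)) = (\<lambda>n. C n * - (\<Lambda> * (A n / real (Suc n))))"
    by (auto simp: algebra_simps)
  ultimately show ?thesis
    using form_eq_suminf[of B C sinph] assms by (simp add: solution_def sums_iff)
qed

text \<open>Testing each equation with its own unknown, the two coupling terms are opposite and
  cancel; only the source in the first mode is left.\<close>

lemma solution_energy:
  assumes "solution \<Lambda> A B"
  shows "form a q 0 A A + form a q sinph B B = A 0"
  using solution_even[OF assms, of A] solution_odd[OF assms, of B] assms by (simp add: solution_def)

lemma solution_nonzero:
  assumes sol: "solution \<Lambda> A B"
  shows "A 0 \<noteq> 0"
proof
  assume zero: "A 0 = 0"
  have A: "decay A" and B: "decay B" using sol by (auto simp: solution_def)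
  have "form a q 0 A A \<ge> wsum (\<lambda>_. \<kappa>) A A" "form a q sinph B B \<ge> wsum invsq B B"
    using form_coercive[OF A zero] form_odd_lower_bound[OF B] by auto
  then have "wsum (\<lambda>_. \<kappa>) A A = 0" "wsum invsq B B = 0"
    using solution_energy[OF sol] zero kappa_sum(1)[OF A] invsq_nonneg(1)[OF B] by linarith+
  then have "A = (\<lambda>n. 0)" "B = (\<lambda>n. 0)"
    using kappa_sum(2)[OF A] invsq_nonneg(2)[OF B] by blast+
  moreover have "a 0 * A 0 + integral circ (\<lambda>z. q z * fser 0 A z * fbasis 0 0 z) / pi = 1 + \<Lambda> * (B 0 / real (Suc 0))"
    using sol[unfolded solution_def, THEN conjunct2, THEN conjunct2, THEN conjunct1, rule_format, of 0]
    by simp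
  \<comment> \<open>With \<open>A\<close> and \<open>B\<close> zero the equation of the first mode
    reads \<open>0 = 1\<close>.\<close>
  ultimately show False by (simp add: fser_def)
qed

text \<open>The first coefficient is negative for small \<open>\<Lambda>\<close>: the reciprocal \<open>1 / A 0\<close> is a constrained
  minimum of the even form up to the coupling, and \<open>t\<close> is an admissible competitor.\<close>

lemma solution_small:
  obtains L where "L > 0" "\<And>\<Lambda> A B. \<lbrakk>0 < \<Lambda>; \<Lambda> < L; solution \<Lambda> A B\<rbrakk> \<Longrightarrow> A 0 < 0"
proof -
  \<comment> \<open>\<open>E\<close> is the depth of the negative direction and
    \<open>\<Lambda>\<^sup>2 * T\<close> the price of the coupling after Young's inequality;
    \<open>L\<close> is chosen to keep the price below the depth.\<close>
  define T E where "T = wsum (\<lambda>_. 1) t t / \<rho>\<^sup>2" and "E = - form a q 0 t t"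
  have E: "E > 0" using t_negative by (simp add: E_def a_def[abs_def])
  have T: "T \<ge> 0"
    unfolding T_def by (intro divide_nonneg_nonneg wsum_eq_0_iff(1)[OF one_weight] t_decay) auto
  define L where "L = sqrt (E / (T + 1))"
  show thesis
  proof
    show "L > 0" using E T by (simp add: L_def)
  next
    fix \<Lambda> A B assume \<Lambda>: "0 < \<Lambda>" "\<Lambda> < L" and sol: "solution \<Lambda> A B"
    have A: "decay A" and B: "decay B" using sol by (auto simp: solution_def)
    define m where "m = A 0"
    have m: "m \<noteq> 0" using solution_nonzero[OF sol] by (simp add: m_def)
    \<comment> \<open>The first coefficient of this combination vanishes, so the even form is
      nonnegative on it. Expanding the square turns this into an upper bound for
      \<open>1 / m\<close>.\<close>
    define w where "w n = t n + (- 1 / m) * A n" for n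
    have w: "decay w" unfolding w_def by (intro decay_linear A t_decay)
    have "w 0 = 0" using m t0 by (simp add: w_def m_def)
    then have "0 \<le> form a q 0 w w"
      using form_coercive[OF w, of 0] kappa_sum(1)[OF w] by linarith
    also have "form a q 0 w w = form a q 0 t t + 2 * (- 1 / m) * form a q 0 t A + (- 1 / m)\<^sup>2 * form a q 0 A A"
      unfolding w_def by (rule form_square[OF t_decay A])
    also have "form a q 0 t A = 1 + \<Lambda> * coupling t B"
      using solution_even[OF sol t_decay] t0 by (simp add: form_commute[of _ t A])
    also have "form a q 0 A A = m - form a q sinph B B"
      using solution_energy[OF sol] by (simp add: m_def)
    finally have 1: "0 \<le> - E + 2 * (- 1 / m) * (1 + \<Lambda> * coupling t B) + (- 1 / m)\<^sup>2 * (m - form a q sinph B B)"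
      by (simp add: E_def)
    \<comment> \<open>Young's inequality for the factors \<open>\<Lambda> * t n / \<rho>\<close> and
      \<open>\<rho> * B n / (n + 1)\<close>, the latter divided by \<open>m\<close>. The weight is
      chosen so that the term in \<open>B\<close> is exactly the lower bound of the odd form and can
      be absorbed by it.\<close>
    have 2: "2 * (- 1 / m) * \<Lambda> * coupling t B \<le> \<Lambda>\<^sup>2 * T + (- 1 / m)\<^sup>2 * wsum invsq B B"
    proof (rule sums_le)
      show "(\<lambda>n. 2 * (- 1 / m) * \<Lambda> * (1 / real (Suc n) * t n * B n)) sums (2 * (- 1 / m) * \<Lambda> * coupling t B)"
        by (intro sums_mult wsum_sums[OF inverse_weight(2) t_decay B])
      show "(\<lambda>n. \<Lambda>\<^sup>2 * ((1 * t n * t n) / \<rho>\<^sup>2) + (- 1 / m)\<^sup>2 * (invsq n * B n * B n)) sums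
          (\<Lambda>\<^sup>2 * T + (- 1 / m)\<^sup>2 * wsum invsq B B)"
        unfolding T_def by (intro sums_add sums_mult sums_divide wsum_sums[OF one_weight] wsum_sums[OF invsq_bound] t_decay B)
      fix n
      have "0 \<le> (\<Lambda> * t n / \<rho> - (- 1 / m) * \<rho> * B n / real (Suc n))\<^sup>2" by simp
      also have "\<dots> = \<Lambda>\<^sup>2 * ((1 * t n * t n) / \<rho>\<^sup>2) + (- 1 / m)\<^sup>2 * (invsq n * B n * B n)
          - 2 * (- 1 / m) * \<Lambda> * (1 / real (Suc n) * t n * B n)"
        using rho m by (simp add: power2_diff power_mult_distrib power_divide power2_eq_square field_simps del: of_nat_Suc)
      finally show "2 * (- 1 / m) * \<Lambda> * (1 / real (Suc n) * t n * B n)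
          \<le> \<Lambda>\<^sup>2 * ((1 * t n * t n) / \<rho>\<^sup>2) + (- 1 / m)\<^sup>2 * (invsq n * B n * B n)" by simp
    qed
    have 3: "(- 1 / m)\<^sup>2 * wsum invsq B B \<le> (- 1 / m)\<^sup>2 * form a q sinph B B"
      by (intro mult_left_mono form_odd_lower_bound B) simp
    have 4: "(- 1 / m)\<^sup>2 * (m - form a q sinph B B) = 1 / m - (- 1 / m)\<^sup>2 * form a q sinph B B"
      using m by (simp add: power2_eq_square field_simps)
    have "1 / m \<le> - E + \<Lambda>\<^sup>2 * T"
      using 1 2 3 unfolding 4 by (simp add: algebra_simps)
    also have "\<Lambda>\<^sup>2 * T < E"
    proof -
      have "\<Lambda>\<^sup>2 < L\<^sup>2" using \<Lambda> by (intro power_strict_mono) auto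
      also have "L\<^sup>2 = E / (T + 1)" using E T by (simp add: L_def)
      finally have "\<Lambda>\<^sup>2 * (T + 1) < E" using T by (simp add: field_simps)
      moreover have "\<Lambda>\<^sup>2 \<ge> 0" by simp
      ultimately show ?thesis by (simp only: distrib_left)
    qed
    finally have "1 / m < 0" by simp
    then show "A 0 < 0" by (simp add: m_def)
  qed
qed

text \<open>Let \<open>m\<close> be the first cosine coefficient and \<open>e\<close> the first
  mode. The odd equation tested with \<open>e\<close> gives \<open>- \<Lambda> * m\<close>, so
  nonnegativity of the odd form at \<open>B + m e\<close> bounds the odd energy below by
  \<open>m^2\<close> times \<open>2 * \<Lambda>\<close> minus a constant. The even energy is at
  least a constant times \<open>m^2\<close>. As the two energies add up to \<open>m\<close>, for
  large \<Lambda> the number \<open>m\<close> is at least a positive multiple of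
  \<open>m^2\<close>.\<close>

lemma solution_large:
  obtains L where "\<And>\<Lambda> A B. \<lbrakk>\<Lambda> > L; solution \<Lambda> A B\<rbrakk> \<Longrightarrow> A 0 > 0"
proof -
  define e :: "nat \<Rightarrow> real" where "e n = (if n = 0 then 1 else 0)" for n
  have e: "decay e" by (rule decay_finite_support[of 1]) (auto simp: e_def)
  have fser_e: "fser 0 e = fbasis 0 0"
    using fser_single[of 0 0 1] by (simp add: e_def[abs_def] fun_eq_iff)
  \<comment> \<open>The even form at the first mode, less the cost of the mixed term. Young's
    inequality splits that term into \<kappa> times the squared norm of \<open>w\<close>, which
    coercivity returns, and a multiple of \<open>h^2 / \<kappa>\<close>; the factor 2 is the length
    of the circle over the normalization \<open>pi\<close>.\<close>
  define M where "M = form a q 0 e e - 2 * h\<^sup>2 / \<kappa>"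
  define L where "L = (form a q sinph e e - M) / 2"
  show thesis
  proof
    fix \<Lambda> A B assume \<Lambda>: "\<Lambda> > L" and sol: "solution \<Lambda> A B"
    have A: "decay A" and B: "decay B" using sol by (auto simp: solution_def)
    define m where "m = A 0"
    have m: "m \<noteq> 0" using solution_nonzero[OF sol] by (simp add: m_def)
    have "coupling A e = (\<Sum>n. if n = 0 then A n else 0)"
      unfolding wsum_def by (rule suminf_cong) (auto simp: e_def)
    then have "coupling A e = m" using sums_single[of 0 A] by (simp add: m_def sums_iff)
    then have Be: "form a q sinph B e = - \<Lambda> * m"
      using solution_odd[OF sol e] by simp
    have "0 \<le> form a q sinph (\<lambda>n. B n + m * e n) (\<lambda>n. B n + m * e n)"
      using form_odd_lower_bound[OF decay_linear[OF B e]] invsq_nonneg(1)[OF decay_linear[OF B e]]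
      by (meson order.trans)
    also have "\<dots> = form a q sinph B B + 2 * m * (- \<Lambda> * m) + m\<^sup>2 * form a q sinph e e"
      by (simp only: form_square[OF B e] Be)
    finally have odd: "form a q sinph B B \<ge> m\<^sup>2 * (2 * \<Lambda> - form a q sinph e e)"
      by (simp add: algebra_simps power2_eq_square)
    define w where "w n = A n + (- m) * e n" for n
    have w: "decay w" unfolding w_def by (intro decay_linear A e)
    have w0: "w 0 = 0" by (simp add: w_def m_def e_def)
    have "(\<lambda>n. w n + m * e n) = A" by (simp add: w_def)
    then have AA: "form a q 0 A A = form a q 0 w w + 2 * m * form a q 0 w e + m\<^sup>2 * form a q 0 e e"
      using form_square[OF w e, of 0 m] by simp
    \<comment> \<open>The multiplier does not mix the first mode with the others, so only the
      potential contributes to the mixed term.\<close>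
    have "wsum a w e = 0"
      unfolding wsum_def using w0 by (subst suminf_finite[of "{}"]) (auto simp: e_def)
    then have we: "form a q 0 w e = integral circ (\<lambda>z. q z * (fser 0 w z * fbasis 0 0 z)) / pi"
      by (simp add: form_def fser_e)
    have mixed: "- (2 * h\<^sup>2 * m\<^sup>2 / \<kappa>) - wsum (\<lambda>_. \<kappa>) w w \<le> 2 * m * form a q 0 w e"
    proof -
      have "integral circ (\<lambda>z. - (h\<^sup>2 * m\<^sup>2 / \<kappa>) - \<kappa> * (fser 0 w z * fser 0 w z))
          \<le> integral circ (\<lambda>z. 2 * m * (q z * (fser 0 w z * fbasis 0 0 z)))"
      proof (rule integral_le)
        show "(\<lambda>z. - (h\<^sup>2 * m\<^sup>2 / \<kappa>) - \<kappa> * (fser 0 w z * fser 0 w z)) integrable_on circ"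
          "(\<lambda>z. 2 * m * (q z * (fser 0 w z * fbasis 0 0 z))) integrable_on circ"
          by (intro integrable_continuous_real continuous_intros q_continuous continuous_fser decay_summable w)+
      next
        fix z :: real assume z: "z \<in> circ"
        define x y where "x = m * q z * fbasis 0 0 z" and "y = fser 0 w z"
        have "\<bar>x\<bar> \<le> \<bar>m\<bar> * h * 1"
          unfolding x_def abs_mult by (intro mult_mono q_bound[OF z] abs_fbasis_le) (use q_bound[OF z] in auto)
        then have "\<bar>x\<bar> ^ 2 \<le> (\<bar>m\<bar> * h)\<^sup>2"
          by (intro power_mono) auto
        then have x: "x\<^sup>2 / \<kappa> \<le> h\<^sup>2 * m\<^sup>2 / \<kappa>"
          using kappa by (intro divide_right_mono) (auto simp: power_mult_distrib mult.commute)
        define s where "s = sqrt \<kappa>"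
        have s: "s > 0" "\<kappa> = s\<^sup>2"
          using kappa by (simp_all add: s_def)
        have "0 \<le> (x / s + s * y)\<^sup>2" by simp
        also have "\<dots> = x\<^sup>2 / \<kappa> + \<kappa> * (y * y) + 2 * (x * y)"
          using s by (simp add: power2_eq_square field_simps)
        finally have "- (x\<^sup>2 / \<kappa>) - \<kappa> * (y * y) \<le> 2 * (x * y)" by simp
        with x have "- (h\<^sup>2 * m\<^sup>2 / \<kappa>) - \<kappa> * (y * y) \<le> 2 * (x * y)" by linarith
        moreover have "2 * (x * y) = 2 * m * (q z * (fser 0 w z * fbasis 0 0 z))"
          by (simp add: x_def y_def)
        ultimately show "- (h\<^sup>2 * m\<^sup>2 / \<kappa>) - \<kappa> * (fser 0 w z * fser 0 w z) \<le> 2 * m * (q z * (fser 0 w z * fbasis 0 0 z))"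
          unfolding y_def by linarith
      qed
      also have "\<dots> = pi * (2 * m * form a q 0 w e)"
        by (simp add: we)
      finally have 1: "integral circ (\<lambda>z. - (h\<^sup>2 * m\<^sup>2 / \<kappa>) - \<kappa> * (fser 0 w z * fser 0 w z)) \<le> pi * (2 * m * form a q 0 w e)" .
      define I where "I = integral circ (\<lambda>z. fser 0 w z * fser 0 w z)"
      have "wsum (\<lambda>_. \<kappa>) w w = \<kappa> * (I / pi)"
        using sums_mult[OF parseval[OF decay_summable[OF w] decay_summable[OF w], of 0], of \<kappa>]
        by (simp add: wsum_def sums_iff mult.assoc I_def)
      then have 2: "\<kappa> * I = pi * wsum (\<lambda>_. \<kappa>) w w" by simp
      have "((\<lambda>z. - (h\<^sup>2 * m\<^sup>2 / \<kappa>)) has_integral pi * (- (2 * h\<^sup>2 * m\<^sup>2 / \<kappa>))) circ"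
        using has_integral_const_real[of "- (h\<^sup>2 * m\<^sup>2 / \<kappa>)" 0 "2 * pi"] by (simp add: mult_ac)
      moreover have "(\<lambda>z. fser 0 w z * fser 0 w z) integrable_on circ"
        by (intro integrable_continuous_real continuous_intros continuous_fser decay_summable w)
      then have "((\<lambda>z. \<kappa> * (fser 0 w z * fser 0 w z)) has_integral \<kappa> * I) circ"
        unfolding I_def by (intro has_integral_mult_right integrable_integral)
      ultimately have "((\<lambda>z. - (h\<^sup>2 * m\<^sup>2 / \<kappa>) - \<kappa> * (fser 0 w z * fser 0 w z)) has_integral
          (pi * (- (2 * h\<^sup>2 * m\<^sup>2 / \<kappa>)) - \<kappa> * I)) circ"
        by (rule has_integral_diff)
      from integral_unique[OF this] 1
      have "pi * (- (2 * h\<^sup>2 * m\<^sup>2 / \<kappa>) - wsum (\<lambda>_. \<kappa>) w w) \<le> pi * (2 * m * form a q 0 w e)"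
        unfolding 2 right_diff_distrib by linarith
      then show ?thesis by (rule mult_left_le_imp_le) simp
    qed
    have "form a q 0 A A \<ge> m\<^sup>2 * M"
    proof -
      have "m\<^sup>2 * M = m\<^sup>2 * form a q 0 e e - 2 * h\<^sup>2 * m\<^sup>2 / \<kappa>"
        by (simp add: M_def right_diff_distrib)
      moreover have "form a q 0 w w \<ge> wsum (\<lambda>_. \<kappa>) w w"
        by (rule form_coercive[OF w w0])
      ultimately show ?thesis using mixed unfolding AA by linarith
    qed
    moreover have "m\<^sup>2 * (2 * \<Lambda> - form a q sinph e e + M) = m\<^sup>2 * (2 * \<Lambda> - form a q sinph e e) + m\<^sup>2 * M"
      by (simp add: distrib_left)
    moreover have "form a q 0 A A + form a q sinph B B = m"
      using solution_energy[OF sol] by (simp add: m_def)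
    ultimately have "m \<ge> m\<^sup>2 * (2 * \<Lambda> - form a q sinph e e + M)"
      using odd by linarith
    moreover have "2 * \<Lambda> - form a q sinph e e + M > 0"
      using \<Lambda> by (simp add: L_def field_simps)
    then have "m\<^sup>2 * (2 * \<Lambda> - form a q sinph e e + M) > 0"
      using m by simp
    ultimately show "A 0 > 0" by (simp add: m_def)
  qed
qed

text \<open>Quadratic growth of the multiplier lets the energy identity control the derivative by
  the function itself. This is needed because changing \<Lambda> perturbs the operator by a multiple
  of the derivative, which is unbounded in L2.\<close>

lemma solution_derivative_bound:
  assumes "\<alpha> > 0" and coer: "\<And>n. a n \<ge> \<alpha> * real (Suc n) ^ 2 - M" and sol: "solution \<Lambda> A B"
  shows "\<alpha> * (wsum (\<lambda>n. real (Suc n) ^ 2) A A + wsum (\<lambda>n. real (Suc n) ^ 2) B B)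
    \<le> (M + h) * (wsum (\<lambda>_. 1) A A + wsum (\<lambda>_. 1) B B) + A 0"
proof -
  have A: "decay A" and B: "decay B" using sol by (auto simp: solution_def)
  have *: "\<alpha> * wsum (\<lambda>n. real (Suc n) ^ 2) C C \<le> (M + h) * wsum (\<lambda>_. 1) C C + form a q b C C" if C: "decay C" for C b
  proof -
    have "wsum (\<lambda>n. \<alpha> * real (Suc n) ^ 2 - M - h) C C \<le> form a q b C C"
    proof (rule form_lower_bound[OF C])
      show "\<bar>\<alpha> * real (Suc n) ^ 2 - M - h\<bar> \<le> (\<alpha> + \<bar>M\<bar> + \<bar>h\<bar>) * real (Suc n) ^ 2" for n
      proof -
        have "\<bar>M\<bar> + \<bar>h\<bar> \<le> (\<bar>M\<bar> + \<bar>h\<bar>) * real (Suc n) ^ 2"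
          by (intro mult_right_mono[of 1, simplified] mult_left_mono[of 1 _ "\<bar>M\<bar> + \<bar>h\<bar>", simplified]) auto
        moreover have "\<alpha> * real (Suc n) ^ 2 \<ge> 0" using \<open>\<alpha> > 0\<close> by simp
        ultimately show ?thesis unfolding distrib_right by linarith
      qed
      show "\<alpha> * real (Suc n) ^ 2 - M - h + h \<le> a n" for n using coer[of n] by simp
    qed
    moreover have "wsum (\<lambda>n. \<alpha> * real (Suc n) ^ 2 - M - h) C C
        = \<alpha> * wsum (\<lambda>n. real (Suc n) ^ 2) C C - (M + h) * wsum (\<lambda>_. 1) C C"
    proof -
      have "(\<lambda>n. \<alpha> * (real (Suc n) ^ 2 * C n * C n) - (M + h) * (1 * C n * C n)) sums
        (\<alpha> * wsum (\<lambda>n. real (Suc n) ^ 2) C C - (M + h) * wsum (\<lambda>_. 1) C C)"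
        by (intro sums_diff sums_mult wsum_sums[OF one_weight] wsum_sums[of "\<lambda>n. real (Suc n) ^ 2" 1] C) auto
      then show ?thesis by (simp add: wsum_def sums_iff algebra_simps)
    qed
    ultimately show ?thesis by linarith
  qed
  from *[OF A, of 0] *[OF B, of sinph] solution_energy[OF sol] show ?thesis
    by (simp add: algebra_simps)
qed

end

section \<open>Weak derivatives and Fourier coefficients\<close>

definition fcoef :: "real \<Rightarrow> (real \<Rightarrow> real) \<Rightarrow> nat \<Rightarrow> real" where
  "fcoef b f n = integral circ (\<lambda>z. f z * fbasis b n z) / pi"

lemma smoothD:
  assumes "smooth f"
  shows "(f has_real_derivative deriv f x) (at x)" and "smooth (deriv f)" and "continuous_on S f"
proof -
  have d: "f differentiable (at x)" for x
    using assms[unfolded smooth_def, rule_format, of 0] by simp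
  then show "(f has_real_derivative deriv f x) (at x)"
    using DERIV_deriv_iff_real_differentiable by blast
  have "(deriv ^^ n) (deriv f) = (deriv ^^ Suc n) f" for n
    by (simp add: funpow_swap1)
  then show "smooth (deriv f)"
    using assms unfolding smooth_def by metis
  show "continuous_on S f"
    using d by (meson continuous_at_imp_continuous_on differentiable_imp_continuous_within)
qed

lemma periodic_deriv:
  fixes f :: "real \<Rightarrow> real"
  assumes "smooth f" "periodic f"
  shows "periodic (deriv f)"
  unfolding periodic_def
proof
  fix z
  have "((\<lambda>x. f (x + 2 * pi)) has_real_derivative deriv f (z + 2 * pi)) (at z)"
    using DERIV_shift[of f "deriv f (z + 2 * pi)" z "2 * pi"] smoothD(1)[OF assms(1)] by blast
  moreover have "(\<lambda>x. f (x + 2 * pi)) = f"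
    using assms(2) by (simp add: periodic_def)
  ultimately show "deriv f (z + 2 * pi) = deriv f z"
    using smoothD(1)[OF assms(1), of z] DERIV_unique by metis
qed

lemma deriv_scaled_cos: "deriv (\<lambda>z. a * cos (r * z + b)) = (\<lambda>z. (a * r) * cos (r * z + (b + pi / 2)))"
proof
  fix z
  have "((\<lambda>z. a * cos (r * z + b)) has_real_derivative - (a * r * sin (r * z + b))) (at z)"
    by (auto intro!: derivative_eq_intros)
  moreover have "cos (r * z + (b + pi / 2)) = - sin (r * z + b)"
    by (simp add: add.assoc[symmetric] cos_add)
  ultimately show "deriv (\<lambda>z. a * cos (r * z + b)) z = (a * r) * cos (r * z + (b + pi / 2))"
    using DERIV_imp_deriv by fastforce
qed

text \<open>Differentiation changes only amplitude and phase, so all iterated derivatives stay in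
  the family.\<close>

lemma smooth_scaled_cos: "smooth (\<lambda>z. a * cos (r * z + b))"
  unfolding smooth_def
proof (intro allI)
  fix n x
  have "\<exists>a' b'. (deriv ^^ n) (\<lambda>z. a * cos (r * z + b)) = (\<lambda>z. a' * cos (r * z + b'))"
  proof (induction n)
    case (Suc n)
    then obtain a' b' where "(deriv ^^ n) (\<lambda>z. a * cos (r * z + b)) = (\<lambda>z. a' * cos (r * z + b'))"
      by blast
    then have "(deriv ^^ Suc n) (\<lambda>z. a * cos (r * z + b)) = (\<lambda>z. (a' * r) * cos (r * z + (b' + pi / 2)))"
      by (simp add: deriv_scaled_cos)
    then show ?case by blast
  qed auto
  then obtain a' b' where "(deriv ^^ n) (\<lambda>z. a * cos (r * z + b)) = (\<lambda>z. a' * cos (r * z + b'))"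
    by blast
  then show "(deriv ^^ n) (\<lambda>z. a * cos (r * z + b)) differentiable (at x)"
    by (auto simp: real_differentiable_def intro!: exI derivative_eq_intros)
qed

lemma smooth_fbasis: "smooth (fbasis b n)"
  using smooth_scaled_cos[of 1] by (simp add: fbasis_def[abs_def])

lemma periodic_fbasis: "periodic (fbasis b n)"
proof -
  have "cos (real (Suc n) * (z + 2 * pi) + b) = cos (real (Suc n) * z + b)" for z
  proof -
    have "real (Suc n) * (z + 2 * pi) + b = (real (Suc n) * z + b) + 2 * pi * of_int (int (Suc n))"
      by (simp add: algebra_simps)
    then show ?thesis by (simp only: cos_add cos_int_2pin sin_int_2pin) simp
  qed
  then show ?thesis by (simp add: periodic_def fbasis_def)
qed

lemma deriv_fbasis:
  "deriv (fbasis 0 n) z = - (real (Suc n) * fbasis sinph n z)"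
  "deriv (fbasis sinph n) z = real (Suc n) * fbasis 0 n z"
proof -
  have d: "deriv (fbasis b n) z = real (Suc n) * cos (real (Suc n) * z + (b + pi / 2))" for b
    using fun_cong[OF deriv_scaled_cos[of 1 "real (Suc n)" b]] by (simp add: fbasis_def[abs_def])
  show "deriv (fbasis 0 n) z = - (real (Suc n) * fbasis sinph n z)"
    unfolding d fbasis_sin by (simp add: cos_add)
  show "deriv (fbasis sinph n) z = real (Suc n) * fbasis 0 n z"
    unfolding d fbasis_cos by simp
qed

lemma L2_torus_integrable:
  assumes "f \<in> L2_torus"
  shows "f absolutely_integrable_on circ"
proof -
  have meas: "f \<in> borel_measurable lebesgue" and int: "set_integrable lebesgue circ (\<lambda>z. (cmod (f z))\<^sup>2)"
    using assms by (auto simp: L2_torus_def)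
  have "set_integrable lebesgue circ (\<lambda>z. 1 + (cmod (f z))\<^sup>2)"
    by (intro set_integral_add(1) int absolutely_integrable_continuous_real continuous_intros)
  then show ?thesis
  proof (rule set_integrable_bound)
    show "set_borel_measurable lebesgue circ f"
      using meas unfolding set_borel_measurable_def
      by (intro borel_measurable_scaleR borel_measurable_indicator) auto
    have "x \<le> 1 + x\<^sup>2" for x :: real
      using zero_le_power2[of "x - 1 / 2"] by (simp add: power2_diff power_divide)
    then show "AE x in lebesgue. x \<in> circ \<longrightarrow> norm (f x) \<le> norm (1 + (cmod (f x))\<^sup>2)"
      by (auto intro!: AE_I2)
  qed
qed

lemma Re_absolutely_integrable:
  fixes f :: "real \<Rightarrow> complex"
  assumes "f absolutely_integrable_on S"
  shows "(\<lambda>z. Re (f z)) absolutely_integrable_on S"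
  using absolutely_integrable_linear[OF assms bounded_linear_Re] by (simp add: o_def)

lemma Re_set_integral:
  fixes f :: "real \<Rightarrow> complex"
  assumes "f absolutely_integrable_on S"
  shows "Re (LINT z:S|lebesgue. f z) = integral S (\<lambda>z. Re (f z))"
  using integral_unique[OF has_integral_Re[OF integrable_integral[OF set_lebesgue_integral_eq_integral(1)[OF assms]]]]
    set_lebesgue_integral_eq_integral(2)[OF assms] by simp

lemma mult_of_real_absolutely_integrable:
  fixes f :: "real \<Rightarrow> complex"
  assumes "f absolutely_integrable_on {a..b}" "continuous_on {a..b} h"
  shows "(\<lambda>z. f z * of_real (h z)) absolutely_integrable_on {a..b}"
proof -
  have "(\<lambda>z. h z *\<^sub>R f z) absolutely_integrable_on {a..b}"
    using assms
    by (intro absolutely_integrable_bounded_measurable_product[OF bilinear_conv_bounded_bilinear[THEN iffD2, OF bounded_bilinear_scaleR]])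
       (auto intro!: continuous_imp_measurable_on_sets_lebesgue compact_imp_bounded
             compact_continuous_image)
  then show ?thesis by (simp add: scaleR_conv_of_real mult.commute)
qed

text \<open>Test functions are real, so real parts can be taken in the weak derivative. For real
  \<Lambda> the operator has real coefficients, and it suffices to follow the real part of a
  solution.\<close>

lemma weak_deriv_Re:
  assumes "weak_deriv f g" "smooth \<psi>" "periodic \<psi>"
  shows "integral circ (\<lambda>z. Re (f z) * deriv \<psi> z) = - integral circ (\<lambda>z. Re (g z) * \<psi> z)"
proof -
  have f: "f absolutely_integrable_on circ" and g: "g absolutely_integrable_on circ"
    using assms(1) by (auto simp: weak_deriv_def intro: L2_torus_integrable)
  have "(LINT z:circ|lebesgue. f z * of_real (deriv \<psi> z)) = - (LINT z:circ|lebesgue. g z * of_real (\<psi> z))"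
    using assms by (simp add: weak_deriv_def)
  from arg_cong[OF this, of Re] show ?thesis
    using Re_set_integral[OF mult_of_real_absolutely_integrable[OF f smoothD(3)[OF smoothD(2)[OF assms(2)]]]]
      Re_set_integral[OF mult_of_real_absolutely_integrable[OF g smoothD(3)[OF assms(2)]]]
    by simp
qed

text \<open>The basis functions and the constant 1 are themselves admissible test functions.\<close>

lemma fcoef_weak_deriv:
  assumes "weak_deriv f g"
  shows "fcoef 0 (\<lambda>z. Re (g z)) n = real (Suc n) * fcoef sinph (\<lambda>z. Re (f z)) n"
    and "fcoef sinph (\<lambda>z. Re (g z)) n = - (real (Suc n) * fcoef 0 (\<lambda>z. Re (f z)) n)"
    and "integral circ (\<lambda>z. Re (g z)) = 0"
proof -
  have "integral circ (\<lambda>z. Re (f z) * - (real (Suc n) * fbasis sinph n z)) = - integral circ (\<lambda>z. Re (g z) * fbasis 0 n z)"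
    using weak_deriv_Re[OF assms smooth_fbasis periodic_fbasis, of 0 n] unfolding deriv_fbasis .
  moreover have "(\<lambda>z. Re (f z) * - (real (Suc n) * fbasis sinph n z)) = (\<lambda>z. - real (Suc n) * (Re (f z) * fbasis sinph n z))"
    by (rule ext) (simp only: mult_minus_left mult_minus_right mult.left_commute)
  ultimately show "fcoef 0 (\<lambda>z. Re (g z)) n = real (Suc n) * fcoef sinph (\<lambda>z. Re (f z)) n"
    by (simp only: fcoef_def integral_mult_right) (simp add: field_simps)
  have "integral circ (\<lambda>z. Re (f z) * (real (Suc n) * fbasis 0 n z)) = - integral circ (\<lambda>z. Re (g z) * fbasis sinph n z)"
    using weak_deriv_Re[OF assms smooth_fbasis periodic_fbasis, of sinph n] unfolding deriv_fbasis .
  moreover have "(\<lambda>z. Re (f z) * (real (Suc n) * fbasis 0 n z)) = (\<lambda>z. real (Suc n) * (Re (f z) * fbasis 0 n z))"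
    by (simp add: mult_ac)
  ultimately show "fcoef sinph (\<lambda>z. Re (g z)) n = - (real (Suc n) * fcoef 0 (\<lambda>z. Re (f z)) n)"
    by (simp only: fcoef_def integral_mult_right) (simp add: field_simps)
  have "smooth (\<lambda>z. 1)" "deriv (\<lambda>z. 1 :: real) = (\<lambda>z. 0)"
    using smooth_scaled_cos[of 1 0 0] by auto
  then show "integral circ (\<lambda>z. Re (g z)) = 0"
    using weak_deriv_Re[OF assms, of "\<lambda>z. 1"] by (simp add: periodic_def)
qed

lemma fcoef_bound:
  assumes "f absolutely_integrable_on circ"
  shows "\<bar>fcoef b f n\<bar> \<le> integral circ (\<lambda>z. \<bar>f z\<bar>) / pi"
proof -
  have "norm (integral circ (\<lambda>z. f z * fbasis b n z)) \<le> integral circ (\<lambda>z. \<bar>f z\<bar>)"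
  proof (rule integral_norm_bound_integral)
    show "(\<lambda>z. f z * fbasis b n z) integrable_on circ"
      using absolutely_integrable_times_continuous[OF assms continuous_fbasis]
      by (simp add: absolutely_integrable_on_def)
    show "(\<lambda>z. \<bar>f z\<bar>) integrable_on circ"
      using assms by (simp add: absolutely_integrable_on_def)
  qed (auto simp: abs_mult intro!: mult_left_le abs_fbasis_le)
  then show ?thesis by (simp add: fcoef_def divide_right_mono)
qed

text \<open>Each weak derivative brings a factor \<open>n + 1\<close> and exchanges sine and cosine
  coefficients, so the induction has to bound both together.\<close>

lemma H_torus_fcoef_bound:
  assumes "f \<in> H_torus m"
  shows "\<exists>C. \<forall>n. \<bar>fcoef 0 (\<lambda>z. Re (f z)) n\<bar> * real (Suc n) ^ m \<le> C \<and>
                 \<bar>fcoef sinph (\<lambda>z. Re (f z)) n\<bar> * real (Suc n) ^ m \<le> C"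
  using assms
proof (induction m arbitrary: f)
  case 0
  then show ?case
    using fcoef_bound[OF Re_absolutely_integrable[OF L2_torus_integrable]] by auto
next
  case (Suc m)
  then obtain g where g: "weak_deriv f g" "g \<in> H_torus m" by auto
  obtain C where C: "\<And>n. \<bar>fcoef 0 (\<lambda>z. Re (g z)) n\<bar> * real (Suc n) ^ m \<le> C"
    "\<And>n. \<bar>fcoef sinph (\<lambda>z. Re (g z)) n\<bar> * real (Suc n) ^ m \<le> C"
    using Suc.IH[OF g(2)] by blast
  show ?case
    using C unfolding fcoef_weak_deriv(1,2)[OF g(1)]
    by (intro exI[of _ C]) (simp add: abs_mult mult_ac)
qed

lemma H_torus_decay:
  assumes "f \<in> H_torus 4"
  shows "decay (fcoef 0 (\<lambda>z. Re (f z)))" "decay (fcoef sinph (\<lambda>z. Re (f z)))"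
  using H_torus_fcoef_bound[OF assms] by (auto simp: decay_def)


lemma AE_lebesgue_negligible:
  assumes "AE z in lebesgue. P z"
  obtains N where "negligible N" "\<And>z. z \<notin> N \<Longrightarrow> P z"
proof -
  obtain N where "N \<in> null_sets lebesgue" "{z. \<not> P z} \<subseteq> N"
    using assms by (auto simp: eventually_ae_filter)
  then show thesis
    using that[of N] by (auto simp: negligible_iff_null_sets)
qed

text \<open>The equation in Fourier space, divided by \<open>- (n + 1)^2\<close>. Division makes the
  multiplier part symmetric of second order and the \<Lambda>-coupling skew. Evenness of \<eta>
  removes the integrals that would mix parities.\<close>

lemma coefficients_of_graph:
  assumes G: "(\<phi>, f) \<in> G_graph \<beta> \<gamma> k c \<eta> (of_real \<Lambda>) \<rho>"
    and cont: "continuous_on circ \<eta>" and even: "\<And>z. \<eta> (2 * pi - z) = \<eta> z"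
    and mean: "integral circ (\<lambda>z. Re (f z)) = 0" and gamma: "\<gamma> > 0"
  defines "A \<equiv> fcoef 0 (\<lambda>z. Re (\<phi> z))" and "B \<equiv> fcoef sinph (\<lambda>z. Re (\<phi> z))"
  defines "a \<equiv> \<lambda>n. \<beta> * k ^ 4 * real (Suc n) ^ 2 - k\<^sup>2 * c + \<gamma> / real (Suc n) ^ 2 + \<rho>\<^sup>2 / real (Suc n) ^ 2"
  shows "decay A" "decay B"
    and "\<exists>N. negligible N \<and> (\<forall>z\<in>circ - N. Re (\<phi> z) = fser 0 A z + fser sinph B z)"
    and "a n * A n + integral circ (\<lambda>z. (2 * k\<^sup>2 * \<eta> z) * fser 0 A z * fbasis 0 n z) / pi
      = - fcoef 0 (\<lambda>z. Re (f z)) n / real (Suc n) ^ 2 + \<Lambda> * (B n / real (Suc n))"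
    and "a n * B n + integral circ (\<lambda>z. (2 * k\<^sup>2 * \<eta> z) * fser sinph B z * fbasis sinph n z) / pi
      = - fcoef sinph (\<lambda>z. Re (f z)) n / real (Suc n) ^ 2 - \<Lambda> * (A n / real (Suc n))"
proof -
  define W where "W \<phi>2 z = of_real c * \<phi> z + of_real (\<beta> * k\<^sup>2) * \<phi>2 z - 2 * of_real (\<eta> z) * \<phi> z" for \<phi>2 :: "real \<Rightarrow> complex" and z
  obtain \<phi>1 \<phi>2 w1 w2 where H4: "\<phi> \<in> H_torus 4" and fL: "f \<in> L2_torus"
    and d: "weak_deriv \<phi> \<phi>1" "weak_deriv \<phi>1 \<phi>2" "weak_deriv (W \<phi>2) w1" "weak_deriv w1 w2"
    and ae: "AE z in lebesgue. f z = of_real \<Lambda> * \<phi>1 z - of_real (k\<^sup>2) * w2 z - of_real (\<rho>\<^sup>2) * \<phi> z - of_real \<gamma> * \<phi> z"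
    using G unfolding G_graph_def W_def by blast
  have L2: "\<phi> \<in> L2_torus" "\<phi>1 \<in> L2_torus" "\<phi>2 \<in> L2_torus" "w2 \<in> L2_torus" "w1 \<in> L2_torus"
    using d by (auto simp: weak_deriv_def)
  note ai = Re_absolutely_integrable[OF L2_torus_integrable]
  have int: "(\<lambda>z. Re (g z) * h z) integrable_on circ" if "g \<in> L2_torus" "continuous_on circ h" for g h
    using absolutely_integrable_times_continuous[OF ai[OF that(1)] that(2)] by (simp add: absolutely_integrable_on_def)
  obtain N where N: "negligible N"
    and feq: "\<And>z. z \<notin> N \<Longrightarrow> f z = of_real \<Lambda> * \<phi>1 z - of_real (k\<^sup>2) * w2 z - of_real (\<rho>\<^sup>2) * \<phi> z - of_real \<gamma> * \<phi> z"
    using AE_lebesgue_negligible[OF ae] by blast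
  have f_int: "integral circ (\<lambda>z. Re (f z) * h z) = \<Lambda> * integral circ (\<lambda>z. Re (\<phi>1 z) * h z)
      - k\<^sup>2 * integral circ (\<lambda>z. Re (w2 z) * h z) - (\<rho>\<^sup>2 + \<gamma>) * integral circ (\<lambda>z. Re (\<phi> z) * h z)"
    if h: "continuous_on circ h" for h
  proof -
    have "integral circ (\<lambda>z. Re (f z) * h z) = integral circ (\<lambda>z. \<Lambda> * (Re (\<phi>1 z) * h z)
        - k\<^sup>2 * (Re (w2 z) * h z) - (\<rho>\<^sup>2 + \<gamma>) * (Re (\<phi> z) * h z))"
      by (rule integral_spike[OF N]) (simp add: feq algebra_simps)
    also have "\<dots> = \<Lambda> * integral circ (\<lambda>z. Re (\<phi>1 z) * h z)
      - k\<^sup>2 * integral circ (\<lambda>z. Re (w2 z) * h z) - (\<rho>\<^sup>2 + \<gamma>) * integral circ (\<lambda>z. Re (\<phi> z) * h z)"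
      by (intro integral_unique has_integral_diff has_integral_mult_right integrable_integral int L2 h)
    finally show ?thesis .
  qed
  \<comment> \<open>All derivatives have mean zero, so the mean of the equation is
    \<open>- (\<rho>\<^sup>2 + \<gamma>)\<close> times the mean of \<phi>. This is where the
    constant mode disappears.\<close>
  have mean\<phi>: "integral circ (\<lambda>z. Re (\<phi> z)) = 0"
  proof -
    have "0 = - ((\<rho>\<^sup>2 + \<gamma>) * integral circ (\<lambda>z. Re (\<phi> z)))"
      using f_int[of "\<lambda>z. 1"] mean fcoef_weak_deriv(3)[OF d(1)] fcoef_weak_deriv(3)[OF d(4)] by simp
    moreover have "\<rho>\<^sup>2 + \<gamma> > 0" using gamma by (simp add: add_nonneg_pos)
    ultimately show ?thesis by simp
  qed
  show A: "decay A" and B: "decay B"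
    unfolding A_def B_def using H_torus_decay[OF H4] by auto
  obtain N' where N': "negligible N'" and rep: "\<And>z. z \<in> circ - N' \<Longrightarrow> Re (\<phi> z) = fser 0 A z + fser sinph B z"
    by (rule fourier_representation[OF ai[OF L2(1)] mean\<phi>, of A B])
       (use decay_summable[OF A] decay_summable[OF B] that in \<open>auto simp: A_def B_def fcoef_def\<close>)
  then show "\<exists>N. negligible N \<and> (\<forall>z\<in>circ - N. Re (\<phi> z) = fser 0 A z + fser sinph B z)" by blast
  \<comment> \<open>The product with \<eta> is not expanded in coefficients; \<phi> is replaced by
    its series under the integral, which is the shape in which \<open>form\<close> uses it.\<close>
  have eta\<phi>: "integral circ (\<lambda>z. Re (\<phi> z) * (\<eta> z * fbasis b n z))
      = integral circ (\<lambda>z. \<eta> z * fser 0 A z * fbasis b n z) + integral circ (\<lambda>z. \<eta> z * fser sinph B z * fbasis b n z)" for b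
  proof -
    have "integral circ (\<lambda>z. Re (\<phi> z) * (\<eta> z * fbasis b n z))
        = integral circ (\<lambda>z. \<eta> z * fser 0 A z * fbasis b n z + \<eta> z * fser sinph B z * fbasis b n z)"
      by (rule integral_spike[OF N']) (simp add: rep algebra_simps)
    also have "\<dots> = integral circ (\<lambda>z. \<eta> z * fser 0 A z * fbasis b n z) + integral circ (\<lambda>z. \<eta> z * fser sinph B z * fbasis b n z)"
      by (intro integral_unique has_integral_add integrable_integral integrable_continuous_real
          continuous_intros cont continuous_fser decay_summable A B)
    finally show ?thesis .
  qed
  have W_int: "fcoef b (\<lambda>z. Re (W \<phi>2 z)) n = c * fcoef b (\<lambda>z. Re (\<phi> z)) n + \<beta> * k\<^sup>2 * fcoef b (\<lambda>z. Re (\<phi>2 z)) n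
      - 2 * (integral circ (\<lambda>z. Re (\<phi> z) * (\<eta> z * fbasis b n z)) / pi)" for b
  proof -
    have "((\<lambda>z. c * (Re (\<phi> z) * fbasis b n z) + \<beta> * k\<^sup>2 * (Re (\<phi>2 z) * fbasis b n z)
        - 2 * (Re (\<phi> z) * (\<eta> z * fbasis b n z))) has_integral
        (c * integral circ (\<lambda>z. Re (\<phi> z) * fbasis b n z) + \<beta> * k\<^sup>2 * integral circ (\<lambda>z. Re (\<phi>2 z) * fbasis b n z)
        - 2 * integral circ (\<lambda>z. Re (\<phi> z) * (\<eta> z * fbasis b n z)))) circ"
      by (intro has_integral_diff has_integral_add has_integral_mult_right integrable_integral int L2
          continuous_intros cont)
    moreover have "(\<lambda>z. c * (Re (\<phi> z) * fbasis b n z) + \<beta> * k\<^sup>2 * (Re (\<phi>2 z) * fbasis b n z)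
        - 2 * (Re (\<phi> z) * (\<eta> z * fbasis b n z))) = (\<lambda>z. Re (W \<phi>2 z) * fbasis b n z)"
      by (rule ext) (simp add: W_def algebra_simps)
    ultimately show ?thesis
      by (simp add: fcoef_def integral_unique add_divide_distrib diff_divide_distrib)
  qed
  define s where "s = real (Suc n)"
  have s: "s > 0" by (simp add: s_def)
  note coef = fcoef_weak_deriv(1,2)[OF d(1), of n] fcoef_weak_deriv(1,2)[OF d(2), of n]
    fcoef_weak_deriv(1,2)[OF d(3), of n] fcoef_weak_deriv(1,2)[OF d(4), of n]
  have f_coef: "fcoef b (\<lambda>z. Re (f z)) n = \<Lambda> * fcoef b (\<lambda>z. Re (\<phi>1 z)) n - k\<^sup>2 * fcoef b (\<lambda>z. Re (w2 z)) n
      - (\<rho>\<^sup>2 + \<gamma>) * fcoef b (\<lambda>z. Re (\<phi> z)) n" for b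
    unfolding fcoef_def f_int[OF continuous_fbasis] by (simp add: diff_divide_distrib)
  have scale: "integral circ (\<lambda>z. (2 * k\<^sup>2 * \<eta> z) * g z * fbasis b n z) / pi
      = 2 * k\<^sup>2 * (integral circ (\<lambda>z. \<eta> z * g z * fbasis b n z) / pi)" for g b
    by (simp add: mult.assoc)
  define MA where "MA = integral circ (\<lambda>z. \<eta> z * fser 0 A z * fbasis 0 n z) / pi"
  define MB where "MB = integral circ (\<lambda>z. \<eta> z * fser sinph B z * fbasis sinph n z) / pi"
  have cross: "integral circ (\<lambda>z. \<eta> z * fser 0 A z * fbasis sinph n z) = 0"
    "integral circ (\<lambda>z. \<eta> z * fser sinph B z * fbasis 0 n z) = 0"
    by (intro integral_cos_sin_even[where h = \<eta>] even decay_summable A B)+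
  have WA: "fcoef 0 (\<lambda>z. Re (W \<phi>2 z)) n = c * A n - \<beta> * k\<^sup>2 * s\<^sup>2 * A n - 2 * MA"
    using W_int[of 0] cross unfolding eta\<phi> coef by (simp add: A_def MA_def s_def power2_eq_square)
  have WB: "fcoef sinph (\<lambda>z. Re (W \<phi>2 z)) n = c * B n - \<beta> * k\<^sup>2 * s\<^sup>2 * B n - 2 * MB"
    using W_int[of sinph] cross unfolding eta\<phi> coef by (simp add: B_def MB_def s_def power2_eq_square)
  have fA: "fcoef 0 (\<lambda>z. Re (f z)) n = \<Lambda> * (s * B n) + k\<^sup>2 * s\<^sup>2 * (c * A n - \<beta> * k\<^sup>2 * s\<^sup>2 * A n - 2 * MA) - (\<rho>\<^sup>2 + \<gamma>) * A n"
    using f_coef[of 0] unfolding coef(7) coef(6) coef(1) WA by (simp add: A_def B_def s_def power2_eq_square)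
  have fB: "fcoef sinph (\<lambda>z. Re (f z)) n = - \<Lambda> * (s * A n) + k\<^sup>2 * s\<^sup>2 * (c * B n - \<beta> * k\<^sup>2 * s\<^sup>2 * B n - 2 * MB) - (\<rho>\<^sup>2 + \<gamma>) * B n"
    using f_coef[of sinph] unfolding coef(8) coef(5) coef(2) WB by (simp add: A_def B_def s_def power2_eq_square)
  show "a n * A n + integral circ (\<lambda>z. (2 * k\<^sup>2 * \<eta> z) * fser 0 A z * fbasis 0 n z) / pi
      = - fcoef 0 (\<lambda>z. Re (f z)) n / real (Suc n) ^ 2 + \<Lambda> * (B n / real (Suc n))"
    unfolding scale fA a_def MA_def[symmetric] s_def[symmetric] using s
    by (simp add: field_simps power2_eq_square power4_eq_xxxx)
  show "a n * B n + integral circ (\<lambda>z. (2 * k\<^sup>2 * \<eta> z) * fser sinph B z * fbasis sinph n z) / pi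
      = - fcoef sinph (\<lambda>z. Re (f z)) n / real (Suc n) ^ 2 - \<Lambda> * (A n / real (Suc n))"
    unfolding scale fB a_def MB_def[symmetric] s_def[symmetric] using s
    by (simp add: field_simps power2_eq_square power4_eq_xxxx)
qed

section \<open>Differences of solutions and L2 norms\<close>

text \<open>Real parts are built into the combination, so that its results are described by real
  Fourier series while remaining elements of the complex L2 space in which the inverse is
  bounded.\<close>

definition Re_lin :: "real \<Rightarrow> real \<Rightarrow> (real \<Rightarrow> complex) \<Rightarrow> (real \<Rightarrow> complex) \<Rightarrow> real \<Rightarrow> complex" where
  "Re_lin r s f g z = of_real (r * Re (f z) + s * Re (g z))"

lemma L2_torus_Re_lin:
  assumes "f \<in> L2_torus" "g \<in> L2_torus"
  shows "Re_lin r s f g \<in> L2_torus"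
proof -
  have meas: "f \<in> borel_measurable lebesgue" "g \<in> borel_measurable lebesgue"
    and int: "set_integrable lebesgue circ (\<lambda>z. (cmod (f z))\<^sup>2)" "set_integrable lebesgue circ (\<lambda>z. (cmod (g z))\<^sup>2)"
    and per: "periodic f" "periodic g"
    using assms by (auto simp: L2_torus_def)
  have m: "Re_lin r s f g \<in> borel_measurable lebesgue"
    unfolding Re_lin_def[abs_def] using meas by measurable
  have "set_integrable lebesgue circ (\<lambda>z. 2 * r\<^sup>2 * (cmod (f z))\<^sup>2 + 2 * s\<^sup>2 * (cmod (g z))\<^sup>2)"
    by (intro set_integral_add(1) set_integrable_mult_right int)
  then have "set_integrable lebesgue circ (\<lambda>z. (cmod (Re_lin r s f g z))\<^sup>2)"
  proof (rule set_integrable_bound)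
    show "set_borel_measurable lebesgue circ (\<lambda>z. (cmod (Re_lin r s f g z))\<^sup>2)"
      using m unfolding set_borel_measurable_def
      by (intro borel_measurable_scaleR borel_measurable_indicator borel_measurable_power borel_measurable_norm) auto
    have "(r * Re a + s * Re b)\<^sup>2 \<le> 2 * r\<^sup>2 * (cmod a)\<^sup>2 + 2 * s\<^sup>2 * (cmod b)\<^sup>2" for a b :: complex
    proof -
      have "(r * Re a + s * Re b)\<^sup>2 \<le> 2 * (r * Re a)\<^sup>2 + 2 * (s * Re b)\<^sup>2"
        using zero_le_power2[of "r * Re a - s * Re b"] by (simp add: power2_diff power2_sum)
      also have "\<dots> \<le> 2 * r\<^sup>2 * (cmod a)\<^sup>2 + 2 * s\<^sup>2 * (cmod b)\<^sup>2"
      proof -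
        have "(Re a)\<^sup>2 \<le> (cmod a)\<^sup>2" "(Re b)\<^sup>2 \<le> (cmod b)\<^sup>2"
          by (simp_all add: cmod_power2)
        then have "r\<^sup>2 * (Re a)\<^sup>2 \<le> r\<^sup>2 * (cmod a)\<^sup>2" "s\<^sup>2 * (Re b)\<^sup>2 \<le> s\<^sup>2 * (cmod b)\<^sup>2"
          by (auto intro: mult_left_mono)
        then show ?thesis by (simp add: power_mult_distrib)
      qed
      finally show ?thesis .
    qed
    then show "AE z in lebesgue. z \<in> circ \<longrightarrow> norm ((cmod (Re_lin r s f g z))\<^sup>2)
        \<le> norm (2 * r\<^sup>2 * (cmod (f z))\<^sup>2 + 2 * s\<^sup>2 * (cmod (g z))\<^sup>2)"
      by (auto simp: Re_lin_def simp del: of_real_add of_real_mult intro!: AE_I2)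
  qed
  moreover have "periodic (Re_lin r s f g)"
    using per by (simp add: periodic_def Re_lin_def)
  ultimately show ?thesis using m by (simp add: L2_torus_def)
qed

lemma set_integral_of_real_eq:
  fixes h :: "real \<Rightarrow> real"
  assumes "(\<lambda>z. of_real (h z) :: complex) absolutely_integrable_on S"
  shows "(LINT z:S|lebesgue. of_real (h z) :: complex) = of_real (integral S h)"
  unfolding set_lebesgue_integral_eq_integral(2)[OF assms]
proof (rule integral_unique)
  have "h integrable_on S"
    using integrable_linear[OF set_lebesgue_integral_eq_integral(1)[OF assms] bounded_linear_Re]
    by (simp add: o_def)
  then show "((\<lambda>z. of_real (h z) :: complex) has_integral of_real (integral S h)) S"
    by (intro has_integral_of_real integrable_integral)
qed

lemma weak_deriv_Re_lin:
  assumes "weak_deriv f f'" "weak_deriv g g'"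
  shows "weak_deriv (Re_lin r s f g) (Re_lin r s f' g')"
  unfolding weak_deriv_def
proof (intro conjI allI impI)
  have L2: "f \<in> L2_torus" "f' \<in> L2_torus" "g \<in> L2_torus" "g' \<in> L2_torus"
    using assms by (auto simp: weak_deriv_def)
  then show L2': "Re_lin r s f g \<in> L2_torus" "Re_lin r s f' g' \<in> L2_torus"
    by (auto intro: L2_torus_Re_lin)
  fix \<psi> assume \<psi>: "smooth \<psi> \<and> periodic \<psi>"
  have int: "(\<lambda>z. Re (p z) * h z) integrable_on circ" if "p \<in> L2_torus" "continuous_on circ h" for p h
    using absolutely_integrable_times_continuous[OF Re_absolutely_integrable[OF L2_torus_integrable[OF that(1)]] that(2)]
    by (simp add: absolutely_integrable_on_def)
  have lin: "(LINT z:circ|lebesgue. Re_lin r s p q z * of_real (h z))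
      = of_real (r * integral circ (\<lambda>z. Re (p z) * h z) + s * integral circ (\<lambda>z. Re (q z) * h z))"
    if L: "p \<in> L2_torus" "q \<in> L2_torus" and h: "continuous_on circ h" for p q h
  proof -
    have eq: "(\<lambda>z. Re_lin r s p q z * of_real (h z)) = (\<lambda>z. of_real (r * (Re (p z) * h z) + s * (Re (q z) * h z)))"
      by (simp add: Re_lin_def algebra_simps)
    have "(\<lambda>z. Re_lin r s p q z * of_real (h z)) absolutely_integrable_on circ"
      by (intro mult_of_real_absolutely_integrable L2_torus_integrable L2_torus_Re_lin L h)
    then have "(LINT z:circ|lebesgue. Re_lin r s p q z * of_real (h z))
        = of_real (integral circ (\<lambda>z. r * (Re (p z) * h z) + s * (Re (q z) * h z)))"
      unfolding eq by (rule set_integral_of_real_eq)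
    also have "integral circ (\<lambda>z. r * (Re (p z) * h z) + s * (Re (q z) * h z))
        = r * integral circ (\<lambda>z. Re (p z) * h z) + s * integral circ (\<lambda>z. Re (q z) * h z)"
      by (intro integral_unique has_integral_add has_integral_mult_right integrable_integral int L h)
    finally show ?thesis .
  qed
  have "continuous_on circ \<psi>" "continuous_on circ (deriv \<psi>)"
    using \<psi> smoothD by auto
  then show "(LINT z:circ|lebesgue. Re_lin r s f g z * of_real (deriv \<psi> z))
      = - (LINT z:circ|lebesgue. Re_lin r s f' g' z * of_real (\<psi> z))"
    using weak_deriv_Re[OF assms(1), of \<psi>] weak_deriv_Re[OF assms(2), of \<psi>] \<psi>
    by (simp add: lin L2)
qed

lemma H_torus_Re_lin:
  assumes "f \<in> H_torus m" "g \<in> H_torus m"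
  shows "Re_lin r s f g \<in> H_torus m"
  using assms
proof (induction m arbitrary: f g)
  case 0
  then show ?case by (simp add: L2_torus_Re_lin)
next
  case (Suc m)
  then show ?case using weak_deriv_Re_lin by fastforce
qed

text \<open>The resolvent identity: the operators for \<Lambda>' and \<Lambda> differ by
  \<open>\<Lambda>' - \<Lambda>\<close> times the derivative, so the difference of two solutions
  with the same right-hand side solves the \<Lambda>-equation with a small multiple of the
  derivative as source.\<close>

lemma G_graph_difference:
  assumes "(\<phi>, f) \<in> G_graph \<beta> \<gamma> k c \<eta> (of_real \<Lambda>) \<rho>" "(\<phi>', f) \<in> G_graph \<beta> \<gamma> k c \<eta> (of_real \<Lambda>') \<rho>"
  obtains \<phi>1' where "weak_deriv \<phi>' \<phi>1'"
    "(Re_lin 1 (- 1) \<phi> \<phi>', Re_lin (\<Lambda>' - \<Lambda>) 0 \<phi>1' \<phi>1') \<in> G_graph \<beta> \<gamma> k c \<eta> (of_real \<Lambda>) \<rho>"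
proof -
  define W where "W \<phi> \<phi>2 z = of_real c * \<phi> z + of_real (\<beta> * k\<^sup>2) * \<phi>2 z - 2 * of_real (\<eta> z) * \<phi> z" for \<phi> \<phi>2 :: "real \<Rightarrow> complex" and z
  obtain \<phi>1 \<phi>2 w1 w2 where H4: "\<phi> \<in> H_torus 4"
    and d: "weak_deriv \<phi> \<phi>1" "weak_deriv \<phi>1 \<phi>2" "weak_deriv (W \<phi> \<phi>2) w1" "weak_deriv w1 w2"
    and ae: "AE z in lebesgue. f z = of_real \<Lambda> * \<phi>1 z - of_real (k\<^sup>2) * w2 z - of_real (\<rho>\<^sup>2) * \<phi> z - of_real \<gamma> * \<phi> z"
    using assms(1) unfolding G_graph_def W_def by blast
  obtain \<phi>1' \<phi>2' w1' w2' where H4': "\<phi>' \<in> H_torus 4"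
    and d': "weak_deriv \<phi>' \<phi>1'" "weak_deriv \<phi>1' \<phi>2'" "weak_deriv (W \<phi>' \<phi>2') w1'" "weak_deriv w1' w2'"
    and ae': "AE z in lebesgue. f z = of_real \<Lambda>' * \<phi>1' z - of_real (k\<^sup>2) * w2' z - of_real (\<rho>\<^sup>2) * \<phi>' z - of_real \<gamma> * \<phi>' z"
    using assms(2) unfolding G_graph_def W_def by blast
  have WW: "Re_lin 1 (-1) (W \<phi> \<phi>2) (W \<phi>' \<phi>2') = W (Re_lin 1 (-1) \<phi> \<phi>') (Re_lin 1 (-1) \<phi>2 \<phi>2')"
    by (rule ext) (simp add: W_def Re_lin_def algebra_simps complex_eq_iff)
  have "AE z in lebesgue. Re_lin (\<Lambda>' - \<Lambda>) 0 \<phi>1' \<phi>1' z = of_real \<Lambda> * Re_lin 1 (-1) \<phi>1 \<phi>1' z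
      - of_real (k\<^sup>2) * Re_lin 1 (-1) w2 w2' z - of_real (\<rho>\<^sup>2) * Re_lin 1 (-1) \<phi> \<phi>' z - of_real \<gamma> * Re_lin 1 (-1) \<phi> \<phi>' z"
    using ae ae'
  proof eventually_elim
    case (elim z)
    then have "Re (of_real \<Lambda> * \<phi>1 z - of_real (k\<^sup>2) * w2 z - of_real (\<rho>\<^sup>2) * \<phi> z - of_real \<gamma> * \<phi> z)
        = Re (of_real \<Lambda>' * \<phi>1' z - of_real (k\<^sup>2) * w2' z - of_real (\<rho>\<^sup>2) * \<phi>' z - of_real \<gamma> * \<phi>' z)" by simp
    then show ?case
      by (simp add: Re_lin_def complex_eq_iff algebra_simps)
  qed
  moreover have "weak_deriv (W (Re_lin 1 (-1) \<phi> \<phi>') (Re_lin 1 (-1) \<phi>2 \<phi>2')) (Re_lin 1 (-1) w1 w1')"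
    unfolding WW[symmetric] by (rule weak_deriv_Re_lin[OF d(3) d'(3)])
  moreover have "Re_lin (\<Lambda>' - \<Lambda>) 0 \<phi>1' \<phi>1' \<in> L2_torus"
    using d'(2) by (intro L2_torus_Re_lin) (auto simp: weak_deriv_def)
  ultimately have "(Re_lin 1 (- 1) \<phi> \<phi>', Re_lin (\<Lambda>' - \<Lambda>) 0 \<phi>1' \<phi>1') \<in> G_graph \<beta> \<gamma> k c \<eta> (of_real \<Lambda>) \<rho>"
    using H_torus_Re_lin[OF H4 H4', of 1 "-1"] weak_deriv_Re_lin[OF d(1) d'(1), of 1 "-1"]
      weak_deriv_Re_lin[OF d(2) d'(2), of 1 "-1"] weak_deriv_Re_lin[OF d(4) d'(4), of 1 "-1"]
    unfolding G_graph_def W_def by blast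
  then show thesis using that d'(1) by blast
qed

lemma L2_norm_torus_squared:
  assumes "f \<in> L2_torus"
  shows "(L2_norm_torus f)\<^sup>2 = integral circ (\<lambda>z. (cmod (f z))\<^sup>2)" "L2_norm_torus f \<ge> 0"
proof -
  have int: "set_integrable lebesgue circ (\<lambda>z. (cmod (f z))\<^sup>2)"
    using assms by (auto simp: L2_torus_def)
  note eq = set_lebesgue_integral_eq_integral[OF int]
  have "integral circ (\<lambda>z. (cmod (f z))\<^sup>2) \<ge> 0"
    by (rule integral_nonneg[OF eq(1)]) auto
  then show "(L2_norm_torus f)\<^sup>2 = integral circ (\<lambda>z. (cmod (f z))\<^sup>2)" "L2_norm_torus f \<ge> 0"
    by (simp_all add: L2_norm_torus_def eq(2))
qed

text \<open>Parseval for each parity; the mixed product is odd and integrates to 0.\<close>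

lemma L2_norm_torus_series:
  assumes f: "f \<in> L2_torus" and A: "summable (\<lambda>n. \<bar>A n\<bar>)" and B: "summable (\<lambda>n. \<bar>B n\<bar>)"
    and N: "negligible N" "\<And>z. z \<in> circ - N \<Longrightarrow> f z = of_real (fser 0 A z + fser sinph B z)"
  shows "(L2_norm_torus f)\<^sup>2 = pi * ((\<Sum>n. A n * A n) + (\<Sum>n. B n * B n))"
proof -
  have "integral circ (\<lambda>z. (cmod (f z))\<^sup>2) = integral circ (\<lambda>z. fser 0 A z * fser 0 A z + fser sinph B z * fser sinph B z
      + 2 * (fser 0 A z * fser sinph B z))"
    by (rule integral_spike[OF N(1)]) (simp add: N(2) power2_eq_square algebra_simps del: of_real_add)
  also have "\<dots> = integral circ (\<lambda>z. fser 0 A z * fser 0 A z) + integral circ (\<lambda>z. fser sinph B z * fser sinph B z)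
      + 2 * integral circ (\<lambda>z. fser 0 A z * fser sinph B z)"
    by (intro integral_unique has_integral_add has_integral_mult_right integrable_integral integrable_continuous_real
        continuous_intros continuous_fser A B)
  also have "integral circ (\<lambda>z. fser 0 A z * fser sinph B z) = 0"
    by (rule integral_circ_odd) (simp add: fser_reflect A B)
  also have "integral circ (\<lambda>z. fser 0 A z * fser 0 A z) = pi * (\<Sum>n. A n * A n)"
    using parseval[OF A A, of 0] by (simp add: sums_iff)
  also have "integral circ (\<lambda>z. fser sinph B z * fser sinph B z) = pi * (\<Sum>n. B n * B n)"
    using parseval[OF B B, of sinph] by (simp add: sums_iff)
  finally show ?thesis
    by (simp add: L2_norm_torus_squared(1)[OF f] distrib_left)
qed

text \<open>Integration by parts; the boundary terms agree by periodicity.\<close>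

lemma weak_deriv_classical:
  fixes g g' :: "real \<Rightarrow> real"
  assumes "\<And>z. (g has_real_derivative g' z) (at z)" "continuous_on UNIV g'" "periodic g" "periodic g'"
  shows "weak_deriv (\<lambda>z. of_real (g z)) (\<lambda>z. of_real (g' z))"
  unfolding weak_deriv_def
proof (intro conjI allI impI)
  have L2: "(\<lambda>z. of_real (h z)) \<in> L2_torus" if "continuous_on UNIV h" "periodic h" for h :: "real \<Rightarrow> real"
  proof -
    have "(\<lambda>z. complex_of_real (h z)) \<in> borel_measurable (lebesgue_on UNIV)"
      by (intro continuous_imp_measurable_on_sets_lebesgue continuous_intros that) simp
    then have "(\<lambda>z. complex_of_real (h z)) \<in> borel_measurable lebesgue"
      by (simp only: lebesgue_on_UNIV_eq)
    moreover have "set_integrable lebesgue circ (\<lambda>z. (cmod (complex_of_real (h z)))\<^sup>2)"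
      by (intro absolutely_integrable_continuous_real continuous_intros continuous_on_subset[OF that(1)]) auto
    ultimately show ?thesis using that(2) by (simp add: L2_torus_def periodic_def)
  qed
  have g: "continuous_on UNIV g"
    using assms(1) by (meson DERIV_isCont continuous_at_imp_continuous_on)
  show gL: "(\<lambda>z. of_real (g z)) \<in> L2_torus" "(\<lambda>z. of_real (g' z)) \<in> L2_torus"
    using L2 g assms by auto
  fix \<psi> assume \<psi>: "smooth \<psi> \<and> periodic \<psi>"
  have c: "continuous_on circ g" "continuous_on circ g'" "continuous_on circ \<psi>" "continuous_on circ (deriv \<psi>)"
    using g assms(2) \<psi> smoothD by (auto intro: continuous_on_subset)
  have I1: "((\<lambda>z. g z * deriv \<psi> z + g' z * \<psi> z) has_integral (g (2 * pi) * \<psi> (2 * pi) - g 0 * \<psi> 0)) circ"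
  proof (rule fundamental_theorem_of_calculus)
    fix x :: real assume "x \<in> circ"
    have "((\<lambda>z. g z * \<psi> z) has_real_derivative g x * deriv \<psi> x + g' x * \<psi> x) (at x)"
      using assms(1)[of x] smoothD(1)[of \<psi> x] \<psi> by (auto intro!: derivative_eq_intros)
    then show "((\<lambda>z. g z * \<psi> z) has_vector_derivative g x * deriv \<psi> x + g' x * \<psi> x) (at x within circ)"
      by (simp add: has_real_derivative_iff_has_vector_derivative has_vector_derivative_at_within)
  qed simp
  have per: "h (2 * pi) = h 0" if "periodic h" for h :: "real \<Rightarrow> real"
    using that[unfolded periodic_def, rule_format, of 0] by simp
  have I2: "((\<lambda>z. g z * deriv \<psi> z + g' z * \<psi> z) has_integral
      (integral circ (\<lambda>z. g z * deriv \<psi> z) + integral circ (\<lambda>z. g' z * \<psi> z))) circ"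
    by (intro has_integral_add integrable_integral integrable_continuous_real continuous_intros c)
  from has_integral_unique[OF I1 I2] per[OF assms(3)] per[of \<psi>] \<psi>
  have eq: "integral circ (\<lambda>z. g z * deriv \<psi> z) + integral circ (\<lambda>z. g' z * \<psi> z) = 0"
    by simp
  have conv: "(LINT z:circ|lebesgue. complex_of_real (p z) * of_real (h z)) = of_real (integral circ (\<lambda>z. p z * h z))"
    if "continuous_on circ p" "continuous_on circ h" for p h
  proof -
    have "(LINT z:circ|lebesgue. complex_of_real (p z * h z)) = of_real (integral circ (\<lambda>z. p z * h z))"
      by (intro set_integral_of_real_eq absolutely_integrable_continuous_real continuous_intros that)
    then show ?thesis by simp
  qed
  show "(LINT z:circ|lebesgue. complex_of_real (g z) * of_real (deriv \<psi> z))
      = - (LINT z:circ|lebesgue. complex_of_real (g' z) * of_real (\<psi> z))"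
    unfolding conv[OF c(1,4)] conv[OF c(2,3)] using eq by (simp add: add_eq_0_iff flip: of_real_minus)
qed

lemma weak_deriv_smooth:
  assumes "smooth g" "periodic g"
  shows "weak_deriv (\<lambda>z. of_real (g z)) (\<lambda>z. of_real (deriv g z))"
  by (rule weak_deriv_classical)
     (use assms smoothD periodic_deriv in auto)

lemma smooth_H_torus:
  assumes "smooth g" "periodic g"
  shows "(\<lambda>z. of_real (g z)) \<in> H_torus m"
  using assms
proof (induction m arbitrary: g)
  case 0
  then show ?case using weak_deriv_smooth[of g] by (simp add: weak_deriv_def)
next
  case (Suc m)
  then show ?case using weak_deriv_smooth[of g] smoothD(2) periodic_deriv by auto
qed

section \<open>Non-invertibility from an intermediate value argument\<close>

text \<open>The decay of the coefficients survives the extra factor \<open>n + 1\<close>, so the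
  derivative has an absolutely convergent series and its L2 norm becomes a weighted sum.\<close>

lemma G_graph_Re_series:
  assumes G: "(\<phi>, f) \<in> G_graph \<beta> \<gamma> k c \<eta> (of_real \<Lambda>) \<rho>" and d: "weak_deriv \<phi> \<phi>1"
  defines "A \<equiv> fcoef 0 (\<lambda>z. Re (\<phi> z))" and "B \<equiv> fcoef sinph (\<lambda>z. Re (\<phi> z))"
  shows "summable (\<lambda>n. \<bar>real (Suc n) * B n\<bar>)" "summable (\<lambda>n. \<bar>- (real (Suc n) * A n)\<bar>)"
    and "\<exists>N. negligible N \<and> (\<forall>z\<in>circ - N. Re (\<phi>1 z) = fser 0 (\<lambda>n. real (Suc n) * B n) z + fser sinph (\<lambda>n. - (real (Suc n) * A n)) z)"
proof -
  have "\<phi> \<in> H_torus 4" using G by (auto simp: G_graph_def)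
  then have A: "decay A" and B: "decay B" unfolding A_def B_def using H_torus_decay by auto
  have sum: "summable (\<lambda>n. \<bar>real (Suc n) * C n\<bar>)" if "decay C" for C
  proof (rule summable_comparison_test'[OF decay_summable_squared[OF that], of 0])
    show "norm \<bar>real (Suc n) * C n\<bar> \<le> (real (Suc n))\<^sup>2 * \<bar>C n\<bar>" for n
    proof -
      have "real (Suc n) * 1 \<le> real (Suc n) * real (Suc n)" by (intro mult_left_mono) auto
      from mult_right_mono[OF this, of "\<bar>C n\<bar>"] show ?thesis
        by (simp add: abs_mult power2_eq_square)
    qed
  qed
  show sB: "summable (\<lambda>n. \<bar>real (Suc n) * B n\<bar>)" by (rule sum[OF B])
  show sA: "summable (\<lambda>n. \<bar>- (real (Suc n) * A n)\<bar>)" using sum[OF A] by simp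
  have "\<phi>1 \<in> L2_torus" using d by (simp add: weak_deriv_def)
  then obtain N where "negligible N"
    "\<And>z. z \<in> circ - N \<Longrightarrow> Re (\<phi>1 z) = fser 0 (\<lambda>n. real (Suc n) * B n) z + fser sinph (\<lambda>n. - (real (Suc n) * A n)) z"
    by (rule fourier_representation[OF Re_absolutely_integrable[OF L2_torus_integrable] fcoef_weak_deriv(3)[OF d],
          of "\<lambda>n. real (Suc n) * B n"
          "\<lambda>n. - (real (Suc n) * A n)"])
       (use sA sB that in \<open>simp_all only: fcoef_weak_deriv(1,2)[OF d] A_def B_def fcoef_def[symmetric]\<close>)
  then show "\<exists>N. negligible N \<and> (\<forall>z\<in>circ - N. Re (\<phi>1 z) = fser 0 (\<lambda>n. real (Suc n) * B n) z + fser sinph (\<lambda>n. - (real (Suc n) * A n)) z)"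
    by blast
qed

text \<open>The minus sign turns into \<open>+ 1\<close> in the first mode once the equation is
  divided by \<open>- (n + 1)^2\<close>.\<close>

lemma minus_cos_coefficients:
  "(\<lambda>z. of_real (- cos z)) \<in> L2_torus"
  "fcoef 0 (\<lambda>z. - cos z) n = (if n = 0 then - 1 else 0)"
  "fcoef sinph (\<lambda>z. - cos z) n = 0"
  "integral circ (\<lambda>z. - cos z) = 0"
proof -
  have c: "- cos z = - fbasis 0 0 z" for z by (simp add: fbasis_cos)
  have "smooth (\<lambda>z. - cos z)" "periodic (\<lambda>z. - cos z :: real)"
    using smooth_scaled_cos[of "-1" 1 0] by (simp_all add: periodic_def)
  from weak_deriv_smooth[OF this] show "(\<lambda>z. of_real (- cos z)) \<in> L2_torus"
    by (simp add: weak_deriv_def)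
  show "fcoef 0 (\<lambda>z. - cos z) n = (if n = 0 then - 1 else 0)"
    unfolding c fcoef_def using integral_fbasis_product[of 0 0 n] by simp
  define e :: "nat \<Rightarrow> real" where "e n = (if n = 0 then 1 else 0)" for n
  have "summable (\<lambda>n. \<bar>e n\<bar>)" by (rule summable_finite[of "{0}"]) (auto simp: e_def)
  from integral_cos_sin_even(1)[of "\<lambda>z. 1", OF _ this, of n]
  show "fcoef sinph (\<lambda>z. - cos z) n = 0"
    using fser_single[of 0 0 1] unfolding c fcoef_def by (simp add: e_def[abs_def])
  show "integral circ (\<lambda>z. - cos z) = 0"
    unfolding c using integral_fbasis[of 0 0] by simp
qed

theorem not_invertible_if_unstable_forms:
  fixes \<beta> \<gamma> k c \<rho> :: real and \<eta> :: "real \<Rightarrow> real"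
  assumes pos: "\<beta> > 0" "\<gamma> > 0" "k > 0"
    and cont: "continuous_on circ \<eta>" and even: "\<And>z. \<eta> (2 * pi - z) = \<eta> z"
    and forms: "unstable_forms (\<lambda>n. \<beta> * k ^ 4 * real (Suc n) ^ 2 - k\<^sup>2 * c + \<gamma> / real (Suc n) ^ 2)
       (\<lambda>z. 2 * k\<^sup>2 * \<eta> z) K h \<kappa> \<rho> p t"
  shows "\<exists>\<Lambda>>0. \<not> invertible_L2 (G_graph \<beta> \<gamma> k c \<eta> (of_real \<Lambda>) \<rho>)"
proof (rule ccontr)
  assume contra: "\<not> ?thesis"
  define G where "G \<Lambda> = G_graph \<beta> \<gamma> k c \<eta> (of_real \<Lambda>) \<rho>" for \<Lambda> :: real
  have inv: "invertible_L2 (G \<Lambda>)" if "\<Lambda> > 0" for \<Lambda>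
    using contra that by (auto simp: G_def)
  interpret unstable_forms "\<lambda>n. \<beta> * k ^ 4 * real (Suc n) ^ 2 - k\<^sup>2 * c + \<gamma> / real (Suc n) ^ 2"
    "\<lambda>z. 2 * k\<^sup>2 * \<eta> z" K h \<kappa> \<rho> p t by (rule forms)
  define f0 where "f0 z = complex_of_real (- cos z)" for z
  have "\<exists>\<phi>. (\<phi>, f0) \<in> G \<Lambda>" if "\<Lambda> > 0" for \<Lambda>
    using inv[OF that] minus_cos_coefficients(1) by (auto simp: invertible_L2_def f0_def[abs_def])
  then obtain \<Phi> where \<Phi>: "\<And>\<Lambda>. \<Lambda> > 0 \<Longrightarrow> (\<Phi> \<Lambda>, f0) \<in> G \<Lambda>" by metis
  define A B where "A \<Lambda> = fcoef 0 (\<lambda>z. Re (\<Phi> \<Lambda> z))" and "B \<Lambda> = fcoef sinph (\<lambda>z. Re (\<Phi> \<Lambda> z))" for \<Lambda>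
  have Ref0: "(\<lambda>z. Re (f0 z)) = (\<lambda>z. - cos z)" by (simp add: f0_def)
  have "integral circ (\<lambda>z. Re (f0 z)) = 0" unfolding Ref0 by (rule minus_cos_coefficients)
  note coefs = coefficients_of_graph[OF \<Phi>[unfolded G_def] cont even this pos(2), folded A_def B_def, unfolded Ref0]
  have decay: "decay (A \<Lambda>)" "decay (B \<Lambda>)" if "\<Lambda> > 0" for \<Lambda>
    using coefs(1,2)[OF that] .
  have sol: "solution \<Lambda> (A \<Lambda>) (B \<Lambda>)" if "\<Lambda> > 0" for \<Lambda>
    unfolding solution_def a_def
    using decay[OF that] coefs(4,5)[OF that] by (auto simp: minus_cos_coefficients)
  \<comment> \<open>Up to the factor \<open>pi\<close>, \<open>N2\<close> is the squared norm of the
    real part of a solution, \<open>dd\<close> the squared distance between two such parts, and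
    \<open>S\<close> the squared norm of the derivative.\<close>
  define N2 where "N2 \<Lambda> = wsum (\<lambda>_. 1) (A \<Lambda>) (A \<Lambda>) + wsum (\<lambda>_. 1) (B \<Lambda>) (B \<Lambda>)" for \<Lambda>
  define dd where "dd \<Lambda> \<Lambda>' = wsum (\<lambda>_. 1) (\<lambda>n. A \<Lambda> n + (- 1) * A \<Lambda>' n) (\<lambda>n. A \<Lambda> n + (- 1) * A \<Lambda>' n)
     + wsum (\<lambda>_. 1) (\<lambda>n. B \<Lambda> n + (- 1) * B \<Lambda>' n) (\<lambda>n. B \<Lambda> n + (- 1) * B \<Lambda>' n)" for \<Lambda> \<Lambda>'
  define S where "S \<Lambda> = wsum (\<lambda>n. real (Suc n) ^ 2) (A \<Lambda>) (A \<Lambda>) + wsum (\<lambda>n. real (Suc n) ^ 2) (B \<Lambda>) (B \<Lambda>)" for \<Lambda>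
  have wsum1: "wsum (\<lambda>_. 1) C C \<ge> 0" "(C 0)\<^sup>2 \<le> wsum (\<lambda>_. 1) C C" if "decay C" for C
  proof -
    note s = wsum_sums[OF one_weight that that]
    show "wsum (\<lambda>_. 1) C C \<ge> 0" by (rule wsum_eq_0_iff(1)[OF one_weight _ that]) simp
    show "(C 0)\<^sup>2 \<le> wsum (\<lambda>_. 1) C C"
      using sum_le_suminf[OF sums_summable[OF s], of "{0}"] by (simp add: wsum_def power2_eq_square)
  qed
  define \<alpha> where "\<alpha> = \<beta> * k ^ 4"
  have \<alpha>: "\<alpha> > 0" using pos by (simp add: \<alpha>_def)
  define M where "M = \<bar>k\<^sup>2 * c\<bar>"
  define K1 where "K1 = (M + \<bar>h\<bar> + 1) / \<alpha>"
  have K1: "K1 > 0" using \<alpha> by (simp add: K1_def M_def divide_pos_pos add_nonneg_pos)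
  have S_bound: "S \<Lambda> \<le> K1 * (1 + N2 \<Lambda>)" if "\<Lambda> > 0" for \<Lambda>
  proof -
    have "a n \<ge> \<alpha> * real (Suc n) ^ 2 - M" for n
    proof -
      have "\<gamma> / real (Suc n) ^ 2 \<ge> 0" "\<rho>\<^sup>2 / real (Suc n) ^ 2 \<ge> 0"
        using pos by (auto intro!: divide_nonneg_nonneg)
      then show ?thesis unfolding a_def \<alpha>_def M_def by linarith
    qed
    from solution_derivative_bound[OF \<alpha> this sol[OF that]]
    have "\<alpha> * S \<Lambda> \<le> (M + h) * N2 \<Lambda> + A \<Lambda> 0" by (simp add: S_def N2_def)
    also have "\<dots> \<le> (M + \<bar>h\<bar>) * N2 \<Lambda> + (1 + N2 \<Lambda>)"
    proof (rule add_mono)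
      have "N2 \<Lambda> \<ge> 0" unfolding N2_def using wsum1(1) decay[OF that] by (simp add: add_nonneg_nonneg)
      then show "(M + h) * N2 \<Lambda> \<le> (M + \<bar>h\<bar>) * N2 \<Lambda>" by (intro mult_right_mono) auto
      have "A \<Lambda> 0 \<le> 1 + (A \<Lambda> 0)\<^sup>2"
        using zero_le_power2[of "A \<Lambda> 0 - 1 / 2"] by (simp add: power2_diff power_divide)
      also have "\<dots> \<le> 1 + N2 \<Lambda>"
        unfolding N2_def using wsum1(2)[OF decay(1)[OF that]] wsum1(1)[OF decay(2)[OF that]] by linarith
      finally show "A \<Lambda> 0 \<le> 1 + N2 \<Lambda>" .
    qed
    also have "\<dots> \<le> (M + \<bar>h\<bar> + 1) * (1 + N2 \<Lambda>)"
      by (simp add: algebra_simps M_def)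
    finally show ?thesis
      using \<alpha> by (simp add: K1_def field_simps)
  qed
  \<comment> \<open>The bound \<open>C\<close> of the inverse at the fixed \<Lambda> is applied to
    the difference of two solutions. The derivative on the right belongs to the moving parameter
    \<Lambda>', so this is not yet continuity.\<close>
  have cont_bound: "\<exists>C. \<forall>\<Lambda>'>0. dd \<Lambda> \<Lambda>' \<le> C * (\<Lambda>' - \<Lambda>)\<^sup>2 * S \<Lambda>'" if \<Lambda>: "\<Lambda> > 0" for \<Lambda>
  proof -
    obtain C where C: "\<And>\<phi> f. (\<phi>, f) \<in> G \<Lambda> \<Longrightarrow> L2_norm_torus \<phi> \<le> C * L2_norm_torus f"
      using inv[OF \<Lambda>] unfolding invertible_L2_def by blast
    show ?thesis
    proof (intro exI allI impI)
      fix \<Lambda>' :: real assume \<Lambda>': "\<Lambda>' > 0"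
      define r where "r = \<Lambda>' - \<Lambda>"
      obtain \<phi>1' where d: "weak_deriv (\<Phi> \<Lambda>') \<phi>1'"
        and diff: "(Re_lin 1 (- 1) (\<Phi> \<Lambda>) (\<Phi> \<Lambda>'), Re_lin r 0 \<phi>1' \<phi>1') \<in> G \<Lambda>"
        using G_graph_difference[OF \<Phi>[OF \<Lambda>, unfolded G_def] \<Phi>[OF \<Lambda>', unfolded G_def]] unfolding G_def r_def by blast
      have L2: "Re_lin 1 (- 1) (\<Phi> \<Lambda>) (\<Phi> \<Lambda>') \<in> L2_torus" "Re_lin r 0 \<phi>1' \<phi>1' \<in> L2_torus"
        using diff d by (auto simp: G_def G_graph_def weak_deriv_def)
      obtain N N' where N: "negligible N" "\<And>z. z \<in> circ - N \<Longrightarrow> Re (\<Phi> \<Lambda> z) = fser 0 (A \<Lambda>) z + fser sinph (B \<Lambda>) z"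
        and N': "negligible N'" "\<And>z. z \<in> circ - N' \<Longrightarrow> Re (\<Phi> \<Lambda>' z) = fser 0 (A \<Lambda>') z + fser sinph (B \<Lambda>') z"
        using coefs(3)[OF \<Lambda>] coefs(3)[OF \<Lambda>'] by blast
      have dec: "decay (\<lambda>n. A \<Lambda> n + (- 1) * A \<Lambda>' n)" "decay (\<lambda>n. B \<Lambda> n + (- 1) * B \<Lambda>' n)"
        by (intro decay_linear decay \<Lambda> \<Lambda>')+
      have "(L2_norm_torus (Re_lin 1 (- 1) (\<Phi> \<Lambda>) (\<Phi> \<Lambda>')))\<^sup>2 = pi * dd \<Lambda> \<Lambda>'"
        unfolding dd_def wsum_def mult_1_left
      proof (rule L2_norm_torus_series[OF L2(1) decay_summable[OF dec(1)] decay_summable[OF dec(2)]])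
        show "negligible (N \<union> N')" using N(1) N'(1) by (rule negligible_Un)
        fix z assume z: "z \<in> circ - (N \<union> N')"
        show "Re_lin 1 (- 1) (\<Phi> \<Lambda>) (\<Phi> \<Lambda>') z = complex_of_real
            (fser 0 (\<lambda>n. A \<Lambda> n + (- 1) * A \<Lambda>' n) z + fser sinph (\<lambda>n. B \<Lambda> n + (- 1) * B \<Lambda>' n) z)"
          using z by (simp only: fser_linear[OF decay_summable decay_summable] decay \<Lambda> \<Lambda>' Re_lin_def)
            (simp add: N(2) N'(2) algebra_simps)
      qed
      moreover have "(L2_norm_torus (Re_lin r 0 \<phi>1' \<phi>1'))\<^sup>2 = pi * (r\<^sup>2 * S \<Lambda>')"
      proof -
        note series = G_graph_Re_series[OF \<Phi>[OF \<Lambda>', unfolded G_def] d, folded A_def B_def]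
        obtain N where N: "negligible N" "\<And>z. z \<in> circ - N \<Longrightarrow> Re (\<phi>1' z)
            = fser 0 (\<lambda>n. real (Suc n) * B \<Lambda>' n) z + fser sinph (\<lambda>n. - (real (Suc n) * A \<Lambda>' n)) z"
          using series(3) by blast
        have zero: "summable (\<lambda>n. \<bar>0 :: real\<bar>)" "fser b (\<lambda>n. 0) z = 0" for b z
          by (simp_all add: fser_def)
        \<comment> \<open>Scaling is written as a combination with the zero sequence, so that
          linearity of the series covers it.\<close>
        have scal: "fser b (\<lambda>n. 0 + r * C n) z = r * fser b C z" "summable (\<lambda>n. \<bar>0 + r * C n\<bar>)"
          if "summable (\<lambda>n. \<bar>C n\<bar>)" for b C z
          using fser_linear[OF zero(1) that, of b r z] zero(2) summable_mult[OF that, of "\<bar>r\<bar>"]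
          by (simp_all add: abs_mult)
        have "(L2_norm_torus (Re_lin r 0 \<phi>1' \<phi>1'))\<^sup>2 = pi * ((\<Sum>n. (0 + r * (real (Suc n) * B \<Lambda>' n)) * (0 + r * (real (Suc n) * B \<Lambda>' n)))
            + (\<Sum>n. (0 + r * - (real (Suc n) * A \<Lambda>' n)) * (0 + r * - (real (Suc n) * A \<Lambda>' n))))"
        proof (rule L2_norm_torus_series[OF L2(2) scal(2)[OF series(1)] scal(2)[OF series(2)] N(1)])
          fix z assume "z \<in> circ - N"
          then show "Re_lin r 0 \<phi>1' \<phi>1' z = complex_of_real (fser 0 (\<lambda>n. 0 + r * (real (Suc n) * B \<Lambda>' n)) z
              + fser sinph (\<lambda>n. 0 + r * - (real (Suc n) * A \<Lambda>' n)) z)"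
            unfolding scal(1)[OF series(1)] scal(1)[OF series(2)] by (simp add: Re_lin_def N(2) algebra_simps)
        qed
        also have "(\<Sum>n. (0 + r * (real (Suc n) * B \<Lambda>' n)) * (0 + r * (real (Suc n) * B \<Lambda>' n)))
            = r\<^sup>2 * wsum (\<lambda>n. real (Suc n) ^ 2) (B \<Lambda>') (B \<Lambda>')"
          using sums_mult[OF wsum_sums[of "\<lambda>n. real (Suc n) ^ 2" 1, OF _ decay(2)[OF \<Lambda>'] decay(2)[OF \<Lambda>']], of "r\<^sup>2"]
          by (simp add: wsum_def sums_iff power2_eq_square mult_ac del: of_nat_Suc)
        also have "(\<Sum>n. (0 + r * - (real (Suc n) * A \<Lambda>' n)) * (0 + r * - (real (Suc n) * A \<Lambda>' n)))
            = r\<^sup>2 * wsum (\<lambda>n. real (Suc n) ^ 2) (A \<Lambda>') (A \<Lambda>')"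
          using sums_mult[OF wsum_sums[of "\<lambda>n. real (Suc n) ^ 2" 1, OF _ decay(1)[OF \<Lambda>'] decay(1)[OF \<Lambda>']], of "r\<^sup>2"]
          by (simp add: wsum_def sums_iff power2_eq_square mult_ac del: of_nat_Suc)
        finally show ?thesis by (simp add: S_def algebra_simps)
      qed
      moreover have "(L2_norm_torus (Re_lin 1 (- 1) (\<Phi> \<Lambda>) (\<Phi> \<Lambda>')))\<^sup>2 \<le> (C * L2_norm_torus (Re_lin r 0 \<phi>1' \<phi>1'))\<^sup>2"
        by (intro power_mono C diff L2_norm_torus_squared(2) L2)
      ultimately have "pi * dd \<Lambda> \<Lambda>' \<le> C\<^sup>2 * (pi * (r\<^sup>2 * S \<Lambda>'))"
        by (simp add: power_mult_distrib)
      then have "pi * dd \<Lambda> \<Lambda>' \<le> pi * (C\<^sup>2 * r\<^sup>2 * S \<Lambda>')" by (simp add: mult_ac)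
      then show "dd \<Lambda> \<Lambda>' \<le> C\<^sup>2 * (\<Lambda>' - \<Lambda>)\<^sup>2 * S \<Lambda>'" unfolding r_def by (rule mult_left_le_imp_le) simp
    qed
  qed
  \<comment> \<open>Brings the norm at \<Lambda>' back to the norm at \<Lambda>, at the price of the
    distance that is being estimated.\<close>
  have N2_diff: "N2 \<Lambda>' \<le> 2 * N2 \<Lambda> + 2 * dd \<Lambda> \<Lambda>'" if \<Lambda>: "\<Lambda> > 0" "\<Lambda>' > 0" for \<Lambda> \<Lambda>'
  proof -
    have *: "wsum (\<lambda>_. 1) D D \<le> 2 * wsum (\<lambda>_. 1) C C + 2 * wsum (\<lambda>_. 1) (\<lambda>n. C n + (-1) * D n) (\<lambda>n. C n + (-1) * D n)"
      if C: "decay C" and D: "decay D" for C D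
    proof (rule sums_le)
      show "(\<lambda>n. 1 * D n * D n) sums wsum (\<lambda>_. 1) D D" by (rule wsum_sums[OF one_weight D D])
      show "(\<lambda>n. 2 * (1 * C n * C n) + 2 * (1 * (C n + (-1) * D n) * (C n + (-1) * D n))) sums
          (2 * wsum (\<lambda>_. 1) C C + 2 * wsum (\<lambda>_. 1) (\<lambda>n. C n + (-1) * D n) (\<lambda>n. C n + (-1) * D n))"
        by (intro sums_add sums_mult wsum_sums[OF one_weight] C D decay_linear)
      show "1 * D n * D n \<le> 2 * (1 * C n * C n) + 2 * (1 * (C n + (-1) * D n) * (C n + (-1) * D n))" for n
        using zero_le_power2[of "2 * C n - D n"] by (simp add: power2_eq_square algebra_simps)
    qed
    have arith: "x + y \<le> 2 * (u + v) + 2 * (p + q)" if "x \<le> 2 * u + 2 * p" "y \<le> 2 * v + 2 * q" for x y u v p q :: real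
      using add_mono[OF that] by (simp add: algebra_simps)
    show ?thesis
      unfolding N2_def dd_def by (intro arith * decay \<Lambda>)
  qed
  have continuous: "isCont (\<lambda>\<Lambda>. A \<Lambda> 0) \<Lambda>" if \<Lambda>: "\<Lambda> > 0" for \<Lambda>
  proof -
    obtain C0 where C0: "\<And>\<Lambda>'. \<Lambda>' > 0 \<Longrightarrow> dd \<Lambda> \<Lambda>' \<le> C0 * (\<Lambda>' - \<Lambda>)\<^sup>2 * S \<Lambda>'"
      using cont_bound[OF \<Lambda>] by blast
    define C where "C = max C0 1"
    have S0: "S \<Lambda>' \<ge> 0" if "\<Lambda>' > 0" for \<Lambda>'
      unfolding S_def using decay[OF that]
      by (intro add_nonneg_nonneg wsum_eq_0_iff(1)[where K = 1]) auto
    have C: "dd \<Lambda> \<Lambda>' \<le> C * (\<Lambda>' - \<Lambda>)\<^sup>2 * S \<Lambda>'" if "\<Lambda>' > 0" for \<Lambda>'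
    proof -
      have "C0 * ((\<Lambda>' - \<Lambda>)\<^sup>2 * S \<Lambda>') \<le> C * ((\<Lambda>' - \<Lambda>)\<^sup>2 * S \<Lambda>')"
        using S0[OF that] by (intro mult_right_mono) (auto simp: C_def)
      with C0[OF that] show ?thesis by (simp add: mult.assoc)
    qed
    have Cpos: "C > 0" by (simp add: C_def)
    \<comment> \<open>The square of a local Lipschitz constant; the leading 2 comes from absorbing
      half of the distance on the left.\<close>
    define L where "L = 2 * (C * K1) * (1 + 2 * N2 \<Lambda>)"
    have bound: "(A \<Lambda>' 0 - A \<Lambda> 0)\<^sup>2 \<le> L * (\<Lambda>' - \<Lambda>)\<^sup>2"
      if \<Lambda>': "\<Lambda>' > 0" and small: "C * K1 * (\<Lambda>' - \<Lambda>)\<^sup>2 \<le> 1 / 4" for \<Lambda>'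
    proof -
      define x where "x = C * K1 * (\<Lambda>' - \<Lambda>)\<^sup>2"
      have x: "x \<ge> 0" "x \<le> 1 / 4" using Cpos K1 small by (auto simp: x_def)
      have dec: "decay (\<lambda>n. A \<Lambda> n + (- 1) * A \<Lambda>' n)" "decay (\<lambda>n. B \<Lambda> n + (- 1) * B \<Lambda>' n)"
        by (intro decay_linear decay \<Lambda> \<Lambda>')+
      have dd: "(A \<Lambda> 0 - A \<Lambda>' 0)\<^sup>2 \<le> dd \<Lambda> \<Lambda>'" and dd0: "dd \<Lambda> \<Lambda>' \<ge> 0"
        unfolding dd_def using wsum1(2)[OF dec(1)] wsum1(1)[OF dec(1)] wsum1(1)[OF dec(2)] by auto
      have "dd \<Lambda> \<Lambda>' \<le> C * (\<Lambda>' - \<Lambda>)\<^sup>2 * S \<Lambda>'" by (rule C[OF \<Lambda>'])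
      also have "\<dots> \<le> C * (\<Lambda>' - \<Lambda>)\<^sup>2 * (K1 * (1 + N2 \<Lambda>'))"
        using Cpos by (intro mult_left_mono S_bound \<Lambda>') simp
      also have "\<dots> = x * (1 + N2 \<Lambda>')" by (simp add: x_def)
      also have "\<dots> \<le> x * (1 + (2 * N2 \<Lambda> + 2 * dd \<Lambda> \<Lambda>'))"
        using N2_diff[OF \<Lambda> \<Lambda>'] x by (intro mult_left_mono) auto
      also have "\<dots> = x * (1 + 2 * N2 \<Lambda>) + 2 * (x * dd \<Lambda> \<Lambda>')" by (simp add: algebra_simps)
      \<comment> \<open>Since \<open>dd\<close> appears with factor \<open>2 * x\<close>, the bound
        \<open>1 / 4\<close> leaves half of it, which is absorbed.\<close>
      also have "x * dd \<Lambda> \<Lambda>' \<le> 1 / 4 * dd \<Lambda> \<Lambda>'" using x dd0 by (intro mult_right_mono)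
      finally have "dd \<Lambda> \<Lambda>' \<le> 2 * (x * (1 + 2 * N2 \<Lambda>))" by simp
      also have "\<dots> = L * (\<Lambda>' - \<Lambda>)\<^sup>2" by (simp add: L_def x_def algebra_simps)
      finally show ?thesis using dd by (simp add: power2_commute)
    qed
    \<comment> \<open>The first entry keeps \<Lambda>' positive, the second makes the absorption
      possible.\<close>
    define d where "d = min \<Lambda> (sqrt (1 / (4 * (C * K1))))"
    have d: "d > 0" using \<Lambda> Cpos K1 by (simp add: d_def)
    have L: "\<bar>A \<Lambda>' 0 - A \<Lambda> 0\<bar> \<le> sqrt L * \<bar>\<Lambda>' - \<Lambda>\<bar>" if "\<bar>\<Lambda>' - \<Lambda>\<bar> < d" for \<Lambda>'
    proof -
      have "\<bar>\<Lambda>' - \<Lambda>\<bar>\<^sup>2 \<le> (sqrt (1 / (4 * (C * K1))))\<^sup>2"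
        using that by (intro power_mono) (auto simp: d_def)
      then have "(\<Lambda>' - \<Lambda>)\<^sup>2 \<le> 1 / (4 * (C * K1))" using Cpos K1 by simp
      then have "C * K1 * (\<Lambda>' - \<Lambda>)\<^sup>2 \<le> 1 / 4" using Cpos K1 by (simp add: field_simps)
      moreover have "\<Lambda>' > 0" using that by (auto simp: d_def)
      ultimately have "(A \<Lambda>' 0 - A \<Lambda> 0)\<^sup>2 \<le> L * (\<Lambda>' - \<Lambda>)\<^sup>2" using bound by blast
      then have "sqrt ((A \<Lambda>' 0 - A \<Lambda> 0)\<^sup>2) \<le> sqrt (L * (\<Lambda>' - \<Lambda>)\<^sup>2)" by (rule real_sqrt_le_mono)
      then show ?thesis by (simp add: real_sqrt_mult)
    qed
    have "((\<lambda>\<Lambda>'. sqrt L * \<bar>\<Lambda>' - \<Lambda>\<bar>) \<longlongrightarrow> 0) (at \<Lambda>)"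
      by (auto intro!: tendsto_eq_intros)
    moreover have "eventually (\<lambda>\<Lambda>'. norm (A \<Lambda>' 0 - A \<Lambda> 0) \<le> sqrt L * \<bar>\<Lambda>' - \<Lambda>\<bar>) (at \<Lambda>)"
      using d L by (auto simp: eventually_at dist_real_def)
    ultimately have "((\<lambda>\<Lambda>'. A \<Lambda>' 0 - A \<Lambda> 0) \<longlongrightarrow> 0) (at \<Lambda>)"
      by (rule Lim_null_comparison[rotated])
    then show ?thesis unfolding isCont_def by (rule LIM_zero_cancel)
  qed
  obtain l where l: "l > 0" "\<And>\<Lambda> C D. \<lbrakk>0 < \<Lambda>; \<Lambda> < l; solution \<Lambda> C D\<rbrakk> \<Longrightarrow> C 0 < 0"
    by (rule solution_small) (rule that)
  obtain u where u: "\<And>\<Lambda> C D. \<lbrakk>\<Lambda> > u; solution \<Lambda> C D\<rbrakk> \<Longrightarrow> C 0 > 0"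
    by (rule solution_large) (rule that)
  define x y where "x = l / 2" and "y = max x u + 1"
  have x: "0 < x" "x < l" and y: "x \<le> y" "u < y" "0 < y"
    using l(1) by (auto simp: x_def y_def)
  have "A x 0 < 0" by (rule l(2)[OF x sol[OF x(1)]])
  moreover have "A y 0 > 0" by (rule u[OF y(2) sol[OF y(3)]])
  ultimately have "\<exists>\<Lambda>. x \<le> \<Lambda> \<and> \<Lambda> \<le> y \<and> A \<Lambda> 0 = 0"
    using continuous x y by (intro IVT) auto
  then obtain \<Lambda> where "x \<le> \<Lambda>" "A \<Lambda> 0 = 0" by blast
  then show False
    using solution_nonzero[OF sol, of \<Lambda>] x(1) by simp
qed

section \<open>The translational zero mode\<close>

lemma deriv_scale_arg:
  fixes g :: "real \<Rightarrow> real"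
  assumes "\<And>x. (g has_real_derivative g' x) (at x)"
  shows "deriv (\<lambda>x. a * g (k * x)) = (\<lambda>x. (a * k) * g' (k * x))"
proof
  fix x
  have "((\<lambda>x. a * g (k * x)) has_real_derivative a * (g' (k * x) * k)) (at x)"
    by (intro DERIV_cmult DERIV_chain2[OF assms]) (auto intro!: derivative_eq_intros)
  then show "deriv (\<lambda>x. a * g (k * x)) x = (a * k) * g' (k * x)"
    by (simp add: DERIV_imp_deriv mult_ac)
qed

text \<open>The wave equation is stated through the expression that
  \<open>c + \<beta> k\<^sup>2 \<partial>\<^sup>2 - 2 \<eta>\<close> produces from
  \<open>deriv \<eta>\<close>, so that one further derivative is already the linearized equation for
  \<open>deriv \<eta>\<close>.\<close>

lemma profile_equation:
  fixes \<eta> :: "real \<Rightarrow> real"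
  assumes \<eta>: "smooth \<eta>" and k: "k > 0"
    and sol: "solves_RMKP \<beta> \<gamma> (\<lambda>x y t. \<eta> (k * (x - c * t)))"
  shows "((\<lambda>z. c * deriv \<eta> z + \<beta> * k\<^sup>2 * deriv (deriv (deriv \<eta>)) z - 2 * \<eta> z * deriv \<eta> z)
    has_real_derivative - (\<gamma> / k\<^sup>2) * \<eta> z) (at z)"
proof -
  define d1 d2 d3 d4 where "d1 = deriv \<eta>" and "d2 = deriv d1" and "d3 = deriv d2" and "d4 = deriv d3"
  have s: "smooth d1" "smooth d2" "smooth d3"
    using \<eta> smoothD(2) by (simp_all add: d1_def d2_def d3_def)
  have D: "(\<eta> has_real_derivative d1 x) (at x)" "(d1 has_real_derivative d2 x) (at x)"
    "(d2 has_real_derivative d3 x) (at x)" "(d3 has_real_derivative d4 x) (at x)" for x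
    using smoothD(1) \<eta> s by (simp_all add: d1_def d2_def d3_def d4_def)
  define W where "W z = c * d1 z + \<beta> * k\<^sup>2 * d3 z - 2 * \<eta> z * d1 z" for z
  define W' where "W' z = c * d2 z + \<beta> * k\<^sup>2 * d4 z - 2 * (d1 z * d1 z + \<eta> z * d2 z)" for z
  have W: "(W has_real_derivative W' z) (at z)" for z
    unfolding W_def[abs_def] W'_def using D by (auto intro!: derivative_eq_intros)
  have dt: "deriv (\<lambda>t. \<eta> (k * (x - c * t))) 0 = - (k * c) * d1 (k * x)" for x
  proof -
    have "((\<lambda>t. \<eta> (k * (x - c * t))) has_real_derivative d1 (k * (x - c * 0)) * (- (k * c))) (at 0)"
      by (rule DERIV_chain2[OF D(1)]) (auto intro!: derivative_eq_intros)
    then show ?thesis by (simp add: DERIV_imp_deriv)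
  qed
  have dxxx: "(deriv ^^ 3) (\<lambda>x. \<eta> (k * x)) = (\<lambda>x. k ^ 3 * d3 (k * x))"
    using deriv_scale_arg[OF D(1), of 1 k] deriv_scale_arg[OF D(2), of k k] deriv_scale_arg[OF D(3), of "k * k" k]
    by (simp add: numeral_3_eq_3 mult.assoc)
  have dsq: "deriv (\<lambda>x. (\<eta> (k * x))\<^sup>2) x = 2 * k * \<eta> (k * x) * d1 (k * x)" for x
  proof -
    have "((\<lambda>x. \<eta> x * \<eta> x) has_real_derivative 2 * \<eta> x * d1 x) (at x)" for x
      using D(1)[of x] by (auto intro!: derivative_eq_intros)
    from fun_cong[OF deriv_scale_arg[OF this, of 1 k], of x] show ?thesis
      by (simp add: power2_eq_square)
  qed
  define x where "x = z / k"
  have kx: "k * x = z" using k by (simp add: x_def)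
  \<comment> \<open>At \<open>t = 0\<close> and \<open>y = 0\<close> everything under the outer
    x-derivative collapses to one function of \<open>k * x\<close>.\<close>
  have inner: "(\<lambda>x. deriv (\<lambda>t. \<eta> (k * (x - c * t))) 0 - \<beta> * (deriv ^^ 3) (\<lambda>x. \<eta> (k * (x - c * 0))) x
       + deriv (\<lambda>x. (\<eta> (k * (x - c * 0)))\<^sup>2) x) = (\<lambda>x. - k * W (k * x))"
    unfolding dt mult_zero_right diff_zero dxxx dsq W_def
    by (simp add: algebra_simps power2_eq_square power3_eq_cube)
  have "deriv (\<lambda>x. - k * W (k * x)) x - \<gamma> * \<eta> (k * x) = 0"
    using spec[OF spec[OF spec[OF sol[unfolded solves_RMKP_def], of x], of 0], of 0] unfolding inner
    by (simp add: numeral_2_eq_2)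
  then have "- k * k * W' z = \<gamma> * \<eta> z"
    unfolding deriv_scale_arg[OF W] kx by simp
  then have "W' z = - (\<gamma> / k\<^sup>2) * \<eta> z"
    using k by (simp add: field_simps power2_eq_square)
  with W[of z] show ?thesis
    unfolding W_def[abs_def] d1_def d2_def d3_def by simp
qed

text \<open>Translation invariance: differentiating the profile equation once more in
  \<open>z\<close> puts \<open>deriv \<eta>\<close> in the kernel at \<open>\<Lambda> = 0\<close>,
  \<open>\<rho> = 0\<close>.\<close>

lemma zero_mode:
  fixes \<eta> :: "real \<Rightarrow> real"
  assumes \<eta>: "smooth \<eta>" "periodic \<eta>" and k: "k > 0"
    and sol: "solves_RMKP \<beta> \<gamma> (\<lambda>x y t. \<eta> (k * (x - c * t)))"
  shows "(\<lambda>z. of_real (deriv \<eta> z), \<lambda>z. 0) \<in> G_graph \<beta> \<gamma> k c \<eta> (of_real 0) 0"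
proof -
  define W where "W z = c * deriv \<eta> z + \<beta> * k\<^sup>2 * deriv (deriv (deriv \<eta>)) z - 2 * \<eta> z * deriv \<eta> z" for z
  have s: "smooth (deriv \<eta>)" "smooth (deriv (deriv \<eta>))" "smooth (deriv (deriv (deriv \<eta>)))"
    using \<eta> smoothD(2) by simp_all
  have p: "periodic (deriv \<eta>)" "periodic (deriv (deriv \<eta>))" "periodic (deriv (deriv (deriv \<eta>)))"
    using \<eta> s periodic_deriv by simp_all
  have "weak_deriv (\<lambda>z. of_real (W z)) (\<lambda>z. of_real (- (\<gamma> / k\<^sup>2) * \<eta> z))"
  proof (rule weak_deriv_classical)
    show "(W has_real_derivative - (\<gamma> / k\<^sup>2) * \<eta> z) (at z)" for z
      unfolding W_def[abs_def] by (rule profile_equation[OF \<eta>(1) k sol])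
    show "continuous_on UNIV (\<lambda>z. - (\<gamma> / k\<^sup>2) * \<eta> z)"
      by (intro continuous_intros smoothD(3) \<eta>)
  qed (use \<eta> p in \<open>auto simp: periodic_def W_def\<close>)
  moreover have "(\<lambda>z. complex_of_real (W z)) = (\<lambda>z. of_real c * of_real (deriv \<eta> z)
      + of_real (\<beta> * k\<^sup>2) * of_real (deriv (deriv (deriv \<eta>)) z) - 2 * of_real (\<eta> z) * of_real (deriv \<eta> z))"
    by (simp add: W_def)
  ultimately have W: "weak_deriv (\<lambda>z. of_real c * of_real (deriv \<eta> z)
      + of_real (\<beta> * k\<^sup>2) * of_real (deriv (deriv (deriv \<eta>)) z) - 2 * of_real (\<eta> z) * of_real (deriv \<eta> z))
      (\<lambda>z. of_real (- (\<gamma> / k\<^sup>2) * \<eta> z))" by simp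
  have "weak_deriv (\<lambda>z. of_real (- (\<gamma> / k\<^sup>2) * \<eta> z)) (\<lambda>z. of_real (- (\<gamma> / k\<^sup>2) * deriv \<eta> z))"
  proof (rule weak_deriv_classical)
    show "((\<lambda>z. - (\<gamma> / k\<^sup>2) * \<eta> z) has_real_derivative - (\<gamma> / k\<^sup>2) * deriv \<eta> z) (at z)" for z
      by (intro DERIV_cmult smoothD(1) \<eta>)
    show "continuous_on UNIV (\<lambda>z. - (\<gamma> / k\<^sup>2) * deriv \<eta> z)"
      by (intro continuous_intros smoothD(3) s)
  qed (use \<eta> p in \<open>auto simp: periodic_def\<close>)
  moreover have "(\<lambda>z. 0) \<in> L2_torus"
    using smooth_H_torus[of "\<lambda>z. 0" 0] smooth_scaled_cos[of 0 0 0] by (simp add: periodic_def)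
  moreover have "AE z in lebesgue. 0 = complex_of_real 0 * of_real (deriv (deriv \<eta>) z)
      - of_real (k\<^sup>2) * of_real (- (\<gamma> / k\<^sup>2) * deriv \<eta> z) - of_real (0\<^sup>2) * of_real (deriv \<eta> z) - of_real \<gamma> * of_real (deriv \<eta> z)"
    using k by (intro AE_I2) (simp flip: of_real_mult of_real_diff of_real_power of_real_divide)
  ultimately show ?thesis
    using W smooth_H_torus[OF s(1) p(1), of 4] weak_deriv_smooth[OF s(1) p(1)] weak_deriv_smooth[OF s(2) p(2)]
    unfolding G_graph_def by blast
qed

section \<open>Small-amplitude waves\<close>

lemma has_integral_cos_multiple:
  "((\<lambda>z. cos z) has_integral 0) circ" "((\<lambda>z. cos (2 * z)) has_integral 0) circ"
  "((\<lambda>z. cos (3 * z)) has_integral 0) circ" "((\<lambda>z. cos (4 * z)) has_integral 0) circ"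
  "((\<lambda>z. cos (5 * z)) has_integral 0) circ" "((\<lambda>z. cos (6 * z)) has_integral 0) circ"
  using has_integral_cos_circ[of 1 0] has_integral_cos_circ[of 2 0] has_integral_cos_circ[of 3 0]
    has_integral_cos_circ[of 4 0] has_integral_cos_circ[of 5 0] has_integral_cos_circ[of 6 0] by simp_all

lemma cos_multiples:
  fixes z :: real
  shows "cos (2 * z) = 2 * cos z ^ 2 - 1" "cos (3 * z) = 4 * cos z ^ 3 - 3 * cos z"
    "cos (4 * z) = 2 * (2 * cos z ^ 2 - 1) ^ 2 - 1"
    "cos (5 * z) = 2 * cos z * (2 * (2 * cos z ^ 2 - 1) ^ 2 - 1) - (4 * cos z ^ 3 - 3 * cos z)"
    "cos (6 * z) = 2 * (4 * cos z ^ 3 - 3 * cos z) ^ 2 - 1"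
proof -
  show 2: "cos (2 * z) = 2 * cos z ^ 2 - 1" for z :: real by (rule cos_double_cos)
  show 3: "cos (3 * z) = 4 * cos z ^ 3 - 3 * cos z" by (rule cos_treble_cos)
  have "cos (4 * z) = cos (2 * (2 * z))" by simp
  then show 4: "cos (4 * z) = 2 * (2 * cos z ^ 2 - 1) ^ 2 - 1" unfolding 2 .
  have "4 * z - z = 3 * z" "4 * z + z = 5 * z" by simp_all
  then have "cos (4 * z) * cos z = (cos (3 * z) + cos (5 * z)) / 2"
    using cos_times_cos[of "4 * z" z] by (simp only:)
  then show "cos (5 * z) = 2 * cos z * (2 * (2 * cos z ^ 2 - 1) ^ 2 - 1) - (4 * cos z ^ 3 - 3 * cos z)"
    unfolding 3 4 by (simp add: field_simps)
  have "cos (6 * z) = cos (2 * (3 * z))" by simp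
  then show "cos (6 * z) = 2 * (4 * cos z ^ 3 - 3 * cos z) ^ 2 - 1" unfolding 2 3 .
qed

text \<open>The second order part of the wave against the square of the test function: after
  expansion in cosines of multiples of \<open>z\<close>, only the constant term contributes.\<close>

lemma cubic_trig_integral:
  "((\<lambda>z. (x * cos z + y * cos (2 * z)) * (cos z + s * cos (2 * z))\<^sup>2) has_integral pi * (x * s + y / 2)) circ"
proof -
  have "((\<lambda>z. (x * s / 2 + y / 4) + (x * (3 / 4 + s\<^sup>2 / 2) + y * s) * cos z + (x * s + y / 2 + y * s\<^sup>2 * 3 / 4) * cos (2 * z)
      + (x * (1 / 4 + s\<^sup>2 / 4) + y * s / 2) * cos (3 * z) + (x * s / 2 + y / 4) * cos (4 * z)
      + (x * s\<^sup>2 / 4 + y * s / 2) * cos (5 * z) + y * s\<^sup>2 / 4 * cos (6 * z)) has_integral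
      (2 * pi * (x * s / 2 + y / 4) + (x * (3 / 4 + s\<^sup>2 / 2) + y * s) * 0 + (x * s + y / 2 + y * s\<^sup>2 * 3 / 4) * 0
      + (x * (1 / 4 + s\<^sup>2 / 4) + y * s / 2) * 0 + (x * s / 2 + y / 4) * 0
      + (x * s\<^sup>2 / 4 + y * s / 2) * 0 + y * s\<^sup>2 / 4 * 0)) circ"
    using has_integral_const_real[of "x * s / 2 + y / 4" 0 "2 * pi"]
    by (intro has_integral_add has_integral_mult_right has_integral_cos_multiple) simp
  moreover have "(x * s / 2 + y / 4) + (x * (3 / 4 + s\<^sup>2 / 2) + y * s) * cos z + (x * s + y / 2 + y * s\<^sup>2 * 3 / 4) * cos (2 * z)
      + (x * (1 / 4 + s\<^sup>2 / 4) + y * s / 2) * cos (3 * z) + (x * s / 2 + y / 4) * cos (4 * z)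
      + (x * s\<^sup>2 / 4 + y * s / 2) * cos (5 * z) + y * s\<^sup>2 / 4 * cos (6 * z)
      = (x * cos z + y * cos (2 * z)) * (cos z + s * cos (2 * z))\<^sup>2" for z
    unfolding cos_multiples by (simp add: field_simps eval_nat_numeral)
  ultimately show ?thesis by (simp add: algebra_simps)
qed


text \<open>The left side factors as \<open>(s^2 - 1) * (\<beta> * k ^ 4 - \<gamma> / s^2)\<close>.
  Both factors increase with \<open>s\<close>, and their product at \<open>s = 2\<close> is the
  bound.\<close>

lemma transverse_gap:
  fixes \<beta> \<gamma> k s :: real
  assumes "\<gamma> > 0" "4 * \<beta> * k ^ 4 > \<gamma>" "s \<ge> 2"
  shows "\<beta> * k ^ 4 * s\<^sup>2 - (\<gamma> + \<beta> * k ^ 4) + \<gamma> / s\<^sup>2 \<ge> 3 * (4 * \<beta> * k ^ 4 - \<gamma>) / 4"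
proof -
  have s: "s\<^sup>2 \<ge> 4" using power_mono[OF assms(3), of 2] by simp
  have "\<gamma> / s\<^sup>2 \<le> \<gamma> / 4" using s assms(1) by (intro divide_left_mono) auto
  then have "\<beta> * k ^ 4 - \<gamma> / 4 \<le> \<beta> * k ^ 4 - \<gamma> / s\<^sup>2" by simp
  then have "3 * (\<beta> * k ^ 4 - \<gamma> / 4) \<le> (s\<^sup>2 - 1) * (\<beta> * k ^ 4 - \<gamma> / s\<^sup>2)"
    using s assms(2) by (intro mult_mono) auto
  also have "\<dots> = \<beta> * k ^ 4 * s\<^sup>2 - (\<gamma> + \<beta> * k ^ 4) + \<gamma> / s\<^sup>2"
    using assms(3) by (simp add: field_simps)
  finally show ?thesis by (simp add: right_diff_distrib diff_divide_distrib)
qed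

text \<open>The statement for one wave, with all asymptotics replaced by the single constant
  \<open>R\<close>. \<open>small1\<close> preserves the spectral gap, \<open>small2\<close> keeps
  the first coefficient of the zero mode nonzero, and \<open>small3\<close> makes the cubic errors
  smaller than the leading negative energy.\<close>

lemma instability_of_small_wave:
  fixes \<beta> \<gamma> k c \<epsilon> e2 R \<rho>0 :: real and \<eta> :: "real \<Rightarrow> real"
  assumes pos: "\<beta> > 0" "\<gamma> > 0" "k > 0" and large: "4 * \<beta> * k ^ 4 > \<gamma>"
    and e2: "e2 = 2 * k\<^sup>2 / (3 * \<gamma> - 12 * \<beta> * k ^ 4)"
    and \<eta>: "smooth \<eta>" "periodic \<eta>" "\<And>z. \<eta> (- z) = \<eta> z"
    and sol: "solves_RMKP \<beta> \<gamma> (\<lambda>x y t. \<eta> (k * (x - c * t)))"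
    and \<epsilon>: "\<epsilon> \<noteq> 0" "\<bar>\<epsilon>\<bar> \<le> 1" and R: "R \<ge> 1" "\<bar>e2\<bar> \<le> R"
    and \<eta>1: "\<And>z. \<bar>\<eta> z\<bar> \<le> R * \<bar>\<epsilon>\<bar>"
    and \<eta>3: "\<And>z. \<bar>\<eta> z - (\<epsilon> * cos z + \<epsilon>\<^sup>2 * e2 * cos (2 * z))\<bar> \<le> R * \<bar>\<epsilon>\<bar> ^ 3"
    and c1: "\<bar>c - (\<gamma> / k\<^sup>2 + \<beta> * k\<^sup>2)\<bar> \<le> R * \<bar>\<epsilon>\<bar>"
    and c3: "\<bar>c - (\<gamma> / k\<^sup>2 + \<beta> * k\<^sup>2 + \<epsilon>\<^sup>2 * e2)\<bar> \<le> R * \<bar>\<epsilon>\<bar> ^ 3"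
    and small1: "3 * k\<^sup>2 * R * \<bar>\<epsilon>\<bar> \<le> 3 * (4 * \<beta> * k ^ 4 - \<gamma>) / 8"
    and small2: "2 * R * \<bar>\<epsilon>\<bar>\<^sup>2 < 1"
    and small3: "\<bar>\<epsilon>\<bar> * (3 * R + 12 * R ^ 3) < 2 * \<bar>e2\<bar>"
    and \<rho>0: "\<rho>0 > 0"
  shows "\<exists>\<rho>. 0 < \<bar>\<rho>\<bar> \<and> \<bar>\<rho>\<bar> \<le> \<rho>0 \<and> periodic_instability_at \<beta> \<gamma> k c \<eta> \<rho>"
proof -
  \<comment> \<open>The second coefficient of the \<epsilon>-derivative of the two leading terms of
    the wave.\<close>
  define s where "s = 2 * \<epsilon> * e2"
  define t :: "nat \<Rightarrow> real" where "t n = (if n = 0 then 1 else if n = 1 then s else 0)" for n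
  define a0 where "a0 n = \<beta> * k ^ 4 * real (Suc n) ^ 2 - k\<^sup>2 * c + \<gamma> / real (Suc n) ^ 2" for n
  define q where "q z = 2 * k\<^sup>2 * \<eta> z" for z
  define p where "p = fcoef sinph (deriv \<eta>)"
  define h where "h = 2 * k\<^sup>2 * (R * \<bar>\<epsilon>\<bar>)"
  \<comment> \<open>Half of the gap at zero amplitude. The other half pays for the potential,
    \<open>2 * k\<^sup>2 * R * \<bar>\<epsilon>\<bar>\<close>, and for the shift of the speed,
    \<open>k\<^sup>2 * R * \<bar>\<epsilon>\<bar>\<close>; hence the 3 in
    \<open>small1\<close>.\<close>
  define \<kappa> where "\<kappa> = 3 * (4 * \<beta> * k ^ 4 - \<gamma>) / 8"
  define K where "K = \<beta> * k ^ 4 + \<bar>k\<^sup>2 * c\<bar> + \<gamma>"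
  define c0 where "c0 = \<gamma> / k\<^sup>2 + \<beta> * k\<^sup>2"
  have kc0: "k\<^sup>2 * c0 = \<gamma> + \<beta> * k ^ 4"
    using pos by (simp add: c0_def field_simps power2_eq_square power4_eq_xxxx)
  have e2neg: "e2 < 0"
    unfolding e2 using pos large by (intro divide_pos_neg) auto
  have e2eq: "e2 * (4 * \<beta> * k ^ 4 - \<gamma>) = - 2 * k\<^sup>2 / 3"
    unfolding e2 using large by (simp add: field_simps)
  have cont: "continuous_on S \<eta>" for S by (rule smoothD(3)[OF \<eta>(1)])
  have even: "\<eta> (2 * pi - z) = \<eta> z" for z
    using \<eta>(2)[unfolded periodic_def, rule_format, of "- z"] \<eta>(3)[of z] by (simp add: add.commute)

  \<comment> \<open>The coefficient equations at \<open>\<Lambda> = 0\<close>,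
    \<open>\<rho> = 0\<close> and \<open>f = 0\<close>, applied to
    \<open>deriv \<eta>\<close>.\<close>
  have kernel: "decay p" "a0 n * p n + integral circ (\<lambda>z. q z * fser sinph p z * fbasis sinph n z) / pi = 0" for n
  proof -
    have Re: "(\<lambda>z. Re (complex_of_real (deriv \<eta> z))) = deriv \<eta>" by simp
    note co = coefficients_of_graph[OF zero_mode[OF \<eta>(1,2) pos(3) sol] cont even _ pos(2), unfolded Re, folded p_def]
    show "decay p" by (rule co(2)) simp
    have "fcoef sinph (\<lambda>z. Re 0) n = 0" by (simp add: fcoef_def)
    then show "a0 n * p n + integral circ (\<lambda>z. q z * fser sinph p z * fbasis sinph n z) / pi = 0"
      using co(5)[of n] unfolding a0_def q_def by simp
  qed

  \<comment> \<open>Up to sign this is the first cosine coefficient of \<eta>, which is \<epsilon>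
    up to a cubic error. If it vanished, \<open>pi * \<bar>\<epsilon>\<bar>\<close> would be at most
    \<open>2 * pi * R * \<bar>\<epsilon>\<bar> ^ 3\<close>.\<close>
  have p0: "p 0 \<noteq> 0"
  proof -
    have "p 0 = - fcoef 0 \<eta> 0"
      using fcoef_weak_deriv(2)[OF weak_deriv_smooth[OF \<eta>(1,2)], of 0] by (simp add: p_def)
    moreover have "fcoef 0 \<eta> 0 \<noteq> 0"
    proof
      assume zero: "fcoef 0 \<eta> 0 = 0"
      have I: "((\<lambda>z. (\<eta> z - (\<epsilon> * cos z + \<epsilon>\<^sup>2 * e2 * cos (2 * z))) * cos z) has_integral (0 - pi * \<epsilon>)) circ"
      proof -
        have "((\<lambda>z. \<eta> z * cos z) has_integral 0) circ"
        proof -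
          have "(\<lambda>z. \<eta> z * cos z) integrable_on circ"
            by (intro integrable_continuous_real continuous_intros cont)
          with zero show ?thesis
            by (simp add: fcoef_def fbasis_cos has_integral_iff)
        qed
        moreover have "((\<lambda>z. \<epsilon> / 2 + \<epsilon>\<^sup>2 * e2 / 2 * cos z + \<epsilon> / 2 * cos (2 * z) + \<epsilon>\<^sup>2 * e2 / 2 * cos (3 * z)) has_integral
            (pi * \<epsilon> + \<epsilon>\<^sup>2 * e2 / 2 * 0 + \<epsilon> / 2 * 0 + \<epsilon>\<^sup>2 * e2 / 2 * 0)) circ"
          using has_integral_const_real[of "\<epsilon> / 2" 0 "2 * pi"]
          by (intro has_integral_add has_integral_mult_right has_integral_cos_multiple) simp
        moreover have "\<epsilon> / 2 + \<epsilon>\<^sup>2 * e2 / 2 * cos z + \<epsilon> / 2 * cos (2 * z) + \<epsilon>\<^sup>2 * e2 / 2 * cos (3 * z)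
            = (\<epsilon> * cos z + \<epsilon>\<^sup>2 * e2 * cos (2 * z)) * cos z" for z
          unfolding cos_multiples by (simp add: field_simps eval_nat_numeral)
        ultimately have "((\<lambda>z. \<eta> z * cos z - (\<epsilon> * cos z + \<epsilon>\<^sup>2 * e2 * cos (2 * z)) * cos z) has_integral (0 - pi * \<epsilon>)) circ"
          by (intro has_integral_diff) auto
        then show ?thesis by (simp only: left_diff_distrib)
      qed
      have "norm (0 - pi * \<epsilon>) \<le> (R * \<bar>\<epsilon>\<bar> ^ 3) * measure lborel (cbox 0 (2 * pi))"
      proof (rule has_integral_bound)
        show "((\<lambda>z. (\<eta> z - (\<epsilon> * cos z + \<epsilon>\<^sup>2 * e2 * cos (2 * z))) * cos z) has_integral (0 - pi * \<epsilon>)) (cbox 0 (2 * pi))"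
          using I by simp
        show "norm ((\<eta> z - (\<epsilon> * cos z + \<epsilon>\<^sup>2 * e2 * cos (2 * z))) * cos z) \<le> R * \<bar>\<epsilon>\<bar> ^ 3" for z
          using mult_mono[OF \<eta>3[of z] abs_cos_le_one[of z]] R by (simp add: abs_mult)
      qed (use R in simp)
      then have "pi * \<bar>\<epsilon>\<bar> \<le> (2 * R * \<bar>\<epsilon>\<bar>\<^sup>2) * (pi * \<bar>\<epsilon>\<bar>)"
        by (simp add: abs_mult eval_nat_numeral mult_ac)
      also have "\<dots> < 1 * (pi * \<bar>\<epsilon>\<bar>)"
        using small2 \<epsilon> by (intro mult_strict_right_mono) auto
      finally show False by simp
    qed
    ultimately show ?thesis by simp
  qed

  have gap: "a0 n \<ge> \<kappa> + h" if n: "n \<ge> 1" for n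
  proof -
    have "real (Suc n) \<ge> 2" using n by simp
    note transverse_gap[OF pos(2) large this]
    moreover have "2 * \<kappa> = 3 * (4 * \<beta> * k ^ 4 - \<gamma>) / 4" by (simp add: \<kappa>_def)
    ultimately have 1: "\<beta> * k ^ 4 * real (Suc n) ^ 2 - k\<^sup>2 * c0 + \<gamma> / real (Suc n) ^ 2 \<ge> 2 * \<kappa>"
      unfolding kc0 by (simp only:)
    have "\<bar>k\<^sup>2 * (c - c0)\<bar> \<le> k\<^sup>2 * (R * \<bar>\<epsilon>\<bar>)"
      unfolding abs_mult using c1 by (simp add: c0_def mult_left_mono)
    then have "k\<^sup>2 * c \<le> k\<^sup>2 * c0 + k\<^sup>2 * (R * \<bar>\<epsilon>\<bar>)"
      by (simp add: abs_le_iff right_diff_distrib)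
    moreover have "3 * (k\<^sup>2 * (R * \<bar>\<epsilon>\<bar>)) \<le> \<kappa>"
      using small1 by (simp add: \<kappa>_def mult.assoc)
    ultimately show ?thesis
      using 1 unfolding a0_def h_def by linarith
  qed

  have base: "form_data a0 q K h"
  proof
    show "\<bar>a0 n\<bar> \<le> K * real (Suc n) ^ 2" for n
    proof -
      have 1: "real (Suc n) ^ 2 \<ge> 1" by (rule one_le_power) simp
      have arith: "\<bar>B - x + G\<bar> \<le> B + P" if "0 \<le> B" "0 \<le> G" "G \<le> g" "\<bar>x\<bar> + g \<le> P" for B x G P g :: real
        using that by linarith
      have "\<bar>a0 n\<bar> \<le> \<beta> * k ^ 4 * real (Suc n) ^ 2 + (\<bar>k\<^sup>2 * c\<bar> + \<gamma>) * real (Suc n) ^ 2"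
        unfolding a0_def
      proof (rule arith[of _ _ \<gamma>])
        show "\<gamma> / real (Suc n) ^ 2 \<le> \<gamma>"
          using divide_left_mono[of 1 "real (Suc n) ^ 2" \<gamma>] pos 1 by simp
        show "\<bar>k\<^sup>2 * c\<bar> + \<gamma> \<le> (\<bar>k\<^sup>2 * c\<bar> + \<gamma>) * real (Suc n) ^ 2"
          using mult_left_mono[OF 1, of "\<bar>k\<^sup>2 * c\<bar> + \<gamma>"] pos by simp
      qed (use pos in simp_all)
      then show ?thesis by (simp only: K_def distrib_right add.assoc)
    qed
    show "continuous_on circ q" unfolding q_def by (intro continuous_intros cont)
    show "\<bar>q z\<bar> \<le> h" for z
      using \<eta>1[of z] pos unfolding q_def h_def abs_mult by (intro mult_mono) auto
  qed

  have fser_t: "fser 0 t z = cos z + s * cos (2 * z)" for z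
    unfolding fser_def by (subst suminf_finite[of "{0, 1}"]) (auto simp: t_def fbasis_cos)
  have t_decay: "decay t" by (rule decay_finite_support[of 2]) (auto simp: t_def)
  have wsum_t: "wsum w t t = w 0 + s\<^sup>2 * w 1" for w
    unfolding wsum_def by (subst suminf_finite[of "{0, 1}"]) (auto simp: t_def power2_eq_square)
  define X where "X = - form a0 q 0 t t"
  \<comment> \<open>In units of \<open>k\<^sup>2 * \<epsilon>\<^sup>2 * e2\<close> the first mode
    contributes -1, the second -2 and the potential 5, so the total is 2. The errors
    \<open>R\<close>, \<open>4 R^3\<close> and \<open>2 R (1 + 4 R^2)\<close> add up to the constant
    in \<open>small3\<close>.\<close>
  have X: "X > 0"
  proof -
    define E where "E = \<bar>\<epsilon>\<bar>"
    have E: "0 < E" "E \<le> 1" "\<epsilon>\<^sup>2 = E\<^sup>2" using \<epsilon> by (auto simp: E_def)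
    have s2: "s\<^sup>2 = 4 * \<epsilon>\<^sup>2 * e2\<^sup>2" by (simp add: s_def power_mult_distrib)
    have e2R: "e2\<^sup>2 \<le> R\<^sup>2" using R(2) by (metis abs_ge_zero power2_abs power_mono)
    have s2_le: "s\<^sup>2 \<le> 4 * E\<^sup>2 * R\<^sup>2"
      unfolding s2 E(3) using e2R by (intro mult_left_mono) auto
    have "E\<^sup>2 \<le> 1" using E by (simp add: power_le_one)
    then have s2_le': "s\<^sup>2 \<le> 4 * R\<^sup>2"
      using s2_le mult_right_mono[of "E\<^sup>2" 1 "4 * R\<^sup>2"] by simp
    have a00: "a0 0 \<le> - k\<^sup>2 * (\<epsilon>\<^sup>2 * e2) + k\<^sup>2 * (R * E ^ 3)"
    proof -
      have "k\<^sup>2 * (c0 + \<epsilon>\<^sup>2 * e2 - R * E ^ 3) \<le> k\<^sup>2 * c"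
        using c3 unfolding c0_def[symmetric] E_def[symmetric] abs_le_iff by (intro mult_left_mono) auto
      then show ?thesis using kc0 unfolding a0_def by (simp add: algebra_simps)
    qed
    have a01: "s\<^sup>2 * a0 1 \<le> - 2 * k\<^sup>2 * (\<epsilon>\<^sup>2 * e2) + 4 * E\<^sup>2 * R\<^sup>2 * (k\<^sup>2 * (R * E))"
    proof -
      have a01: "a0 1 = 3 * (4 * \<beta> * k ^ 4 - \<gamma>) / 4 - k\<^sup>2 * (c - c0)"
        using kc0 unfolding a0_def by (simp add: field_simps)
      \<comment> \<open>The multiplier at frequency 2 is, to leading order, the denominator of
        \<open>e2\<close> up to a factor, so one power of \<open>e2\<close> cancels against it by
        \<open>e2eq\<close>.\<close>
      have "s\<^sup>2 * a0 1 = 3 * \<epsilon>\<^sup>2 * e2 * (e2 * (4 * \<beta> * k ^ 4 - \<gamma>)) + s\<^sup>2 * (k\<^sup>2 * - (c - c0))"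
        unfolding a01 s2 by (simp add: power2_eq_square field_simps)
      also have "3 * \<epsilon>\<^sup>2 * e2 * (e2 * (4 * \<beta> * k ^ 4 - \<gamma>)) = - 2 * k\<^sup>2 * (\<epsilon>\<^sup>2 * e2)"
        unfolding e2eq by simp
      also have "s\<^sup>2 * (k\<^sup>2 * - (c - c0)) \<le> s\<^sup>2 * (k\<^sup>2 * (R * E))"
        using c1 unfolding c0_def[symmetric] E_def[symmetric] abs_le_iff by (intro mult_left_mono) auto
      also have "s\<^sup>2 * (k\<^sup>2 * (R * E)) \<le> 4 * E\<^sup>2 * R\<^sup>2 * (k\<^sup>2 * (R * E))"
        using s2_le R E by (intro mult_right_mono) auto
      finally show ?thesis by simp
    qed
    have int: "integral circ (\<lambda>z. q z * (fser 0 t z * fser 0 t z)) / pi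
        \<le> 5 * k\<^sup>2 * (\<epsilon>\<^sup>2 * e2) + 2 * k\<^sup>2 * (R * E ^ 3) * (1 + 4 * R\<^sup>2)"
    proof -
      define g where "g z = \<eta> z - (\<epsilon> * cos z + \<epsilon>\<^sup>2 * e2 * cos (2 * z))" for z
      have ct: "continuous_on circ (fser 0 t)" by (rule continuous_fser[OF decay_summable[OF t_decay]])
      have gc: "continuous_on circ g" unfolding g_def by (intro continuous_intros cont)
      have "integral circ (\<lambda>z. g z * (fser 0 t z * fser 0 t z)) \<le> integral circ (\<lambda>z. (R * E ^ 3) * (fser 0 t z * fser 0 t z))"
      proof (rule integral_le)
        show "(\<lambda>z. g z * (fser 0 t z * fser 0 t z)) integrable_on circ" "(\<lambda>z. (R * E ^ 3) * (fser 0 t z * fser 0 t z)) integrable_on circ"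
          by (intro integrable_continuous_real continuous_intros ct gc)+
        show "g z * (fser 0 t z * fser 0 t z) \<le> (R * E ^ 3) * (fser 0 t z * fser 0 t z)" for z
          using \<eta>3[of z] unfolding g_def E_def abs_le_iff by (intro mult_right_mono) auto
      qed
      also have "\<dots> = (R * E ^ 3) * (pi * (1 + s\<^sup>2))"
        using parseval[OF decay_summable[OF t_decay] decay_summable[OF t_decay], of 0] wsum_t[of "\<lambda>_. 1"]
        by (simp add: wsum_def sums_iff divide_eq_eq mult.commute)
      finally have g: "integral circ (\<lambda>z. g z * (fser 0 t z * fser 0 t z)) \<le> (R * E ^ 3) * (pi * (1 + s\<^sup>2))" .
      have "((\<lambda>z. 2 * k\<^sup>2 * ((\<epsilon> * cos z + \<epsilon>\<^sup>2 * e2 * cos (2 * z)) * (cos z + s * cos (2 * z))\<^sup>2)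
          + 2 * k\<^sup>2 * (g z * (fser 0 t z * fser 0 t z))) has_integral
          (2 * k\<^sup>2 * (pi * (\<epsilon> * s + \<epsilon>\<^sup>2 * e2 / 2)) + 2 * k\<^sup>2 * integral circ (\<lambda>z. g z * (fser 0 t z * fser 0 t z)))) circ"
        by (intro has_integral_add has_integral_mult_right cubic_trig_integral integrable_integral
            integrable_continuous_real continuous_intros ct gc)
      moreover have "(\<lambda>z. 2 * k\<^sup>2 * ((\<epsilon> * cos z + \<epsilon>\<^sup>2 * e2 * cos (2 * z)) * (cos z + s * cos (2 * z))\<^sup>2)
          + 2 * k\<^sup>2 * (g z * (fser 0 t z * fser 0 t z))) = (\<lambda>z. q z * (fser 0 t z * fser 0 t z))"
        by (rule ext) (simp add: q_def g_def fser_t power2_eq_square[of "_ + _"] left_diff_distrib right_diff_distrib)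
      ultimately have "integral circ (\<lambda>z. q z * (fser 0 t z * fser 0 t z))
          = pi * (2 * k\<^sup>2 * (\<epsilon> * s + \<epsilon>\<^sup>2 * e2 / 2)) + 2 * k\<^sup>2 * integral circ (\<lambda>z. g z * (fser 0 t z * fser 0 t z))"
        by (simp add: integral_unique mult_ac)
      also have "2 * k\<^sup>2 * (\<epsilon> * s + \<epsilon>\<^sup>2 * e2 / 2) = 5 * k\<^sup>2 * (\<epsilon>\<^sup>2 * e2)"
        by (simp add: s_def power2_eq_square algebra_simps)
      also have "2 * k\<^sup>2 * integral circ (\<lambda>z. g z * (fser 0 t z * fser 0 t z)) \<le> 2 * k\<^sup>2 * ((R * E ^ 3) * (pi * (1 + 4 * R\<^sup>2)))"
      proof (rule mult_left_mono)
        have "(R * E ^ 3) * (pi * (1 + s\<^sup>2)) \<le> (R * E ^ 3) * (pi * (1 + 4 * R\<^sup>2))"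
          using s2_le' R E by (intro mult_left_mono) auto
        with g show "integral circ (\<lambda>z. g z * (fser 0 t z * fser 0 t z)) \<le> (R * E ^ 3) * (pi * (1 + 4 * R\<^sup>2))" by simp
      qed simp
      finally have "integral circ (\<lambda>z. q z * (fser 0 t z * fser 0 t z))
          \<le> pi * (5 * k\<^sup>2 * (\<epsilon>\<^sup>2 * e2) + 2 * k\<^sup>2 * (R * E ^ 3) * (1 + 4 * R\<^sup>2))"
        by (simp add: algebra_simps)
      then show ?thesis by (simp add: pos_divide_le_eq mult.commute)
    qed
    have "form a0 q 0 t t \<le> - k\<^sup>2 * (\<epsilon>\<^sup>2 * e2) + k\<^sup>2 * (R * E ^ 3) + (- 2 * k\<^sup>2 * (\<epsilon>\<^sup>2 * e2) + 4 * E\<^sup>2 * R\<^sup>2 * (k\<^sup>2 * (R * E)))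
        + (5 * k\<^sup>2 * (\<epsilon>\<^sup>2 * e2) + 2 * k\<^sup>2 * (R * E ^ 3) * (1 + 4 * R\<^sup>2))"
      unfolding form_def wsum_t by (intro add_mono a00 a01 int)
    also have "\<dots> = k\<^sup>2 * E\<^sup>2 * (2 * e2 + E * (3 * R + 12 * R ^ 3))"
      unfolding E(3) by (simp add: algebra_simps eval_nat_numeral)
    also have "\<dots> < 0"
      using small3 e2neg pos E unfolding E_def[symmetric] by (intro mult_pos_neg) auto
    finally show ?thesis by (simp add: X_def)
  qed

  \<comment> \<open>On the test function the \<rho>-terms add
    \<open>\<rho>\<^sup>2 * (1 + s\<^sup>2 / 4)\<close>; the second bound keeps them below half of
    the negative energy.\<close>
  define \<rho> where "\<rho> = min \<rho>0 (sqrt (X / (2 * (1 + s\<^sup>2))))"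
  have s1: "1 + s\<^sup>2 > 0" by (simp add: add_pos_nonneg)
  have \<rho>: "\<rho> > 0" "\<rho> \<le> \<rho>0" using X \<rho>0 s1 by (auto simp: \<rho>_def)
  have t_neg: "form (\<lambda>n. a0 n + \<rho>\<^sup>2 / real (Suc n) ^ 2) q 0 t t < 0"
  proof -
    have "\<rho>\<^sup>2 \<le> (sqrt (X / (2 * (1 + s\<^sup>2))))\<^sup>2"
      using \<rho>(1) by (intro power_mono) (auto simp: \<rho>_def)
    also have "\<dots> = X / (2 * (1 + s\<^sup>2))" using X s1 by simp
    finally have 1: "\<rho>\<^sup>2 * (1 + s\<^sup>2) \<le> X / 2" using s1 by (simp add: field_simps)
    have "form (\<lambda>n. a0 n + \<rho>\<^sup>2 / real (Suc n) ^ 2) q 0 t t = form a0 q 0 t t + (\<rho>\<^sup>2 + s\<^sup>2 * (\<rho>\<^sup>2 / 4))"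
      by (simp add: form_def wsum_t algebra_simps)
    also have "\<dots> \<le> - X + \<rho>\<^sup>2 * (1 + s\<^sup>2)"
    proof -
      have "s\<^sup>2 * \<rho>\<^sup>2 \<ge> 0" by simp
      then show ?thesis by (simp add: X_def algebra_simps)
    qed
    finally show ?thesis using 1 X by simp
  qed
  have "unstable_forms a0 q K h \<kappa> \<rho> p t"
  proof (rule unstable_forms.intro)
    show "form_data a0 q K h" by (rule base)
    show "\<kappa> > 0" using large by (simp add: \<kappa>_def)
  qed (use \<rho> gap kernel p0 t_decay t_neg in \<open>auto simp: t_def[of 0]\<close>)
  then obtain \<Lambda> :: real where "\<Lambda> > 0" "\<not> invertible_L2 (G_graph \<beta> \<gamma> k c \<eta> (of_real \<Lambda>) \<rho>)"
    using not_invertible_if_unstable_forms[OF pos cont even] unfolding a0_def[abs_def] q_def[abs_def] by blast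
  then have "periodic_instability_at \<beta> \<gamma> k c \<eta> \<rho>"
    using \<rho> unfolding periodic_instability_at_def by (intro conjI exI[of _ "of_real \<Lambda>"]) auto
  then show ?thesis using \<rho> by (intro exI[of _ \<rho>]) auto
qed


theorem theorem1p1:
  fixes \<beta> \<gamma> k :: real
    and \<eta> :: "real \<Rightarrow> real \<Rightarrow> real \<Rightarrow> real"
    and c :: "real \<Rightarrow> real \<Rightarrow> real"
  assumes "\<gamma> > 0" and "\<beta> > 0"
    and "k > root 4 \<bar>\<gamma> / (4 * \<beta>)\<bar>"
    and "RMKP_wave_family \<beta> \<gamma> \<eta> c"
  shows "\<forall>\<rho>0>0. \<exists>\<epsilon>0>0. \<forall>\<epsilon>. 0 < \<bar>\<epsilon>\<bar> \<and> \<bar>\<epsilon>\<bar> < \<epsilon>0 \<longrightarrow>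
    (\<exists>\<rho>. 0 < \<bar>\<rho>\<bar> \<and> \<bar>\<rho>\<bar> \<le> \<rho>0 \<and>
      periodic_instability_at \<beta> \<gamma> k (c \<epsilon> k) (\<eta> \<epsilon> k) \<rho>)"
proof (intro allI impI)
  fix \<rho>0 :: real assume \<rho>0: "\<rho>0 > 0"
  have "root 4 \<bar>\<gamma> / (4 * \<beta>)\<bar> \<ge> 0" by simp
  with assms(3) have k: "k > 0" by linarith
  have k4: "\<gamma> / (4 * \<beta>) < k ^ 4"
  proof -
    have "root 4 \<bar>\<gamma> / (4 * \<beta>)\<bar> ^ 4 < k ^ 4"
      using assms(3) by (intro power_strict_mono) auto
    then show ?thesis using assms(1,2) by simp
  qed
  then have large: "4 * \<beta> * k ^ 4 > \<gamma>"
    using assms(2) by (simp add: field_simps)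
  \<comment> \<open>For \<open>n \<ge> 2\<close> every resonance lies at or below the case
    \<open>n = 2\<close>, which is the assumed lower bound on \<open>k\<close>.\<close>
  have nonres: "nonresonant \<beta> \<gamma> k"
    unfolding nonresonant_def
  proof (intro allI impI notI)
    fix n :: nat assume n: "n \<ge> 2" and eq: "k = root 4 (\<gamma> / (\<beta> * (real n)\<^sup>2))"
    have "k ^ 4 = \<gamma> / (\<beta> * (real n)\<^sup>2)"
      unfolding eq using assms(1,2) by simp
    also have "\<dots> \<le> \<gamma> / (\<beta> * 2\<^sup>2)"
      using n assms(1,2) by (intro divide_left_mono mult_left_mono power_mono) auto
    finally show False using k4 by (simp add: mult.commute)
  qed
  obtain D :: "(real \<times> real) set" where D: "open D" "(0, k) \<in> D"
    and wave: "\<And>\<epsilon>. (\<epsilon>, k) \<in> D \<Longrightarrow> solves_RMKP \<beta> \<gamma> (\<lambda>x y t. \<eta> \<epsilon> k (k * (x - c \<epsilon> k * t))) \<and>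
      periodic (\<eta> \<epsilon> k) \<and> (\<forall>z. \<eta> \<epsilon> k (- z) = \<eta> \<epsilon> k z) \<and> smooth (\<eta> \<epsilon> k)"
    and expansion: "\<exists>M. \<forall>\<^sub>F \<epsilon> in at 0. \<forall>z. \<bar>\<eta> \<epsilon> k z - (\<epsilon> * cos z + \<epsilon>\<^sup>2 * eta2 \<beta> \<gamma> k * cos (2 * z)
                       + \<epsilon> ^ 3 * eta3 \<beta> \<gamma> k * cos (3 * z))\<bar> \<le> M * \<epsilon> ^ 4"
      "(\<lambda>\<epsilon>. c \<epsilon> k - (speed0 \<beta> \<gamma> k + \<epsilon>\<^sup>2 * eta2 \<beta> \<gamma> k)) \<in> O[at 0](\<lambda>\<epsilon>. \<epsilon> ^ 4)"
    using assms(4) k nonres unfolding RMKP_wave_family_def by blast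
  define e2 e3 where "e2 = eta2 \<beta> \<gamma> k" and "e3 = eta3 \<beta> \<gamma> k"
  obtain M where M: "\<forall>\<^sub>F \<epsilon> in at 0. \<forall>z. \<bar>\<eta> \<epsilon> k z - (\<epsilon> * cos z + \<epsilon>\<^sup>2 * e2 * cos (2 * z) + \<epsilon> ^ 3 * e3 * cos (3 * z))\<bar> \<le> M * \<epsilon> ^ 4"
    using expansion(1) unfolding e2_def e3_def by blast
  obtain M' where M': "\<forall>\<^sub>F \<epsilon> in at 0. norm (c \<epsilon> k - (speed0 \<beta> \<gamma> k + \<epsilon>\<^sup>2 * e2)) \<le> M' * norm (\<epsilon> ^ 4)"
    using landau_o.bigE[OF expansion(2)] unfolding e2_def by blast
  \<comment> \<open>One constant large enough for all the bounds on profile and speed, using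
    \<open>\<bar>\<epsilon>\<bar> \<le> 1\<close> to lower the powers of \<epsilon>.\<close>
  define R where "R = 1 + \<bar>e2\<bar> + \<bar>e3\<bar> + \<bar>M\<bar> + \<bar>M'\<bar>"
  have R: "R \<ge> 1" "\<bar>e2\<bar> \<le> R" by (auto simp: R_def)
  have e2: "e2 = 2 * k\<^sup>2 / (3 * \<gamma> - 12 * \<beta> * k ^ 4)"
    by (simp add: e2_def eta2_def)
  have e2_twice: "2 * \<bar>e2\<bar> > 0" unfolding e2 using k large by simp
  have in_D: "\<forall>\<^sub>F \<epsilon> in at 0. (\<epsilon>, k) \<in> D"
  proof -
    have "((\<lambda>\<epsilon>. (\<epsilon>, k)) \<longlongrightarrow> (0, k)) (at (0 :: real))" by (intro tendsto_intros)
    from topological_tendstoD[OF this D] show ?thesis .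
  qed
  have to_0: "((\<lambda>\<epsilon>. C * \<bar>\<epsilon>\<bar> ^ n) \<longlongrightarrow> 0) (at 0)" if "n > 0" for C :: real and n
    using that by (auto intro!: tendsto_eq_intros)
  have small: "\<forall>\<^sub>F \<epsilon> in at 0. C * \<bar>\<epsilon>\<bar> ^ n < X" if "n > 0" "X > 0" for C X :: real and n
    using order_tendstoD(2)[OF to_0[OF that(1)] that(2)] .
  have gap: "3 * (4 * \<beta> * k ^ 4 - \<gamma>) / 8 > 0" using large by simp
  have "\<forall>\<^sub>F \<epsilon> in at 0. \<exists>\<rho>. 0 < \<bar>\<rho>\<bar> \<and> \<bar>\<rho>\<bar> \<le> \<rho>0 \<and> periodic_instability_at \<beta> \<gamma> k (c \<epsilon> k) (\<eta> \<epsilon> k) \<rho>"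
    using in_D M M' small[OF zero_less_one zero_less_one, of 1] small[OF zero_less_one gap, of "3 * k\<^sup>2 * R"]
      small[OF pos2 zero_less_one, of "2 * R"] small[OF zero_less_one e2_twice, of "3 * R + 12 * R ^ 3"]
      eventually_neq_at_within[of 0 0 UNIV]
  proof eventually_elim
    case (elim \<epsilon>)
    have \<epsilon>1: "\<bar>\<epsilon>\<bar> \<le> 1" and \<epsilon>0: "\<epsilon> \<noteq> 0" using elim by auto
    note w = wave[OF elim(1)]
    have powers: "\<bar>\<epsilon>\<bar> ^ 4 \<le> \<bar>\<epsilon>\<bar> ^ 3" "\<bar>\<epsilon>\<bar> ^ 3 \<le> \<bar>\<epsilon>\<bar>" "\<epsilon>\<^sup>2 \<le> \<bar>\<epsilon>\<bar>" "\<epsilon> ^ 4 = \<bar>\<epsilon>\<bar> ^ 4"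
      using power_decreasing[of 3 4 "\<bar>\<epsilon>\<bar>"] power_decreasing[of 1 3 "\<bar>\<epsilon>\<bar>"] power_decreasing[of 1 2 "\<bar>\<epsilon>\<bar>"] \<epsilon>1
      by simp_all
    have E3: "\<bar>\<eta> \<epsilon> k z - (\<epsilon> * cos z + \<epsilon>\<^sup>2 * e2 * cos (2 * z))\<bar> \<le> (\<bar>e3\<bar> + \<bar>M\<bar>) * \<bar>\<epsilon>\<bar> ^ 3" for z
    proof -
      have "\<bar>\<epsilon> ^ 3 * e3 * cos (3 * z)\<bar> \<le> \<bar>e3\<bar> * \<bar>\<epsilon>\<bar> ^ 3"
        by (simp add: abs_mult power_abs mult_left_le mult.commute[of "\<bar>e3\<bar>"])
      moreover have "M * \<epsilon> ^ 4 \<le> \<bar>M\<bar> * \<bar>\<epsilon>\<bar> ^ 3"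
        unfolding powers(4) by (intro mult_mono powers) auto
      moreover have "\<bar>\<eta> \<epsilon> k z - (\<epsilon> * cos z + \<epsilon>\<^sup>2 * e2 * cos (2 * z) + \<epsilon> ^ 3 * e3 * cos (3 * z))\<bar> \<le> M * \<epsilon> ^ 4"
        using elim(2) by blast
      ultimately show ?thesis unfolding distrib_right by linarith
    qed
    have E1: "\<bar>\<eta> \<epsilon> k z\<bar> \<le> R * \<bar>\<epsilon>\<bar>" for z
    proof -
      have "\<bar>\<epsilon> * cos z\<bar> \<le> \<bar>\<epsilon>\<bar> * 1" unfolding abs_mult by (intro mult_left_mono) auto
      moreover have "\<bar>\<epsilon>\<^sup>2 * e2 * cos (2 * z)\<bar> \<le> \<bar>\<epsilon>\<bar> * \<bar>e2\<bar> * 1"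
        unfolding abs_mult using powers(3) by (intro mult_mono) auto
      moreover have "(\<bar>e3\<bar> + \<bar>M\<bar>) * \<bar>\<epsilon>\<bar> ^ 3 \<le> (\<bar>e3\<bar> + \<bar>M\<bar>) * \<bar>\<epsilon>\<bar>"
        by (intro mult_left_mono powers) auto
      ultimately have "\<bar>\<eta> \<epsilon> k z\<bar> \<le> \<bar>\<epsilon>\<bar> * 1 + \<bar>\<epsilon>\<bar> * \<bar>e2\<bar> * 1 + (\<bar>e3\<bar> + \<bar>M\<bar>) * \<bar>\<epsilon>\<bar>"
        using E3[of z] by linarith
      also have "\<dots> = (1 + \<bar>e2\<bar> + \<bar>e3\<bar> + \<bar>M\<bar>) * \<bar>\<epsilon>\<bar>" by (simp add: algebra_simps)
      also have "\<dots> \<le> R * \<bar>\<epsilon>\<bar>" by (intro mult_right_mono) (auto simp: R_def)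
      finally show ?thesis .
    qed
    have E3': "(\<bar>e3\<bar> + \<bar>M\<bar>) * \<bar>\<epsilon>\<bar> ^ 3 \<le> R * \<bar>\<epsilon>\<bar> ^ 3"
      by (intro mult_right_mono) (auto simp: R_def)
    have C3: "\<bar>c \<epsilon> k - (\<gamma> / k\<^sup>2 + \<beta> * k\<^sup>2 + \<epsilon>\<^sup>2 * e2)\<bar> \<le> \<bar>M'\<bar> * \<bar>\<epsilon>\<bar> ^ 3"
    proof -
      have "\<bar>c \<epsilon> k - (\<gamma> / k\<^sup>2 + \<beta> * k\<^sup>2 + \<epsilon>\<^sup>2 * e2)\<bar> \<le> M' * \<bar>\<epsilon>\<bar> ^ 4"
        using elim(3) by (simp add: speed0_def power_abs)
      also have "\<dots> \<le> \<bar>M'\<bar> * \<bar>\<epsilon>\<bar> ^ 3" by (intro mult_mono powers) auto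
      finally show ?thesis .
    qed
    have C1: "\<bar>c \<epsilon> k - (\<gamma> / k\<^sup>2 + \<beta> * k\<^sup>2)\<bar> \<le> R * \<bar>\<epsilon>\<bar>"
    proof -
      have "\<bar>\<epsilon>\<^sup>2 * e2\<bar> \<le> \<bar>\<epsilon>\<bar> * \<bar>e2\<bar>" unfolding abs_mult using powers(3) by (intro mult_right_mono) auto
      moreover have "\<bar>M'\<bar> * \<bar>\<epsilon>\<bar> ^ 3 \<le> \<bar>M'\<bar> * \<bar>\<epsilon>\<bar>" by (intro mult_left_mono powers) auto
      ultimately have "\<bar>c \<epsilon> k - (\<gamma> / k\<^sup>2 + \<beta> * k\<^sup>2)\<bar> \<le> \<bar>\<epsilon>\<bar> * \<bar>e2\<bar> + \<bar>M'\<bar> * \<bar>\<epsilon>\<bar>"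
        using C3 by linarith
      also have "\<dots> = (\<bar>e2\<bar> + \<bar>M'\<bar>) * \<bar>\<epsilon>\<bar>" by (simp add: algebra_simps)
      also have "\<dots> \<le> R * \<bar>\<epsilon>\<bar>" by (intro mult_right_mono) (auto simp: R_def)
      finally show ?thesis .
    qed
    have C3': "\<bar>M'\<bar> * \<bar>\<epsilon>\<bar> ^ 3 \<le> R * \<bar>\<epsilon>\<bar> ^ 3"
      by (intro mult_right_mono) (auto simp: R_def)
    show ?case
    proof (rule instability_of_small_wave[OF assms(2,1) k large e2 _ _ _ _ \<epsilon>0 \<epsilon>1 R E1 _ C1 _ _ _ _ \<rho>0])
      show "\<bar>\<eta> \<epsilon> k z - (\<epsilon> * cos z + \<epsilon>\<^sup>2 * e2 * cos (2 * z))\<bar> \<le> R * \<bar>\<epsilon>\<bar> ^ 3" for z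
        using E3 E3' by (rule order.trans)
      show "\<bar>c \<epsilon> k - (\<gamma> / k\<^sup>2 + \<beta> * k\<^sup>2 + \<epsilon>\<^sup>2 * e2)\<bar> \<le> R * \<bar>\<epsilon>\<bar> ^ 3"
        using C3 C3' by (rule order.trans)
      show "solves_RMKP \<beta> \<gamma> (\<lambda>x y t. \<eta> \<epsilon> k (k * (x - c \<epsilon> k * t)))" "smooth (\<eta> \<epsilon> k)" "periodic (\<eta> \<epsilon> k)"
        "\<eta> \<epsilon> k (- z) = \<eta> \<epsilon> k z" for z
        using w by auto
      show "3 * k\<^sup>2 * R * \<bar>\<epsilon>\<bar> \<le> 3 * (4 * \<beta> * k ^ 4 - \<gamma>) / 8"
        using elim(5) unfolding power_one_right by (rule less_imp_le)
      show "2 * R * \<bar>\<epsilon>\<bar>\<^sup>2 < 1" by (rule elim(6))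
      show "\<bar>\<epsilon>\<bar> * (3 * R + 12 * R ^ 3) < 2 * \<bar>e2\<bar>"
        using elim(7) by (simp add: mult.commute)
    qed
  qed
  then show "\<exists>\<epsilon>0>0. \<forall>\<epsilon>. 0 < \<bar>\<epsilon>\<bar> \<and> \<bar>\<epsilon>\<bar> < \<epsilon>0 \<longrightarrow>
    (\<exists>\<rho>. 0 < \<bar>\<rho>\<bar> \<and> \<bar>\<rho>\<bar> \<le> \<rho>0 \<and> periodic_instability_at \<beta> \<gamma> k (c \<epsilon> k) (\<eta> \<epsilon> k) \<rho>)"
    unfolding eventually_at by (simp add: dist_real_def)
qed

end
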